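(* Below $H$ takes an argument of type $1$ and an argument of type $0$ to a value of type $0$. Let - (UWC): there is $\Psi^{(1\times2)\to(0\times0)}$ such that for all $H,\psi^2$: $(\forall f^1)(H(f,\psi(f))=0)\to(\forall f^1,g^1)\big(\overline f\,\Psi(f,\psi)(1)=\overline g\,\Psi(f,\psi)(1)\to H(g,\Psi(f,\psi)(2))=0\big)$; - (WC$^*$): $(\forall^{\mathrm{st}}H)\big[(\forall^{\mathrm{st}}f^1)(\exists^{\mathrm{st}}n^0)(H(f,n)=0)\to(\forall^{\mathrm{st}}f^1)(\exists^{\mathrm{st}}m^0,x^0)(\forall g^1)(\overline fm=\overline gm\to H(g,x)=0)\big]$; - ($\mathfrak{WC}$): $(\forall^{\mathrm{st}}H)\big[(\forall^{\mathrm{st}}f^1)(\exists^{\mathrm{st}}n^0)(H(f,n)=0)\to(\forall^{\mathrm{st}}f^1)(\exists^{\mathrm{st}}x^0)(\forall g^1)(f\approx_1g\to H(g,x)=0)\big]$; - (CONT): $(\exists\Psi^3)(\forall\varphi^2,f^1,g^1)[\overline f\,\Psi(\varphi,f)=\overline g\,\Psi(\varphi,f)\to\varphi(f)=\varphi(g)]$; - ($\mathfrak{CO}$): $(\forall^{\mathrm{st}}\varphi^2,f^1)(\forall g^1)[f\approx_1g\to\varphi(f)=\varphi(g)]$; - (CO$^*$): $(\forall^{\mathrm{st}}\varphi^2,f^1)(\exists^{\mathrm{st}}N^0)(\forall g^1)[\overline fN=\overline gN\to\varphi(f)=\varphi(g)]$. Then $\mathrm{RCA}_0^\Omega$ proves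 \[ \mathrm{UWC}\leftrightarrow\mathrm{UWC}^{\mathrm{st}}\leftrightarrow\mathrm{WC}^*\leftrightarrow\mathfrak{WC}\leftrightarrow\mathrm{CONT}\leftrightarrow\mathrm{CONT}^{\mathrm{st}}\leftrightarrow\mathfrak{CO}\leftrightarrow\mathrm{CO}^* . \]
   Context: Types: $0$ is the type of natural numbers, $\sigma\to\tau$ that of functionals from type $\sigma$ to type $\tau$; $1:=0\to0$, $2:=1\to0$, $3:=2\to0$. Superscripts indicate types; finitely many arguments or values are combined by standard currying/coding (so a functional taking arguments of type $2$ and $1$ to type $0$ is also given type $3$); $(1)$ and $(2)$ denote the components of a pair. For $f,g$ of type $1$, $f\le_1g$ means $(\forall n^0)(f(n)\le g(n))$; `$f\le_11$' says that $f$ is a $0/1$-sequence; $\overline fn$ is (the code of) $\langle f(0),\dots,f(n-1)\rangle$; $\sigma*00\dots$ extends the finite sequence $\sigma$ by zeros. $\mathrm{RCA}_0^\omega$ (Kohlenbach) is $\mathrm{E\text{-}PRA}^\omega+\mathrm{QF\text{-}AC}^{1,0}$. Here $\mathrm{E\text{-}PRA}^\omega$ is classical arithmetic in all finite types with primitive equality $=_0$ only at type $0$ (at higher type, $x=_\tau y$ is defined as $xz_1\dots z_k=_0yz_1\dots z_k$ for all $z_i$), constants for zero, successor, the combinators and primitive recursion with values of type $0$, quantifier-free induction, and the extensionality axiom $x=_\rho y\to\varphi(x)=_\tau\varphi(y)$ for all $\varphi^{\rho\to\tau}$. $\mathrm{QF\text{-}AC}^{\sigma,0}$ is the schema $(\forall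 x^\sigma)(\exists n^0)A_0(x,n)\to(\exists F^{\sigma\to0})(\forall x^\sigma)A_0(x,F(x))$ for quantifier-free $A_0$. $\mathrm{RCA}_0^\Omega$ is $\mathrm{E\text{-}PRA}^{\omega*}_{\mathrm{st}}+\mathrm{QF\text{-}AC}^{1,0}+\mathrm I+\mathrm{HAC}_{\mathrm{int}}+\mathrm{PF\text{-}TP}_\forall$ plus the constant axioms below. The language adds a type $\sigma^*$ of finite sequences of objects of type $\sigma$ and, for each type, a predicate $\mathrm{st}(x)$ (`$x$ is standard'). $(\forall^{\mathrm{st}}x)\Phi$ is $(\forall x)(\mathrm{st}(x)\to\Phi)$ and $(\exists^{\mathrm{st}}x)\Phi$ is $(\exists x)(\mathrm{st}(x)\wedge\Phi)$. A formula is internal if `st' does not occur in it; $A^{\mathrm{st}}$ is obtained from $A$ by appending `st' to all quantifiers except bounded number quantifiers. For $f,g$ of type $1$, $f\approx_1g$ means $(\forall^{\mathrm{st}}n^0)(f(n)=g(n))$. Basic axioms of $\mathrm{E\text{-}PRA}^{\omega*}_{\mathrm{st}}$: $\mathrm{st}(x)\wedge x=y\to\mathrm{st}(y)$; $\mathrm{st}(t)$ for closed terms $t$; $\mathrm{st}(f)\wedge\mathrm{st}(x)\to\mathrm{st}(f(x))$; numbers below a standard number are standard. I (for internal $\varphi$): $(\forall^{\mathrm{st}}x^{\sigma^*})(\exists y^\tau)(\forall z^\sigma\in x)\varphi(z,y)\to(\exists y^\tau)(\forall^{\mathrm{st}}x^\sigma)\varphi(x,y)$. $\mathrm{HAC}_{\mathrm{int}}$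 (for internal $\varphi$): $(\forall^{\mathrm{st}}x^\rho)(\exists^{\mathrm{st}}y^\tau)\varphi(x,y)\to(\exists^{\mathrm{st}}F^{\rho\to\tau^*})(\forall^{\mathrm{st}}x^\rho)(\exists y^\tau\in F(x))\varphi(x,y)$. $\mathrm{PF\text{-}TP}_\forall$: $(\forall^{\mathrm{st}}x^\tau)\varphi(x)\to(\forall x^\tau)\varphi(x)$ for internal $\varphi(x)$ with no parameters other than $x$. Constant axioms: (i) there is a constant $\Omega_0$ with $\mathrm{st}(\Omega_0)\wedge(\forall^{\mathrm{st}}\Xi^3)[M^{\mathrm{st}}(\Xi)\to(\forall^{\mathrm{st}}\varphi^2)(\Omega_0(\varphi)=\Xi(\varphi))]$, where $M(\Xi)$ says that for all $\varphi^2$, $\Xi(\varphi)$ is the least $n$ with $(\forall f,g\le_11)(\overline fn=\overline gn\to\varphi(f)=\varphi(g))$; and analogous constants and axioms for other functionals uniquely defined by a parameter-free internal formula; (ii) there is a constant $\Lambda_0^3$ with $\mathrm{st}(\Lambda_0)$ and $(\forall^{\mathrm{st}}\Upsilon^3)[K^{\mathrm{st}}(\Upsilon)\to(\forall^{\mathrm{st}}\varphi^2,f^1\le_11)(\Xi(\varphi,\Upsilon(\varphi,\cdot))(\overline f\Lambda_0(\varphi,f))=\varphi(f)+1)]$, where $K(\Upsilon)$ is $(\forall\varphi^2,f^1,g^1\le_11)(\overline f\Upsilon(\varphi,f)=\overline g\Upsilon(\varphi,f)\to\varphi(f)=\varphi(g))$ and $\Xi(\varphi,\omega)$ is the associate of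 $\varphi$ computed from a modulus $\omega$: $\Xi(\varphi,\omega)(\sigma)=\varphi(\sigma*00\dots)+1$ if $\omega(\sigma*00\dots)\le|\sigma|$, and $0$ otherwise; (iii) for this theorem, the version of (ii) corresponding to (CONT) is also assumed to be part of $\mathrm{RCA}_0^\Omega$: a further constant $\Lambda_1^3$ with the same axiom, where the restrictions `$\le_11$' are dropped both in $K$ and in the conclusion. *)

theory Defs
  imports Main
begin

section \<open>Finite types, terms and formulas\<close>

datatype ty = N | Fun ty ty  (infixr "\<^bold>\<rightarrow>" 65) | Star ty

abbreviation T1 :: ty where "T1 \<equiv> N \<^bold>\<rightarrow> N"
abbreviation T2 :: ty where "T2 \<equiv> T1 \<^bold>\<rightarrow> N"
abbreviation T3 :: ty where "T3 \<equiv> T2 \<^bold>\<rightarrow> N"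

type_synonym var = "string \<times> ty"

text \<open>
  Locally nameless syntax: free variables are named and carry their type, variables bound by a
  quantifier are de Bruijn indices.

  The type \<open>Star \<sigma>\<close> of finite sequences is the definitional extension in which a sequence is given
  by its length and a function on indices: \<open>Len \<sigma>\<close> is the length, \<open>Prj \<sigma> x i\<close> is the \<open>i\<close>-th entry
  of \<open>x\<close>, and \<open>Mk \<sigma> n f\<close> is the sequence \<open>f 0, \<dots>, f (n - 1)\<close>.

  \<open>Def \<tau> A\<close> is the constant for the functional of type \<open>\<tau>\<close> uniquely defined by the formula \<open>A\<close>,
  whose only variable is the index \<open>Bnd 0\<close>; being a constant, it has no free variables, and the
  operations on terms below do not enter \<open>A\<close>. Without the side conditions in \<open>RCA0_Omega\<close> below it
  is an arbitrary standard object.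

  The bounded number quantifier \<open>BAll t A\<close> is a separate constructor because relativisation
  to \<open>st\<close> treats it differently. Its body binds index 0 (of type \<open>N\<close>), its bound \<open>t\<close> does not.
\<close>

datatype trm =
    V var
  | Bnd nat
  | App trm trm  (infixl "\<cdot>" 90)
  | Zero
  | Succ
  | Kc ty ty
  | Sc ty ty ty
  | Rec
  | Len ty
  | Prj ty
  | Mk ty
  | Omega0
  | Lambda0
  | Lambda1
  | Def ty fm
and fm =
    Eq trm trm  (infix "\<^bold>=" 50)
  | St ty trm
  | Fls
  | Imp fm fm  (infixr "\<^bold>\<longrightarrow>" 25)
  | All ty fm
  | BAll trm fm

text \<open>The list gives the types of the dangling indices.\<close>

fun tyof :: "ty list \<Rightarrow> trm \<Rightarrow> ty option" where
  "tyof \<Delta> (V v) = Some (snd v)"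
| "tyof \<Delta> (Bnd i) = (if i < length \<Delta> then Some (\<Delta> ! i) else None)"
| "tyof \<Delta> (s \<cdot> t) =
     (case tyof \<Delta> s of
        Some (\<sigma> \<^bold>\<rightarrow> \<tau>) \<Rightarrow> if tyof \<Delta> t = Some \<sigma> then Some \<tau> else None
      | _ \<Rightarrow> None)"
| "tyof \<Delta> Zero = Some N"
| "tyof \<Delta> Succ = Some (N \<^bold>\<rightarrow> N)"
| "tyof \<Delta> (Kc \<sigma> \<tau>) = Some (\<sigma> \<^bold>\<rightarrow> \<tau> \<^bold>\<rightarrow> \<sigma>)"
| "tyof \<Delta> (Sc \<rho> \<sigma> \<tau>) = Some ((\<rho> \<^bold>\<rightarrow> \<sigma> \<^bold>\<rightarrow> \<tau>) \<^bold>\<rightarrow> (\<rho> \<^bold>\<rightarrow> \<sigma>) \<^bold>\<rightarrow> \<rho> \<^bold>\<rightarrow> \<tau>)"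
| "tyof \<Delta> Rec = Some (N \<^bold>\<rightarrow> N \<^bold>\<rightarrow> (N \<^bold>\<rightarrow> N \<^bold>\<rightarrow> N) \<^bold>\<rightarrow> N)"
| "tyof \<Delta> (Len \<sigma>) = Some (Star \<sigma> \<^bold>\<rightarrow> N)"
| "tyof \<Delta> (Prj \<sigma>) = Some (Star \<sigma> \<^bold>\<rightarrow> N \<^bold>\<rightarrow> \<sigma>)"
| "tyof \<Delta> (Mk \<sigma>) = Some (N \<^bold>\<rightarrow> (N \<^bold>\<rightarrow> \<sigma>) \<^bold>\<rightarrow> Star \<sigma>)"
| "tyof \<Delta> Omega0 = Some T3"
| "tyof \<Delta> Lambda0 = Some (T2 \<^bold>\<rightarrow> T1 \<^bold>\<rightarrow> N)"
| "tyof \<Delta> Lambda1 = Some (T2 \<^bold>\<rightarrow> T1 \<^bold>\<rightarrow> N)"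
| "tyof \<Delta> (Def \<tau> A) = Some \<tau>"

abbreviation has_ty :: "trm \<Rightarrow> ty \<Rightarrow> bool"  (infix "\<^bold>:" 50) where
  "t \<^bold>: \<tau> \<equiv> tyof [] t = Some \<tau>"

fun wf_fm :: "ty list \<Rightarrow> fm \<Rightarrow> bool" where
  "wf_fm \<Delta> (s \<^bold>= t) \<longleftrightarrow> tyof \<Delta> s = Some N \<and> tyof \<Delta> t = Some N"
| "wf_fm \<Delta> (St \<tau> t) \<longleftrightarrow> tyof \<Delta> t = Some \<tau>"
| "wf_fm \<Delta> Fls \<longleftrightarrow> True"
| "wf_fm \<Delta> (A \<^bold>\<longrightarrow> B) \<longleftrightarrow> wf_fm \<Delta> A \<and> wf_fm \<Delta> B"
| "wf_fm \<Delta> (All \<tau> A) \<longleftrightarrow> wf_fm (\<tau> # \<Delta>) A"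
| "wf_fm \<Delta> (BAll t A) \<longleftrightarrow> tyof \<Delta> t = Some N \<and> wf_fm (N # \<Delta>) A"

abbreviation wff :: "fm \<Rightarrow> bool" where "wff \<equiv> wf_fm []"

fun fv_trm :: "trm \<Rightarrow> var set" where
  "fv_trm (V v) = {v}"
| "fv_trm (s \<cdot> t) = fv_trm s \<union> fv_trm t"
| "fv_trm _ = {}"

fun fv :: "fm \<Rightarrow> var set" where
  "fv (s \<^bold>= t) = fv_trm s \<union> fv_trm t"
| "fv (St \<tau> t) = fv_trm t"
| "fv Fls = {}"
| "fv (A \<^bold>\<longrightarrow> B) = fv A \<union> fv B"
| "fv (All \<tau> A) = fv A"
| "fv (BAll t A) = fv_trm t \<union> fv A"

fun close_trm :: "var \<Rightarrow> nat \<Rightarrow> trm \<Rightarrow> trm" where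
  "close_trm v k (V w) = (if w = v then Bnd k else V w)"
| "close_trm v k (s \<cdot> t) = close_trm v k s \<cdot> close_trm v k t"
| "close_trm v k t = t"

fun close_fm :: "var \<Rightarrow> nat \<Rightarrow> fm \<Rightarrow> fm" where
  "close_fm v k (s \<^bold>= t) = (close_trm v k s \<^bold>= close_trm v k t)"
| "close_fm v k (St \<tau> t) = St \<tau> (close_trm v k t)"
| "close_fm v k Fls = Fls"
| "close_fm v k (A \<^bold>\<longrightarrow> B) = (close_fm v k A \<^bold>\<longrightarrow> close_fm v k B)"
| "close_fm v k (All \<tau> A) = All \<tau> (close_fm v (Suc k) A)"
| "close_fm v k (BAll t A) = BAll (close_trm v k t) (close_fm v (Suc k) A)"

text \<open>Opening is used only with terms \<open>u\<close> that have no dangling indices.\<close>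

fun open_trm :: "nat \<Rightarrow> trm \<Rightarrow> trm \<Rightarrow> trm" where
  "open_trm k u (Bnd i) = (if i = k then u else Bnd i)"
| "open_trm k u (s \<cdot> t) = open_trm k u s \<cdot> open_trm k u t"
| "open_trm k u t = t"

fun open_fm :: "nat \<Rightarrow> trm \<Rightarrow> fm \<Rightarrow> fm" where
  "open_fm k u (s \<^bold>= t) = (open_trm k u s \<^bold>= open_trm k u t)"
| "open_fm k u (St \<tau> t) = St \<tau> (open_trm k u t)"
| "open_fm k u Fls = Fls"
| "open_fm k u (A \<^bold>\<longrightarrow> B) = (open_fm k u A \<^bold>\<longrightarrow> open_fm k u B)"
| "open_fm k u (All \<tau> A) = All \<tau> (open_fm (Suc k) u A)"
| "open_fm k u (BAll t A) = BAll (open_trm k u t) (open_fm (Suc k) u A)"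

definition subst :: "fm \<Rightarrow> var \<Rightarrow> trm \<Rightarrow> fm"  ("_\<lbrakk>_ ::= _\<rbrakk>" [1000, 0, 0] 1000) where
  "A\<lbrakk>v ::= u\<rbrakk> = open_fm 0 u (close_fm v 0 A)"

fun lift_trm :: "trm \<Rightarrow> trm" where
  "lift_trm (Bnd i) = Bnd (Suc i)"
| "lift_trm (s \<cdot> t) = lift_trm s \<cdot> lift_trm t"
| "lift_trm t = t"

definition Neg :: "fm \<Rightarrow> fm"  ("\<^bold>\<not> _" [40] 40) where
  "(\<^bold>\<not> A) = (A \<^bold>\<longrightarrow> Fls)"

definition And :: "fm \<Rightarrow> fm \<Rightarrow> fm"  (infixr "\<^bold>\<and>" 35) where
  "(A \<^bold>\<and> B) = (\<^bold>\<not> (A \<^bold>\<longrightarrow> \<^bold>\<not> B))"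

definition Iff :: "fm \<Rightarrow> fm \<Rightarrow> fm"  (infix "\<^bold>\<longleftrightarrow>" 24) where
  "(A \<^bold>\<longleftrightarrow> B) = ((A \<^bold>\<longrightarrow> B) \<^bold>\<and> (B \<^bold>\<longrightarrow> A))"

definition fall :: "var \<Rightarrow> fm \<Rightarrow> fm"  ("(3\<^bold>\<forall>_./ _)" [1000, 20] 20) where
  "(\<^bold>\<forall>v. A) = All (snd v) (close_fm v 0 A)"

definition fex :: "var \<Rightarrow> fm \<Rightarrow> fm"  ("(3\<^bold>\<exists>_./ _)" [1000, 20] 20) where
  "(\<^bold>\<exists>v. A) = (\<^bold>\<not> (\<^bold>\<forall>v. \<^bold>\<not> A))"

definition fall_st :: "var \<Rightarrow> fm \<Rightarrow> fm"  ("(3\<^bold>\<forall>\<^sup>s\<^sup>t _./ _)" [1000, 20] 20) where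
  "(\<^bold>\<forall>\<^sup>s\<^sup>t v. A) = (\<^bold>\<forall>v. St (snd v) (V v) \<^bold>\<longrightarrow> A)"

definition fex_st :: "var \<Rightarrow> fm \<Rightarrow> fm"  ("(3\<^bold>\<exists>\<^sup>s\<^sup>t _./ _)" [1000, 20] 20) where
  "(\<^bold>\<exists>\<^sup>s\<^sup>t v. A) = (\<^bold>\<exists>v. St (snd v) (V v) \<^bold>\<and> A)"

definition fball :: "var \<Rightarrow> trm \<Rightarrow> fm \<Rightarrow> fm"  ("(3\<^bold>\<forall>_\<^bold><_./ _)" [1000, 51, 20] 20) where
  "(\<^bold>\<forall>i\<^bold><t. A) = BAll t (close_fm i 0 A)"

definition fbex :: "var \<Rightarrow> trm \<Rightarrow> fm \<Rightarrow> fm"  ("(3\<^bold>\<exists>_\<^bold><_./ _)" [1000, 51, 20] 20) where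
  "(\<^bold>\<exists>i\<^bold><t. A) = (\<^bold>\<not> (\<^bold>\<forall>i\<^bold><t. \<^bold>\<not> A))"

primrec internal :: "fm \<Rightarrow> bool" where
  "internal (s \<^bold>= t) \<longleftrightarrow> True"
| "internal (St \<tau> t) \<longleftrightarrow> False"
| "internal Fls \<longleftrightarrow> True"
| "internal (A \<^bold>\<longrightarrow> B) \<longleftrightarrow> internal A \<and> internal B"
| "internal (All \<tau> A) \<longleftrightarrow> internal A"
| "internal (BAll t A) \<longleftrightarrow> internal A"

text \<open>Internal and without quantifiers, bounded ones included.\<close>

primrec qfree :: "fm \<Rightarrow> bool" where
  "qfree (s \<^bold>= t) \<longleftrightarrow> True"
| "qfree (St \<tau> t) \<longleftrightarrow> False"
| "qfree Fls \<longleftrightarrow> True"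
| "qfree (A \<^bold>\<longrightarrow> B) \<longleftrightarrow> qfree A \<and> qfree B"
| "qfree (All \<tau> A) \<longleftrightarrow> False"
| "qfree (BAll t A) \<longleftrightarrow> False"

text \<open>The relativisation \<open>A\<^sup>s\<^sup>t\<close>; on \<open>\<^bold>\<exists>\<close>, which is \<open>\<^bold>\<not>\<^bold>\<forall>\<^bold>\<not>\<close>, it yields \<open>\<^bold>\<not>\<^bold>\<forall>x. st x \<^bold>\<longrightarrow> \<^bold>\<not> \<dots>\<close>.\<close>

primrec rel :: "fm \<Rightarrow> fm" where
  "rel (s \<^bold>= t) = (s \<^bold>= t)"
| "rel (St \<tau> t) = St \<tau> t"
| "rel Fls = Fls"
| "rel (A \<^bold>\<longrightarrow> B) = (rel A \<^bold>\<longrightarrow> rel B)"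
| "rel (All \<tau> A) = All \<tau> (St \<tau> (Bnd 0) \<^bold>\<longrightarrow> rel A)"
| "rel (BAll t A) = BAll t (rel A)"

text \<open>
  Equality at all types. At function types it is pointwise; two sequences are equal if they have the
  same length and the same entries.
\<close>

primrec eqf :: "ty \<Rightarrow> trm \<Rightarrow> trm \<Rightarrow> fm" where
  "eqf N s t = (s \<^bold>= t)"
| "eqf (\<sigma> \<^bold>\<rightarrow> \<tau>) s t = All \<sigma> (eqf \<tau> (lift_trm s \<cdot> Bnd 0) (lift_trm t \<cdot> Bnd 0))"
| "eqf (Star \<sigma>) s t =
     ((Len \<sigma> \<cdot> s \<^bold>= Len \<sigma> \<cdot> t) \<^bold>\<and>
      BAll (Len \<sigma> \<cdot> s) (eqf \<sigma> (Prj \<sigma> \<cdot> lift_trm s \<cdot> Bnd 0) (Prj \<sigma> \<cdot> lift_trm t \<cdot> Bnd 0)))"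


section \<open>Closed terms\<close>

text \<open>Bracket abstraction, for well-typed terms without dangling indices.\<close>

definition const_trm :: "ty \<Rightarrow> trm \<Rightarrow> trm" where
  "const_trm \<sigma> t = Kc (the (tyof [] t)) \<sigma> \<cdot> t"

fun lam :: "var \<Rightarrow> trm \<Rightarrow> trm"  ("(3\<^bold>\<lambda>_./ _)" [1000, 20] 20) where
  "(\<^bold>\<lambda>v. s \<cdot> t) =
     (if v \<notin> fv_trm (s \<cdot> t) then const_trm (snd v) (s \<cdot> t)
      else Sc (snd v) (the (tyof [] t)) (the (tyof [] (s \<cdot> t))) \<cdot> (\<^bold>\<lambda>v. s) \<cdot> (\<^bold>\<lambda>v. t))"
| "(\<^bold>\<lambda>v. V w) =
     (if w = v
      then Sc (snd v) (snd v \<^bold>\<rightarrow> snd v) (snd v) \<cdot> Kc (snd v) (snd v \<^bold>\<rightarrow> snd v) \<cdot> Kc (snd v) (snd v)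
      else const_trm (snd v) (V w))"
| "(\<^bold>\<lambda>v. t) = const_trm (snd v) t"

abbreviation "vi \<equiv> (''i'', N)"
abbreviation "vm \<equiv> (''m'', N)"
abbreviation "vn \<equiv> (''n'', N)"
abbreviation "vr \<equiv> (''r'', N)"
abbreviation "vx \<equiv> (''x'', N)"
abbreviation "vN \<equiv> (''N'', N)"
abbreviation "vf \<equiv> (''f'', T1)"
abbreviation "vg \<equiv> (''g'', T1)"
abbreviation "vphi \<equiv> (''phi'', T2)"
abbreviation "vpsi \<equiv> (''psi'', T2)"
abbreviation "vom \<equiv> (''omega'', T2)"
abbreviation "vH \<equiv> (''H'', T1 \<^bold>\<rightarrow> N \<^bold>\<rightarrow> N)"
abbreviation "vsig \<equiv> (''sigma'', Star N)"
abbreviation "vXi \<equiv> (''Xi'', T3)"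
abbreviation "vUps \<equiv> (''Upsilon'', T2 \<^bold>\<rightarrow> T1 \<^bold>\<rightarrow> N)"
abbreviation "vPsi1 \<equiv> (''Psi1'', T1 \<^bold>\<rightarrow> T2 \<^bold>\<rightarrow> N)"
abbreviation "vPsi2 \<equiv> (''Psi2'', T1 \<^bold>\<rightarrow> T2 \<^bold>\<rightarrow> N)"

abbreviation One :: trm where "One \<equiv> Succ \<cdot> Zero"

definition pred_c :: trm where
  "pred_c = (\<^bold>\<lambda>vn. Rec \<cdot> V vn \<cdot> Zero \<cdot> (\<^bold>\<lambda>vr. \<^bold>\<lambda>vi. V vi))"

definition monus_c :: trm where
  "monus_c = (\<^bold>\<lambda>vm. \<^bold>\<lambda>vn. Rec \<cdot> V vn \<cdot> V vm \<cdot> (\<^bold>\<lambda>vr. \<^bold>\<lambda>vi. pred_c \<cdot> V vr))"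

definition Leq :: "trm \<Rightarrow> trm \<Rightarrow> fm"  (infix "\<^bold>\<le>" 50) where
  "(s \<^bold>\<le> t) = (monus_c \<cdot> s \<cdot> t \<^bold>= Zero)"

definition Less :: "trm \<Rightarrow> trm \<Rightarrow> fm"  (infix "\<^bold><" 50) where
  "(s \<^bold>< t) = (Succ \<cdot> s \<^bold>\<le> t)"

text \<open>\<open>ifz_c x m n\<close> is \<open>m\<close> if \<open>x = 0\<close>, and \<open>n\<close> otherwise.\<close>

definition ifz_c :: trm where
  "ifz_c = (\<^bold>\<lambda>vx. \<^bold>\<lambda>vm. \<^bold>\<lambda>vn. Rec \<cdot> V vx \<cdot> V vm \<cdot> (\<^bold>\<lambda>vr. \<^bold>\<lambda>vi. V vn))"

text \<open>\<open>\<sigma> * 00\<dots>\<close>\<close>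

definition ext0_c :: trm where
  "ext0_c = (\<^bold>\<lambda>vsig. \<^bold>\<lambda>vi.
     ifz_c \<cdot> (monus_c \<cdot> (Succ \<cdot> V vi) \<cdot> (Len N \<cdot> V vsig)) \<cdot> (Prj N \<cdot> V vsig \<cdot> V vi) \<cdot> Zero)"

text \<open>The associate \<open>\<Xi>(\<phi>, \<omega>)\<close> of \<open>\<phi>\<close> computed from the modulus \<open>\<omega>\<close>.\<close>

definition assoc_c :: trm where
  "assoc_c = (\<^bold>\<lambda>vphi. \<^bold>\<lambda>vom. \<^bold>\<lambda>vsig.
     ifz_c \<cdot> (monus_c \<cdot> (V vom \<cdot> (ext0_c \<cdot> V vsig)) \<cdot> (Len N \<cdot> V vsig))
           \<cdot> (Succ \<cdot> (V vphi \<cdot> (ext0_c \<cdot> V vsig))) \<cdot> Zero)"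

text \<open>The initial segment \<open>f 0, \<dots>, f (n - 1)\<close>, as an object of type \<open>Star N\<close>.\<close>

definition seg :: "trm \<Rightarrow> trm \<Rightarrow> trm" where
  "seg f n = Mk N \<cdot> n \<cdot> f"

definition eq_seg :: "trm \<Rightarrow> trm \<Rightarrow> trm \<Rightarrow> fm" where
  "eq_seg f g n = eqf (Star N) (seg f n) (seg g n)"

text \<open>\<open>f\<close> and \<open>g\<close> must not contain \<open>vn\<close> in the next two definitions.\<close>

definition binary :: "trm \<Rightarrow> fm" where
  "binary f = (\<^bold>\<forall>vn. f \<cdot> V vn \<^bold>\<le> One)"

definition approx1 :: "trm \<Rightarrow> trm \<Rightarrow> fm" where
  "approx1 f g = (\<^bold>\<forall>\<^sup>s\<^sup>t vn. f \<cdot> V vn \<^bold>= g \<cdot> V vn)"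


section \<open>Classical natural deduction\<close>

text \<open>
  \<open>prv T \<Gamma> A\<close>: from the axioms \<open>T\<close> and the assumptions \<open>\<Gamma>\<close>, \<open>A\<close> is derivable. Free variables of
  axioms are understood as universally quantified, so the variable condition concerns \<open>\<Gamma>\<close> only.
\<close>

inductive prv :: "fm set \<Rightarrow> fm list \<Rightarrow> fm \<Rightarrow> bool" for T :: "fm set" where
  ax: "A \<in> T \<Longrightarrow> wff A \<Longrightarrow> prv T \<Gamma> A"
| hyp: "A \<in> set \<Gamma> \<Longrightarrow> wff A \<Longrightarrow> prv T \<Gamma> A"
| impI: "prv T (A # \<Gamma>) B \<Longrightarrow> wff A \<Longrightarrow> prv T \<Gamma> (A \<^bold>\<longrightarrow> B)"
| impE: "prv T \<Gamma> (A \<^bold>\<longrightarrow> B) \<Longrightarrow> prv T \<Gamma> A \<Longrightarrow> prv T \<Gamma> B"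
| raa: "prv T ((\<^bold>\<not> A) # \<Gamma>) Fls \<Longrightarrow> wff A \<Longrightarrow> prv T \<Gamma> A"
| allI: "prv T \<Gamma> A \<Longrightarrow> \<forall>B \<in> set \<Gamma>. v \<notin> fv B \<Longrightarrow> prv T \<Gamma> (\<^bold>\<forall>v. A)"
| allE: "prv T \<Gamma> (All \<tau> A) \<Longrightarrow> t \<^bold>: \<tau> \<Longrightarrow> prv T \<Gamma> (open_fm 0 t A)"

abbreviation provable :: "fm set \<Rightarrow> fm \<Rightarrow> bool"  (infix "\<turnstile>" 20) where
  "T \<turnstile> A \<equiv> prv T [] A"


section \<open>The systems\<close>

text \<open>
  Classical arithmetic in all finite types, including the types of finite sequences; \<open>BAll_def\<close>
  explains the bounded quantifier and applies to formulas with \<open>st\<close> as well. The entries of a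
  sequence beyond its length are unspecified.
\<close>

inductive_set EPRA :: "fm set" where
  eq_refl: "s \<^bold>: N \<Longrightarrow> (s \<^bold>= s) \<in> EPRA"
| eq_eucl: "s \<^bold>: N \<Longrightarrow> t \<^bold>: N \<Longrightarrow> u \<^bold>: N \<Longrightarrow> (s \<^bold>= t \<^bold>\<longrightarrow> s \<^bold>= u \<^bold>\<longrightarrow> t \<^bold>= u) \<in> EPRA"
| ext: "s \<^bold>: \<rho> \<Longrightarrow> t \<^bold>: \<rho> \<Longrightarrow> u \<^bold>: \<rho> \<^bold>\<rightarrow> \<tau> \<Longrightarrow> (eqf \<rho> s t \<^bold>\<longrightarrow> eqf \<tau> (u \<cdot> s) (u \<cdot> t)) \<in> EPRA"
| succ_inj: "s \<^bold>: N \<Longrightarrow> t \<^bold>: N \<Longrightarrow> (Succ \<cdot> s \<^bold>= Succ \<cdot> t \<^bold>\<longrightarrow> s \<^bold>= t) \<in> EPRA"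
| succ_zero: "s \<^bold>: N \<Longrightarrow> (\<^bold>\<not> (Succ \<cdot> s \<^bold>= Zero)) \<in> EPRA"
| K_def: "s \<^bold>: \<sigma> \<Longrightarrow> t \<^bold>: \<tau> \<Longrightarrow> eqf \<sigma> (Kc \<sigma> \<tau> \<cdot> s \<cdot> t) s \<in> EPRA"
| S_def: "s \<^bold>: \<rho> \<^bold>\<rightarrow> \<sigma> \<^bold>\<rightarrow> \<tau> \<Longrightarrow> t \<^bold>: \<rho> \<^bold>\<rightarrow> \<sigma> \<Longrightarrow> u \<^bold>: \<rho> \<Longrightarrow>
    eqf \<tau> (Sc \<rho> \<sigma> \<tau> \<cdot> s \<cdot> t \<cdot> u) (s \<cdot> u \<cdot> (t \<cdot> u)) \<in> EPRA"
| Rec_zero: "s \<^bold>: N \<Longrightarrow> t \<^bold>: N \<^bold>\<rightarrow> N \<^bold>\<rightarrow> N \<Longrightarrow> (Rec \<cdot> Zero \<cdot> s \<cdot> t \<^bold>= s) \<in> EPRA"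
| Rec_succ: "u \<^bold>: N \<Longrightarrow> s \<^bold>: N \<Longrightarrow> t \<^bold>: N \<^bold>\<rightarrow> N \<^bold>\<rightarrow> N \<Longrightarrow>
    (Rec \<cdot> (Succ \<cdot> u) \<cdot> s \<cdot> t \<^bold>= t \<cdot> (Rec \<cdot> u \<cdot> s \<cdot> t) \<cdot> u) \<in> EPRA"
| Len_Mk: "s \<^bold>: N \<Longrightarrow> t \<^bold>: N \<^bold>\<rightarrow> \<sigma> \<Longrightarrow> (Len \<sigma> \<cdot> (Mk \<sigma> \<cdot> s \<cdot> t) \<^bold>= s) \<in> EPRA"
| Prj_Mk: "s \<^bold>: N \<Longrightarrow> t \<^bold>: N \<^bold>\<rightarrow> \<sigma> \<Longrightarrow> u \<^bold>: N \<Longrightarrow>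
    (u \<^bold>< s \<^bold>\<longrightarrow> eqf \<sigma> (Prj \<sigma> \<cdot> (Mk \<sigma> \<cdot> s \<cdot> t) \<cdot> u) (t \<cdot> u)) \<in> EPRA"
| BAll_def: "wff (BAll t A) \<Longrightarrow> (BAll t A \<^bold>\<longleftrightarrow> All N (Bnd 0 \<^bold>< t \<^bold>\<longrightarrow> A)) \<in> EPRA"
| qf_induct: "wff A \<Longrightarrow> qfree A \<Longrightarrow> snd n = N \<Longrightarrow>
    (A\<lbrakk>n ::= Zero\<rbrakk> \<^bold>\<longrightarrow> (\<^bold>\<forall>n. A \<^bold>\<longrightarrow> A\<lbrakk>n ::= Succ \<cdot> V n\<rbrakk>) \<^bold>\<longrightarrow> (\<^bold>\<forall>n. A)) \<in> EPRA"

inductive_set QFAC :: "ty \<Rightarrow> fm set" for \<sigma> :: ty where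
  qfac: "wff A \<Longrightarrow> qfree A \<Longrightarrow> snd x = \<sigma> \<Longrightarrow> snd n = N \<Longrightarrow> snd F = \<sigma> \<^bold>\<rightarrow> N \<Longrightarrow>
    distinct [x, n, F] \<Longrightarrow> F \<notin> fv A \<Longrightarrow>
    ((\<^bold>\<forall>x. \<^bold>\<exists>n. A) \<^bold>\<longrightarrow> (\<^bold>\<exists>F. \<^bold>\<forall>x. A\<lbrakk>n ::= V F \<cdot> V x\<rbrakk>)) \<in> QFAC \<sigma>"

definition RCA0_omega :: "fm set" where
  "RCA0_omega = EPRA \<union> QFAC T1"

inductive_set Standard :: "fm set" where
  st_eq: "s \<^bold>: \<tau> \<Longrightarrow> t \<^bold>: \<tau> \<Longrightarrow> (St \<tau> s \<^bold>\<and> eqf \<tau> s t \<^bold>\<longrightarrow> St \<tau> t) \<in> Standard"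
| st_closed: "t \<^bold>: \<tau> \<Longrightarrow> fv_trm t = {} \<Longrightarrow> St \<tau> t \<in> Standard"
| st_app: "s \<^bold>: \<sigma> \<^bold>\<rightarrow> \<tau> \<Longrightarrow> t \<^bold>: \<sigma> \<Longrightarrow> (St (\<sigma> \<^bold>\<rightarrow> \<tau>) s \<^bold>\<and> St \<sigma> t \<^bold>\<longrightarrow> St \<tau> (s \<cdot> t)) \<in> Standard"
| st_less: "s \<^bold>: N \<Longrightarrow> t \<^bold>: N \<Longrightarrow> (St N t \<^bold>\<and> s \<^bold>< t \<^bold>\<longrightarrow> St N s) \<in> Standard"

text \<open>\<open>z \<in> x\<close> for a finite sequence \<open>x\<close> is expressed by quantifying over the indices of \<open>x\<close>.\<close>

inductive_set Idealization :: "fm set" where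
  ideal: "wff A \<Longrightarrow> internal A \<Longrightarrow> snd z = \<sigma> \<Longrightarrow> snd x = Star \<sigma> \<Longrightarrow> snd i = N \<Longrightarrow>
    distinct [z, y, x, i] \<Longrightarrow> x \<notin> fv A \<Longrightarrow> i \<notin> fv A \<Longrightarrow>
    ((\<^bold>\<forall>\<^sup>s\<^sup>t x. \<^bold>\<exists>y. \<^bold>\<forall>i\<^bold><Len \<sigma> \<cdot> V x. A\<lbrakk>z ::= Prj \<sigma> \<cdot> V x \<cdot> V i\<rbrakk>) \<^bold>\<longrightarrow> (\<^bold>\<exists>y. \<^bold>\<forall>\<^sup>s\<^sup>t z. A)) \<in> Idealization"

inductive_set HAC_int :: "fm set" where
  hac: "wff A \<Longrightarrow> internal A \<Longrightarrow> snd x = \<rho> \<Longrightarrow> snd y = \<tau> \<Longrightarrow> snd F = \<rho> \<^bold>\<rightarrow> Star \<tau> \<Longrightarrow> snd i = N \<Longrightarrow>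
    distinct [x, y, F, i] \<Longrightarrow> F \<notin> fv A \<Longrightarrow> i \<notin> fv A \<Longrightarrow>
    ((\<^bold>\<forall>\<^sup>s\<^sup>t x. \<^bold>\<exists>\<^sup>s\<^sup>t y. A) \<^bold>\<longrightarrow>
     (\<^bold>\<exists>\<^sup>s\<^sup>t F. \<^bold>\<forall>\<^sup>s\<^sup>t x. \<^bold>\<exists>i\<^bold><Len \<tau> \<cdot> (V F \<cdot> V x). A\<lbrakk>y ::= Prj \<tau> \<cdot> (V F \<cdot> V x) \<cdot> V i\<rbrakk>)) \<in> HAC_int"

inductive_set PF_TP :: "fm set" where
  pftp: "wff A \<Longrightarrow> internal A \<Longrightarrow> fv A \<subseteq> {x} \<Longrightarrow> ((\<^bold>\<forall>\<^sup>s\<^sup>t x. A) \<^bold>\<longrightarrow> (\<^bold>\<forall>x. A)) \<in> PF_TP"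

text \<open>\<open>M\<close> has the free variable \<open>vXi\<close>; \<open>K0\<close> and \<open>K1\<close> have the free variable \<open>vUps\<close>.\<close>

definition fan_bound :: "trm \<Rightarrow> fm" where
  "fan_bound n = (\<^bold>\<forall>vf. \<^bold>\<forall>vg. binary (V vf) \<^bold>\<longrightarrow> binary (V vg) \<^bold>\<longrightarrow>
     eq_seg (V vf) (V vg) n \<^bold>\<longrightarrow> V vphi \<cdot> V vf \<^bold>= V vphi \<cdot> V vg)"

definition M :: fm where
  "M = (\<^bold>\<forall>vphi. fan_bound (V vXi \<cdot> V vphi) \<^bold>\<and> (\<^bold>\<forall>vm\<^bold><V vXi \<cdot> V vphi. \<^bold>\<not> fan_bound (V vm)))"

definition K0 :: fm where
  "K0 = (\<^bold>\<forall>vphi. \<^bold>\<forall>vf. \<^bold>\<forall>vg. binary (V vf) \<^bold>\<longrightarrow> binary (V vg) \<^bold>\<longrightarrow>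
     eq_seg (V vf) (V vg) (V vUps \<cdot> V vphi \<cdot> V vf) \<^bold>\<longrightarrow> V vphi \<cdot> V vf \<^bold>= V vphi \<cdot> V vg)"

definition K1 :: fm where
  "K1 = (\<^bold>\<forall>vphi. \<^bold>\<forall>vf. \<^bold>\<forall>vg.
     eq_seg (V vf) (V vg) (V vUps \<cdot> V vphi \<cdot> V vf) \<^bold>\<longrightarrow> V vphi \<cdot> V vf \<^bold>= V vphi \<cdot> V vg)"

text \<open>
  In \<open>defined\<close> the formula \<open>A\<close> has at most the free variable \<open>v\<close>, \<open>RCA0_omega\<close> proves that at most
  one object satisfies \<open>A\<close>, and the conclusion says that the constant agrees with the object
  satisfying \<open>A\<^sup>s\<^sup>t\<close> on standard arguments. That the constants are standard is also part of
  \<open>Standard\<close>.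
\<close>

inductive_set Constants :: "fm set" where
  Omega0_st: "St T3 Omega0 \<in> Constants"
| Omega0_def: "(\<^bold>\<forall>\<^sup>s\<^sup>t vXi. rel M \<^bold>\<longrightarrow> (\<^bold>\<forall>\<^sup>s\<^sup>t vphi. Omega0 \<cdot> V vphi \<^bold>= V vXi \<cdot> V vphi)) \<in> Constants"
| defined_st: "St \<tau> (Def \<tau> A) \<in> Constants"
| defined: "wff A \<Longrightarrow> internal A \<Longrightarrow> fv A \<subseteq> {v} \<Longrightarrow> snd v = \<tau> \<Longrightarrow> snd w = \<tau> \<Longrightarrow> w \<noteq> v \<Longrightarrow>
    RCA0_omega \<turnstile> (\<^bold>\<forall>v. \<^bold>\<forall>w. A \<^bold>\<longrightarrow> A\<lbrakk>v ::= V w\<rbrakk> \<^bold>\<longrightarrow> eqf \<tau> (V v) (V w)) \<Longrightarrow>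
    (\<^bold>\<forall>\<^sup>s\<^sup>t v. rel A \<^bold>\<longrightarrow> rel (eqf \<tau> (Def \<tau> (close_fm v 0 A)) (V v))) \<in> Constants"
| Lambda0_st: "St (T2 \<^bold>\<rightarrow> T1 \<^bold>\<rightarrow> N) Lambda0 \<in> Constants"
| Lambda0_def: "(\<^bold>\<forall>\<^sup>s\<^sup>t vUps. rel K0 \<^bold>\<longrightarrow> (\<^bold>\<forall>\<^sup>s\<^sup>t vphi. \<^bold>\<forall>\<^sup>s\<^sup>t vf. binary (V vf) \<^bold>\<longrightarrow>
      assoc_c \<cdot> V vphi \<cdot> (V vUps \<cdot> V vphi) \<cdot> seg (V vf) (Lambda0 \<cdot> V vphi \<cdot> V vf)
        \<^bold>= Succ \<cdot> (V vphi \<cdot> V vf))) \<in> Constants"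
| Lambda1_st: "St (T2 \<^bold>\<rightarrow> T1 \<^bold>\<rightarrow> N) Lambda1 \<in> Constants"
| Lambda1_def: "(\<^bold>\<forall>\<^sup>s\<^sup>t vUps. rel K1 \<^bold>\<longrightarrow> (\<^bold>\<forall>\<^sup>s\<^sup>t vphi. \<^bold>\<forall>\<^sup>s\<^sup>t vf.
      assoc_c \<cdot> V vphi \<cdot> (V vUps \<cdot> V vphi) \<cdot> seg (V vf) (Lambda1 \<cdot> V vphi \<cdot> V vf)
        \<^bold>= Succ \<cdot> (V vphi \<cdot> V vf))) \<in> Constants"

definition RCA0_Omega :: "fm set" where
  "RCA0_Omega = RCA0_omega \<union> Standard \<union> Idealization \<union> HAC_int \<union> PF_TP \<union> Constants"


section \<open>The principles\<close>

text \<open>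
  A functional \<open>\<Psi>\<close> of type \<open>(1 \<times> 2) \<rightarrow> (0 \<times> 0)\<close> is curried in its arguments and given by its two
  components: \<open>\<Psi>(f,\<psi>)(1)\<close> is \<open>\<Psi>\<^sub>1 f \<psi>\<close> and \<open>\<Psi>(f,\<psi>)(2)\<close> is \<open>\<Psi>\<^sub>2 f \<psi>\<close>.
\<close>

definition UWC :: fm where
  "UWC = (\<^bold>\<exists>vPsi1. \<^bold>\<exists>vPsi2. \<^bold>\<forall>vH. \<^bold>\<forall>vpsi.
     (\<^bold>\<forall>vf. V vH \<cdot> V vf \<cdot> (V vpsi \<cdot> V vf) \<^bold>= Zero) \<^bold>\<longrightarrow>
     (\<^bold>\<forall>vf. \<^bold>\<forall>vg. eq_seg (V vf) (V vg) (V vPsi1 \<cdot> V vf \<cdot> V vpsi) \<^bold>\<longrightarrow>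
        V vH \<cdot> V vg \<cdot> (V vPsi2 \<cdot> V vf \<cdot> V vpsi) \<^bold>= Zero))"

definition WC_star :: fm where
  "WC_star = (\<^bold>\<forall>\<^sup>s\<^sup>t vH.
     (\<^bold>\<forall>\<^sup>s\<^sup>t vf. \<^bold>\<exists>\<^sup>s\<^sup>t vn. V vH \<cdot> V vf \<cdot> V vn \<^bold>= Zero) \<^bold>\<longrightarrow>
     (\<^bold>\<forall>\<^sup>s\<^sup>t vf. \<^bold>\<exists>\<^sup>s\<^sup>t vm. \<^bold>\<exists>\<^sup>s\<^sup>t vx. \<^bold>\<forall>vg.
        eq_seg (V vf) (V vg) (V vm) \<^bold>\<longrightarrow> V vH \<cdot> V vg \<cdot> V vx \<^bold>= Zero))"

definition WC_frak :: fm where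
  "WC_frak = (\<^bold>\<forall>\<^sup>s\<^sup>t vH.
     (\<^bold>\<forall>\<^sup>s\<^sup>t vf. \<^bold>\<exists>\<^sup>s\<^sup>t vn. V vH \<cdot> V vf \<cdot> V vn \<^bold>= Zero) \<^bold>\<longrightarrow>
     (\<^bold>\<forall>\<^sup>s\<^sup>t vf. \<^bold>\<exists>\<^sup>s\<^sup>t vx. \<^bold>\<forall>vg.
        approx1 (V vf) (V vg) \<^bold>\<longrightarrow> V vH \<cdot> V vg \<cdot> V vx \<^bold>= Zero))"

definition CONT :: fm where
  "CONT = (\<^bold>\<exists>vUps. K1)"

definition CO_frak :: fm where
  "CO_frak = (\<^bold>\<forall>\<^sup>s\<^sup>t vphi. \<^bold>\<forall>\<^sup>s\<^sup>t vf. \<^bold>\<forall>vg.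
     approx1 (V vf) (V vg) \<^bold>\<longrightarrow> V vphi \<cdot> V vf \<^bold>= V vphi \<cdot> V vg)"

definition CO_star :: fm where
  "CO_star = (\<^bold>\<forall>\<^sup>s\<^sup>t vphi. \<^bold>\<forall>\<^sup>s\<^sup>t vf. \<^bold>\<exists>\<^sup>s\<^sup>t vN. \<^bold>\<forall>vg.
     eq_seg (V vf) (V vg) (V vN) \<^bold>\<longrightarrow> V vphi \<cdot> V vf \<^bold>= V vphi \<cdot> V vg)"

end

theory Submission
  imports Defs "HOL-Library.Countable"
begin

text \<open>
  Derivability is replaced by truth. The calculus is complete with respect to extensional Henkin
  structures (\<open>completeness\<close>), so two sentences are provably equivalent in \<open>RCA0_Omega\<close> if they have the
  same truth value in each of its models. The structures are built from terms, by a Henkin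
  construction and a quotient by provable equality. In a model, the axioms become usable principles:
  bracket abstraction really defines functionals (\<open>ev_lam\<close>), functionals defined from standard ones are
  standard (\<open>std_ev\<close>), and there are \<open>transfer\<close>, \<open>choice\<close> up to finitely many candidates, and, as a
  consequence of idealisation, \<open>underspill\<close>.

  The equivalences are then shown as follows. A modulus of continuity for choice functionals solves the
  problem posed by UWC, and UWC for the graph of a functional yields a modulus of continuity. This
  argument is valid for any class of objects that is closed under definability, hence for UWC and CONT as
  well as for their relativisations (\<open>UWC_on_iff_CONT_on\<close>).

  Transfer turns a modulus of continuity into a standard one, so CONT implies its relativisation. The
  heart of the matter is the way back (\<open>Lambda1_modulus\<close>). A modulus that is only known to work for
  standard arguments is a parameter, and transfer does not admit parameters. The axiom for the constant
  \<open>Lambda1\<close> removes it: \<open>Lambda1\<close> bounds the point at which the associate computed from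
  the modulus is defined, and is for this reason itself a modulus on standard arguments. This is a
  statement about a constant, so transfer extends it to all arguments. As \<open>Lambda1\<close> is standard,
  \<open>CO_star\<close> follows as well.

  In the other direction, choice applied to \<open>CO_star\<close> gives finitely many candidates for a modulus at each
  argument, and their sum is a modulus. Underspill links the versions with infinitely close functions to
  those with a standard number. Finally, \<open>WC_star\<close> follows from \<open>CO_star\<close> for a choice functional \<open>\<psi>\<close>, obtained by
  choice and bounded search, and for \<open>\<lambda>f. H f (\<psi> f)\<close>; the converse is \<open>WC_star\<close> for the graph of \<open>\<phi>\<close>.
\<close>


section \<open>Typing and substitution\<close>

lemma tyof_App_iff:
  "tyof \<Delta> (s \<cdot> t) = Some \<tau> \<longleftrightarrow> (\<exists>\<sigma>. tyof \<Delta> s = Some (\<sigma> \<^bold>\<rightarrow> \<tau>) \<and> tyof \<Delta> t = Some \<sigma>)"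
  by (auto split: option.splits ty.splits)

lemma tyof_append: "tyof \<Delta> t = Some \<tau> \<Longrightarrow> tyof (\<Delta> @ \<Delta>') t = Some \<tau>"
proof (induction t arbitrary: \<tau> rule: fv_trm.induct)
  case (2 s t)
  then show ?case by (auto simp: tyof_App_iff simp del: tyof.simps(3))
qed (auto simp: nth_append split: if_splits)

lemma tyof_close:
  "tyof \<Delta> t = Some \<tau> \<Longrightarrow> tyof (\<Delta> @ [snd v]) (close_trm v (length \<Delta>) t) = Some \<tau>"
proof (induction t arbitrary: \<tau> rule: fv_trm.induct)
  case (2 s t)
  then show ?case by (auto simp: tyof_App_iff simp del: tyof.simps(3))
qed (auto simp: nth_append split: if_splits)

lemma tyof_open:
  "tyof (\<Delta> @ [\<sigma>]) t = Some \<tau> \<Longrightarrow> u \<^bold>: \<sigma> \<Longrightarrow> tyof \<Delta> (open_trm (length \<Delta>) u t) = Some \<tau>"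
proof (induction t arbitrary: \<tau> rule: fv_trm.induct)
  case (2 s t)
  then show ?case by (auto simp: tyof_App_iff simp del: tyof.simps(3))
qed (auto simp: nth_append less_Suc_eq split: if_splits dest: tyof_append[of "[]" _ _ \<Delta>])

lemma wf_close: "wf_fm \<Delta> A \<Longrightarrow> wf_fm (\<Delta> @ [snd v]) (close_fm v (length \<Delta>) A)"
proof (induction A arbitrary: \<Delta> rule: fv.induct)
  case (5 \<tau> A)
  then show ?case using "5.IH"[of "\<tau> # \<Delta>"] by simp
next
  case (6 t A)
  then show ?case using "6.IH"[of "N # \<Delta>"] by (simp add: tyof_close)
qed (auto intro: tyof_close)

lemma wf_open: "wf_fm (\<Delta> @ [\<sigma>]) A \<Longrightarrow> u \<^bold>: \<sigma> \<Longrightarrow> wf_fm \<Delta> (open_fm (length \<Delta>) u A)"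
proof (induction A arbitrary: \<Delta> rule: fv.induct)
  case (5 \<tau> A)
  then show ?case using "5.IH"[of "\<tau> # \<Delta>"] by simp
next
  case (6 t A)
  then show ?case using "6.IH"[of "N # \<Delta>"] by (auto intro: tyof_open)
qed (auto intro: tyof_open)

lemma wff_Neg [simp]: "wf_fm \<Delta> (\<^bold>\<not> A) = wf_fm \<Delta> A"
  by (simp add: Neg_def)

lemma wff_And [simp]: "wf_fm \<Delta> (A \<^bold>\<and> B) \<longleftrightarrow> wf_fm \<Delta> A \<and> wf_fm \<Delta> B"
  by (simp add: And_def)

lemma wff_Iff [simp]: "wf_fm \<Delta> (A \<^bold>\<longleftrightarrow> B) \<longleftrightarrow> wf_fm \<Delta> A \<and> wf_fm \<Delta> B"
  by (auto simp add: Iff_def)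

lemma wff_fall [simp]: "wff A \<Longrightarrow> wff (\<^bold>\<forall>v. A)"
  using wf_close[of "[]" A v] by (simp add: fall_def)

lemma wff_open: "wff (All \<tau> A) \<Longrightarrow> t \<^bold>: \<tau> \<Longrightarrow> wff (open_fm 0 t A)"
  using wf_open[of "[]" \<tau> A t] by simp

lemma open_close_trm:
  "tyof \<Delta> t = Some \<tau> \<Longrightarrow> open_trm (length \<Delta>) (V v) (close_trm v (length \<Delta>) t) = t"
proof (induction t arbitrary: \<tau> rule: fv_trm.induct)
  case (2 s t)
  then show ?case by (auto simp: tyof_App_iff simp del: tyof.simps(3))
qed (auto split: if_splits)

lemma open_close_fm:
  "wf_fm \<Delta> A \<Longrightarrow> open_fm (length \<Delta>) (V v) (close_fm v (length \<Delta>) A) = A"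
proof (induction A arbitrary: \<Delta> rule: fv.induct)
  case (5 \<tau> A)
  then show ?case using "5.IH"[of "\<tau> # \<Delta>"] by simp
next
  case (6 t A)
  then show ?case using "6.IH"[of "N # \<Delta>"] by (simp add: open_close_trm)
qed (auto intro: open_close_trm)

lemma close_open_trm: "v \<notin> fv_trm t \<Longrightarrow> close_trm v k (open_trm k (V v) t) = t"
  by (induction t rule: fv_trm.induct) auto

lemma close_open_fm: "v \<notin> fv A \<Longrightarrow> close_fm v k (open_fm k (V v) A) = A"
  by (induction A arbitrary: k rule: fv.induct) (auto simp: close_open_trm)

lemma fv_close_trm: "fv_trm (close_trm v k t) = fv_trm t - {v}"
  by (induction t rule: fv_trm.induct) auto

lemma fv_close: "fv (close_fm v k A) = fv A - {v}"
  by (induction A arbitrary: k rule: fv.induct) (auto simp: fv_close_trm)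

lemma fv_fall [simp]: "fv (\<^bold>\<forall>v. A) = fv A - {v}"
  by (simp add: fall_def fv_close)

lemma finite_fv_trm: "finite (fv_trm t)"
  by (induction t rule: fv_trm.induct) auto

lemma finite_fv: "finite (fv A)"
  by (induction A rule: fv.induct) (auto simp: finite_fv_trm)

lemma fresh_var: "\<exists>v. snd v = \<tau> \<and> v \<notin> fv A"
proof -
  have "finite (fst ` fv A)"
    by (simp add: finite_fv)
  then obtain a where "a \<notin> fst ` fv A"
    using ex_new_if_finite[OF infinite_UNIV_listI] by blast
  then have "(a, \<tau>) \<notin> fv A"
    by force
  then show ?thesis
    by (intro exI[of _ "(a, \<tau>)"]) simp
qed

lemma open_typed: "tyof \<Delta> t = Some \<tau> \<Longrightarrow> length \<Delta> \<le> k \<Longrightarrow> open_trm k u t = t"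
proof (induction t arbitrary: \<tau> rule: fv_trm.induct)
  case (2 s t)
  then show ?case by (auto simp: tyof_App_iff simp del: tyof.simps(3))
qed (auto split: if_splits)

lemma open_closed [simp]: "t \<^bold>: \<tau> \<Longrightarrow> open_trm k u t = t"
  by (rule open_typed) auto

lemma lift_closed [simp]: "t \<^bold>: \<tau> \<Longrightarrow> lift_trm t = t"
proof (induction t arbitrary: \<tau> rule: fv_trm.induct)
  case (2 s t)
  then show ?case by (auto simp: tyof_App_iff simp del: tyof.simps(3))
qed auto

lemma tyof_lift: "tyof \<Delta> t = Some \<tau> \<Longrightarrow> tyof (\<sigma> # \<Delta>) (lift_trm t) = Some \<tau>"
proof (induction t arbitrary: \<tau> rule: fv_trm.induct)
  case (2 s t)
  then show ?case by (auto simp: tyof_App_iff simp del: tyof.simps(3))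
qed (auto split: if_splits)

lemma open_lift: "u \<^bold>: \<sigma> \<Longrightarrow> open_trm (Suc k) u (lift_trm t) = lift_trm (open_trm k u t)"
  by (induction t rule: fv_trm.induct) auto

lemma open_eqf: "u \<^bold>: \<sigma> \<Longrightarrow> open_fm k u (eqf \<tau> s t) = eqf \<tau> (open_trm k u s) (open_trm k u t)"
  by (induction \<tau> arbitrary: k s t) (auto simp: open_lift And_def Neg_def)

lemma wf_eqf: "tyof \<Delta> s = Some \<tau> \<Longrightarrow> tyof \<Delta> t = Some \<tau> \<Longrightarrow> wf_fm \<Delta> (eqf \<tau> s t)"
  by (induction \<tau> arbitrary: \<Delta> s t) (auto simp: tyof_lift)

lemma tyof_const_trm: "t \<^bold>: \<tau> \<Longrightarrow> const_trm \<sigma> t \<^bold>: \<sigma> \<^bold>\<rightarrow> \<tau>"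
  by (simp add: const_trm_def)

lemma tyof_lam': "t \<^bold>: \<tau> \<Longrightarrow> (\<^bold>\<lambda>v. t) \<^bold>: snd v \<^bold>\<rightarrow> \<tau>"
proof (induction v t arbitrary: \<tau> rule: lam.induct)
  case (1 v s t)
  then obtain \<sigma> where \<sigma>: "s \<^bold>: \<sigma> \<^bold>\<rightarrow> \<tau>" "t \<^bold>: \<sigma>"
    by (auto simp: tyof_App_iff simp del: tyof.simps(3))
  show ?case
  proof (cases "v \<in> fv_trm (s \<cdot> t)")
    case True
    then have "(\<^bold>\<lambda>v. s) \<^bold>: snd v \<^bold>\<rightarrow> \<sigma> \<^bold>\<rightarrow> \<tau>" "(\<^bold>\<lambda>v. t) \<^bold>: snd v \<^bold>\<rightarrow> \<sigma>"
      using "1.IH" \<sigma> by auto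
    then show ?thesis
      using True \<sigma> by auto
  next
    case False
    then show ?thesis
      using tyof_const_trm[OF 1(3)] by (simp del: tyof.simps(3))
  qed
qed (auto intro: tyof_const_trm)

lemma tyof_lam [simp]: "tyof [] t \<noteq> None \<Longrightarrow> tyof [] (\<^bold>\<lambda>v. t) = Some (snd v \<^bold>\<rightarrow> the (tyof [] t))"
  by (auto intro: tyof_lam')

lemma fv_lam [simp]: "fv_trm (\<^bold>\<lambda>v. t) = fv_trm t - {v}"
  by (induction v t rule: lam.induct) (auto simp: const_trm_def)

declare lam.simps [simp del]

lemma pred_c_type [simp]: "pred_c \<^bold>: N \<^bold>\<rightarrow> N" "fv_trm pred_c = {}"
  by (auto simp: pred_c_def)

lemma monus_c_type [simp]: "monus_c \<^bold>: N \<^bold>\<rightarrow> N \<^bold>\<rightarrow> N" "fv_trm monus_c = {}"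
  by (auto simp: monus_c_def)

lemma ifz_c_type [simp]: "ifz_c \<^bold>: N \<^bold>\<rightarrow> N \<^bold>\<rightarrow> N \<^bold>\<rightarrow> N" "fv_trm ifz_c = {}"
  by (auto simp: ifz_c_def)

lemma ext0_c_type [simp]: "ext0_c \<^bold>: Star N \<^bold>\<rightarrow> T1" "fv_trm ext0_c = {}"
  by (auto simp: ext0_c_def)

lemma assoc_c_type [simp]:
  "assoc_c \<^bold>: T2 \<^bold>\<rightarrow> T2 \<^bold>\<rightarrow> Star N \<^bold>\<rightarrow> N" "fv_trm assoc_c = {}"
  by (auto simp: assoc_c_def)

lemma monus_c_tyof [simp]: "tyof \<Delta> monus_c = Some (N \<^bold>\<rightarrow> N \<^bold>\<rightarrow> N)"
  using tyof_append[OF monus_c_type(1)] by simp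

lemma wf_Less [simp]:
  "tyof \<Delta> s = Some N \<Longrightarrow> tyof \<Delta> t = Some N \<Longrightarrow> wf_fm \<Delta> (s \<^bold>< t)"
  by (simp add: Less_def Leq_def)

lemma wff_subst [simp]: "wff A \<Longrightarrow> u \<^bold>: snd v \<Longrightarrow> wff (A\<lbrakk>v ::= u\<rbrakk>)"
  using wf_open[of "[]" "snd v" "close_fm v 0 A" u] wf_close[of "[]" A v] by (simp add: subst_def)

lemma wff_fex [simp]: "wff A \<Longrightarrow> wff (\<^bold>\<exists>v. A)"
  by (simp add: fex_def)

lemma wff_fall_st [simp]: "wff A \<Longrightarrow> wff (\<^bold>\<forall>\<^sup>s\<^sup>t v. A)"
  by (simp add: fall_st_def)

lemma wff_fex_st [simp]: "wff A \<Longrightarrow> wff (\<^bold>\<exists>\<^sup>s\<^sup>t v. A)"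
  by (simp add: fex_st_def)

lemma wff_fball [simp]: "wff A \<Longrightarrow> t \<^bold>: N \<Longrightarrow> snd i = N \<Longrightarrow> wff (\<^bold>\<forall>i\<^bold><t. A)"
  using wf_close[of "[]" A i] by (simp add: fball_def)

lemma wff_fbex [simp]: "wff A \<Longrightarrow> t \<^bold>: N \<Longrightarrow> snd i = N \<Longrightarrow> wff (\<^bold>\<exists>i\<^bold><t. A)"
  by (simp add: fbex_def)

lemma wf_eq_seg [simp]: "f \<^bold>: T1 \<Longrightarrow> g \<^bold>: T1 \<Longrightarrow> n \<^bold>: N \<Longrightarrow> wff (eq_seg f g n)"
  by (simp add: eq_seg_def seg_def wf_eqf del: eqf.simps)

lemma wff_approx1 [simp]: "wff (approx1 (V (a, T1)) (V (b, T1)))"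
  by (simp add: approx1_def)

lemma rel_close: "rel (close_fm v k A) = close_fm v k (rel A)"
  by (induction A arbitrary: k rule: fv.induct) auto

lemma rel_fall [simp]: "rel (\<^bold>\<forall>v. A) = (\<^bold>\<forall>\<^sup>s\<^sup>t v. rel A)"
  by (simp add: fall_def fall_st_def rel_close)

lemma rel_Neg [simp]: "rel (\<^bold>\<not> A) = (\<^bold>\<not> rel A)"
  by (simp add: Neg_def)

lemma rel_eq_seg [simp]: "rel (eq_seg f g n) = eq_seg f g n"
  by (simp add: eq_seg_def And_def)

lemma wf_rel [simp]: "wf_fm \<Delta> A \<Longrightarrow> wf_fm \<Delta> (rel A)"
  by (induction A arbitrary: \<Delta> rule: fv.induct) auto

lemma internal_close [simp]: "internal (close_fm v k A) = internal A"
  by (induction A arbitrary: k rule: fv.induct) auto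

lemma internal_Neg [simp]: "internal (\<^bold>\<not> A) = internal A"
  by (simp add: Neg_def)

lemma internal_And [simp]: "internal (A \<^bold>\<and> B) \<longleftrightarrow> internal A \<and> internal B"
  by (simp add: And_def)

lemma internal_fall [simp]: "internal (\<^bold>\<forall>v. A) = internal A"
  by (simp add: fall_def)

lemma internal_eq_seg [simp]: "internal (eq_seg f g n)"
  by (simp add: eq_seg_def And_def)

lemma fv_lift [simp]: "fv_trm (lift_trm t) = fv_trm t"
  by (induction t rule: fv_trm.induct) auto

lemma fv_Neg [simp]: "fv (\<^bold>\<not> A) = fv A"
  by (simp add: Neg_def)

lemma fv_And [simp]: "fv (A \<^bold>\<and> B) = fv A \<union> fv B"
  by (simp add: And_def)

lemma fv_Iff [simp]: "fv (A \<^bold>\<longleftrightarrow> B) = fv A \<union> fv B"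
  by (auto simp: Iff_def)

lemma fv_eq_seg [simp]: "fv (eq_seg f g n) = fv_trm f \<union> fv_trm g \<union> fv_trm n"
  by (auto simp: eq_seg_def seg_def)

lemma fv_fex [simp]: "fv (\<^bold>\<exists>v. A) = fv A - {v}"
  by (simp add: fex_def)

lemma fv_fall_st [simp]: "fv (\<^bold>\<forall>\<^sup>s\<^sup>t v. A) = fv A - {v}"
  by (auto simp add: fall_st_def)

lemma fv_fex_st [simp]: "fv (\<^bold>\<exists>\<^sup>s\<^sup>t v. A) = fv A - {v}"
  by (auto simp add: fex_st_def)

lemma fv_rel: "fv (rel A) = fv A"
  by (induction A rule: fv.induct) auto


section \<open>Derivations without assumptions\<close>

text \<open>
  The Henkin construction reasons from formulas that it collects. Weakening a derivation would mean
  renaming its eigenvariables, and the axioms with it, so an assumption is carried as the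
  antecedent of an implication that is derived from no assumptions at all.
\<close>

lemma prv_wff: "prv T \<Gamma> A \<Longrightarrow> wff A"
  by (induction rule: prv.induct) (auto intro: wff_open)

lemma prv_mp: "T \<turnstile> A \<^bold>\<longrightarrow> B \<Longrightarrow> T \<turnstile> A \<Longrightarrow> T \<turnstile> B"
  by (rule prv.impE)

lemma prv_const: "wff A \<Longrightarrow> wff B \<Longrightarrow> T \<turnstile> A \<^bold>\<longrightarrow> B \<^bold>\<longrightarrow> A"
  by (intro prv.impI prv.hyp) auto

lemma prv_refl: "wff A \<Longrightarrow> T \<turnstile> A \<^bold>\<longrightarrow> A"
  by (intro prv.impI prv.hyp) auto

lemma prv_weaken: "T \<turnstile> B \<Longrightarrow> wff A \<Longrightarrow> T \<turnstile> A \<^bold>\<longrightarrow> B"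
  using prv_mp prv_const prv_wff by blast

lemma prv_mp_under:
  assumes "T \<turnstile> C \<^bold>\<longrightarrow> A \<^bold>\<longrightarrow> B" "T \<turnstile> C \<^bold>\<longrightarrow> A"
  shows "T \<turnstile> C \<^bold>\<longrightarrow> B"
proof -
  have w: "wff A" "wff B" "wff C"
    using assms by (auto dest: prv_wff)
  let ?G = "[C, C \<^bold>\<longrightarrow> A, C \<^bold>\<longrightarrow> A \<^bold>\<longrightarrow> B]"
  have "prv T ?G (A \<^bold>\<longrightarrow> B)" "prv T ?G A"
    by (rule prv.impE[of _ _ C]; rule prv.hyp; simp add: w)+
  then have "prv T ?G B"
    by (rule prv.impE)
  then have "T \<turnstile> (C \<^bold>\<longrightarrow> A \<^bold>\<longrightarrow> B) \<^bold>\<longrightarrow> (C \<^bold>\<longrightarrow> A) \<^bold>\<longrightarrow> C \<^bold>\<longrightarrow> B"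
    by (intro prv.impI) (simp_all add: w)
  then show ?thesis
    using assms prv_mp by blast
qed

lemma prv_trans: "T \<turnstile> A \<^bold>\<longrightarrow> B \<Longrightarrow> T \<turnstile> B \<^bold>\<longrightarrow> C \<Longrightarrow> T \<turnstile> A \<^bold>\<longrightarrow> C"
  by (meson prv_mp_under prv_weaken prv_wff wf_fm.simps(4))

lemma prv_contradict:
  assumes "wff A" "wff B"
  shows "T \<turnstile> (\<^bold>\<not> A) \<^bold>\<longrightarrow> A \<^bold>\<longrightarrow> B"
proof -
  let ?G = "[\<^bold>\<not> B, A, \<^bold>\<not> A]"
  have "prv T ?G (A \<^bold>\<longrightarrow> Fls)" "prv T ?G A"
    by (rule prv.hyp; simp add: assms Neg_def)+
  then have "prv T ?G Fls"
    by (rule prv.impE)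
  note * = prv.impI[OF prv.impI[OF prv.raa[OF this]]]
  show ?thesis
    by (rule *) (simp_all add: assms)
qed

lemma prv_dneg:
  assumes "wff A"
  shows "T \<turnstile> (\<^bold>\<not> \<^bold>\<not> A) \<^bold>\<longrightarrow> A"
proof -
  let ?G = "[\<^bold>\<not> A, \<^bold>\<not> \<^bold>\<not> A]"
  have "prv T ?G ((\<^bold>\<not> A) \<^bold>\<longrightarrow> Fls)" "prv T ?G (\<^bold>\<not> A)"
    by (rule prv.hyp; simp add: assms Neg_def)+
  then have "prv T ?G Fls"
    by (rule prv.impE)
  note * = prv.impI[OF prv.raa[OF this]]
  show ?thesis
    by (rule *) (simp_all add: assms)
qed

lemma prv_flip:
  assumes "T \<turnstile> A \<^bold>\<longrightarrow> B \<^bold>\<longrightarrow> C"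
  shows "T \<turnstile> B \<^bold>\<longrightarrow> A \<^bold>\<longrightarrow> C"
proof -
  have w: "wff A" "wff B" "wff C"
    using assms by (auto dest: prv_wff)
  let ?G = "[A, B, A \<^bold>\<longrightarrow> B \<^bold>\<longrightarrow> C]"
  have "prv T ?G (B \<^bold>\<longrightarrow> C)"
    by (rule prv.impE[of _ _ A]; rule prv.hyp; simp add: w)
  then have "prv T ?G C"
    by (rule prv.impE) (rule prv.hyp; simp add: w)
  then have "T \<turnstile> (A \<^bold>\<longrightarrow> B \<^bold>\<longrightarrow> C) \<^bold>\<longrightarrow> B \<^bold>\<longrightarrow> A \<^bold>\<longrightarrow> C"
    by (intro prv.impI) (simp_all add: w)
  then show ?thesis
    using assms prv_mp by blast
qed

lemma prv_andI: "wff A \<Longrightarrow> wff B \<Longrightarrow> T \<turnstile> A \<^bold>\<longrightarrow> B \<^bold>\<longrightarrow> (A \<^bold>\<and> B)"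
  unfolding And_def Neg_def
  by (intro prv.impI, rule prv.impE[of _ _ B], rule prv.impE[of _ _ A]) (auto intro: prv.hyp)

lemma prv_and1: assumes "wff A" "wff B" shows "T \<turnstile> (A \<^bold>\<and> B) \<^bold>\<longrightarrow> A"
proof -
  have "T \<turnstile> (\<^bold>\<not> A) \<^bold>\<longrightarrow> A \<^bold>\<longrightarrow> (\<^bold>\<not> B)"
    using assms by (simp add: prv_contradict)
  moreover have "T \<turnstile> (A \<^bold>\<and> B) \<^bold>\<longrightarrow> (A \<^bold>\<longrightarrow> \<^bold>\<not> B) \<^bold>\<longrightarrow> Fls"
    using prv_refl[of "A \<^bold>\<and> B" T] assms by (simp add: And_def Neg_def)
  ultimately have "T \<turnstile> (\<^bold>\<not> A) \<^bold>\<longrightarrow> (A \<^bold>\<and> B) \<^bold>\<longrightarrow> Fls"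
    using prv_trans prv_flip by blast
  then have "T \<turnstile> (A \<^bold>\<and> B) \<^bold>\<longrightarrow> \<^bold>\<not> \<^bold>\<not> A"
    using prv_flip by (simp add: Neg_def)
  then show ?thesis
    using prv_trans prv_dneg assms by blast
qed

lemma prv_and2: assumes "wff A" "wff B" shows "T \<turnstile> (A \<^bold>\<and> B) \<^bold>\<longrightarrow> B"
proof -
  have "T \<turnstile> (\<^bold>\<not> B) \<^bold>\<longrightarrow> A \<^bold>\<longrightarrow> (\<^bold>\<not> B)"
    using assms by (simp add: prv_const)
  moreover have "T \<turnstile> (A \<^bold>\<and> B) \<^bold>\<longrightarrow> (A \<^bold>\<longrightarrow> \<^bold>\<not> B) \<^bold>\<longrightarrow> Fls"
    using prv_refl[of "A \<^bold>\<and> B" T] assms by (simp add: And_def Neg_def)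
  ultimately have "T \<turnstile> (\<^bold>\<not> B) \<^bold>\<longrightarrow> (A \<^bold>\<and> B) \<^bold>\<longrightarrow> Fls"
    using prv_trans prv_flip by blast
  then have "T \<turnstile> (A \<^bold>\<and> B) \<^bold>\<longrightarrow> \<^bold>\<not> \<^bold>\<not> B"
    using prv_flip by (simp add: Neg_def)
  then show ?thesis
    using prv_trans prv_dneg assms by blast
qed

lemma prv_export:
  assumes "T \<turnstile> (A \<^bold>\<and> B) \<^bold>\<longrightarrow> C"
  shows "T \<turnstile> A \<^bold>\<longrightarrow> B \<^bold>\<longrightarrow> C"
proof -
  have w: "wff A" "wff B" "wff C"
    using prv_wff[OF assms] by auto
  have "T \<turnstile> A \<^bold>\<longrightarrow> (B \<^bold>\<longrightarrow> (A \<^bold>\<and> B) \<^bold>\<longrightarrow> C)"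
    by (rule prv_weaken[OF prv_weaken[OF assms]]) (simp_all add: w)
  moreover have "T \<turnstile> (B \<^bold>\<longrightarrow> (A \<^bold>\<and> B) \<^bold>\<longrightarrow> C) \<^bold>\<longrightarrow> (B \<^bold>\<longrightarrow> (A \<^bold>\<and> B)) \<^bold>\<longrightarrow> B \<^bold>\<longrightarrow> C"
  proof (intro prv.impI)
    let ?G = "[B, B \<^bold>\<longrightarrow> (A \<^bold>\<and> B), B \<^bold>\<longrightarrow> (A \<^bold>\<and> B) \<^bold>\<longrightarrow> C]"
    have "prv T ?G ((A \<^bold>\<and> B) \<^bold>\<longrightarrow> C)" "prv T ?G (A \<^bold>\<and> B)"
      by (rule prv.impE[of _ _ B]; rule prv.hyp; simp add: w)+
    then show "prv T ?G C"
      by (rule prv.impE)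
  qed (simp_all add: w)
  ultimately show ?thesis
    using prv_mp_under prv_trans prv_andI w by blast
qed

text \<open>
  The whole implication is generalised first, which the rule for \<open>\<^bold>\<forall>\<close> allows without condition if
  there are no assumptions; the quantifier then moves past \<open>C\<close>.
\<close>

lemma prv_gen:
  assumes "T \<turnstile> C \<^bold>\<longrightarrow> A" "v \<notin> fv C"
  shows "T \<turnstile> C \<^bold>\<longrightarrow> (\<^bold>\<forall>v. A)"
proof -
  have w: "wff C" "wff A"
    using prv_wff[OF assms(1)] by auto
  let ?X = "\<^bold>\<forall>v. C \<^bold>\<longrightarrow> A"
  have "prv T [C, ?X] ?X"
    by (rule prv.hyp) (simp_all add: w)
  from prv.allE[OF this[unfolded fall_def], of "V v"]
  have "prv T [C, ?X] (C \<^bold>\<longrightarrow> A)"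
    using open_close_fm[of "[]" "C \<^bold>\<longrightarrow> A" v] w by (simp add: fall_def)
  then have "prv T [C, ?X] A"
    by (rule prv.impE) (rule prv.hyp; simp add: w)
  then have "prv T [C, ?X] (\<^bold>\<forall>v. A)"
    using assms(2) by (intro prv.allI) auto
  then have "T \<turnstile> ?X \<^bold>\<longrightarrow> C \<^bold>\<longrightarrow> (\<^bold>\<forall>v. A)"
    by (intro prv.impI) (simp_all add: w)
  moreover have "T \<turnstile> ?X"
    using assms(1) by (intro prv.allI) auto
  ultimately show ?thesis
    by (rule prv_mp)
qed


section \<open>Henkin sets\<close>

instance ty :: countable
  by countable_datatype

instance trm :: countable
  by countable_datatype

instance fm :: countable
  by countable_datatype

text \<open>
  A Henkin set is a truth predicate for the formulas over the domain of all well-typed terms. The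
  axioms in \<open>T\<close> may have free variables and are then meant universally, which is why \<open>Tr\<close> contains
  what \<open>T\<close> proves without assumptions.
\<close>

locale henkin =
  fixes T :: "fm set" and Tr :: "fm \<Rightarrow> bool"
  assumes Tr_Fls [simp]: "\<not> Tr Fls"
    and Tr_Imp [simp]: "wff A \<Longrightarrow> wff B \<Longrightarrow> Tr (A \<^bold>\<longrightarrow> B) \<longleftrightarrow> (Tr A \<longrightarrow> Tr B)"
    and Tr_All: "wff (All \<tau> A) \<Longrightarrow> Tr (All \<tau> A) \<longleftrightarrow> (\<forall>t. t \<^bold>: \<tau> \<longrightarrow> Tr (open_fm 0 t A))"
    and Tr_prv: "T \<turnstile> A \<Longrightarrow> Tr A"

text \<open>
  One step of the construction: a consistent formula is strengthened so that it decides \<open>B\<close> and, if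
  it refutes a universal \<open>B\<close>, names a counterexample. The name is a variable; a fresh one always
  exists because the state of the construction is a single formula and \<open>T\<close> imposes no freshness.
\<close>

lemma henkin_step:
  assumes C: "wff C" "\<not> (T \<turnstile> C \<^bold>\<longrightarrow> Fls)" and B: "wff B"
  shows "\<exists>C'. wff C' \<and> \<not> (T \<turnstile> C' \<^bold>\<longrightarrow> Fls) \<and> (T \<turnstile> C' \<^bold>\<longrightarrow> C) \<and>
    ((T \<turnstile> C' \<^bold>\<longrightarrow> B) \<or> (T \<turnstile> C' \<^bold>\<longrightarrow> (\<^bold>\<not> B)) \<and>
      (\<forall>\<tau> A. B = All \<tau> A \<longrightarrow> (\<exists>t. t \<^bold>: \<tau> \<and> (T \<turnstile> C' \<^bold>\<longrightarrow> (\<^bold>\<not> open_fm 0 t A)))))"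
proof (cases "T \<turnstile> (C \<^bold>\<and> B) \<^bold>\<longrightarrow> Fls")
  case False
  then show ?thesis
    using prv_and1 prv_and2 C B by (intro exI[of _ "C \<^bold>\<and> B"]) auto
next
  case True
  then have CB: "T \<turnstile> C \<^bold>\<longrightarrow> (\<^bold>\<not> B)"
    unfolding Neg_def by (rule prv_export)
  show ?thesis
  proof (cases "\<exists>\<tau> A. B = All \<tau> A")
    case False
    then show ?thesis
      using CB C prv_refl by (intro exI[of _ C]) auto
  next
    case True
    then obtain \<tau> A where BA: "B = All \<tau> A"
      by auto
    obtain v where v: "snd v = \<tau>" "v \<notin> fv (C \<^bold>\<longrightarrow> A)"
      using fresh_var by blast
    let ?A = "open_fm 0 (V v) A"
    have w: "wff ?A"
      using B BA v by (intro wff_open) auto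
    have "\<not> (T \<turnstile> (C \<^bold>\<and> \<^bold>\<not> ?A) \<^bold>\<longrightarrow> Fls)"
    proof
      assume "T \<turnstile> (C \<^bold>\<and> \<^bold>\<not> ?A) \<^bold>\<longrightarrow> Fls"
      then have "T \<turnstile> C \<^bold>\<longrightarrow> \<^bold>\<not> \<^bold>\<not> ?A"
        using prv_export by (simp add: Neg_def)
      then have "T \<turnstile> C \<^bold>\<longrightarrow> ?A"
        using prv_trans prv_dneg w by blast
      then have "T \<turnstile> C \<^bold>\<longrightarrow> (\<^bold>\<forall>v. ?A)"
        using v by (intro prv_gen) auto
      moreover have "(\<^bold>\<forall>v. ?A) = B"
        using v BA by (simp add: fall_def close_open_fm)
      ultimately show False
        using CB C prv_mp_under by (auto simp: Neg_def)
    qed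
    moreover have "T \<turnstile> (C \<^bold>\<and> \<^bold>\<not> ?A) \<^bold>\<longrightarrow> C" "T \<turnstile> (C \<^bold>\<and> \<^bold>\<not> ?A) \<^bold>\<longrightarrow> (\<^bold>\<not> ?A)"
      using C w by (auto intro: prv_and1 prv_and2)
    ultimately show ?thesis
      using C(1) w v(1) BA prv_trans[OF _ CB]
      by (intro exI[of _ "C \<^bold>\<and> \<^bold>\<not> ?A"]) (auto intro!: exI[of _ "V v"])
  qed
qed

text \<open>
  All formulas are decided one after the other, starting from \<open>\<^bold>\<not> A\<close>; true is what follows from
  the formula reached at some stage.
\<close>

theorem henkin_exists:
  assumes A: "wff A" "\<not> (T \<turnstile> A)"
  shows "\<exists>Tr. henkin T Tr \<and> \<not> Tr A"
proof -
  define good where "good C \<longleftrightarrow> wff C \<and> \<not> (T \<turnstile> C \<^bold>\<longrightarrow> Fls)" for C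
  define decides where "decides C B \<longleftrightarrow>
      (T \<turnstile> C \<^bold>\<longrightarrow> B) \<or> (T \<turnstile> C \<^bold>\<longrightarrow> (\<^bold>\<not> B)) \<and>
      (\<forall>\<tau> A. B = All \<tau> A \<longrightarrow> (\<exists>t. t \<^bold>: \<tau> \<and> (T \<turnstile> C \<^bold>\<longrightarrow> (\<^bold>\<not> open_fm 0 t A))))" for C B
  define next_ok where "next_ok n C C' \<longleftrightarrow> (T \<turnstile> C' \<^bold>\<longrightarrow> C) \<and>
      (wff (from_nat n) \<longrightarrow> decides C' (from_nat n))" for n C C'
  have start: "good (\<^bold>\<not> A)"
    unfolding good_def using A prv_dneg[OF A(1)] prv_mp unfolding Neg_def by auto
  have step: "\<exists>C'. good C' \<and> next_ok n C C'" if "good C" for n C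
    using that henkin_step[of C T "from_nat n"] prv_refl[of C T]
    unfolding good_def next_ok_def decides_def by blast
  obtain C where C: "\<And>n. good (C n)" "\<And>n. next_ok n (C n) (C (Suc n))" "C 0 = (\<^bold>\<not> A)"
  proof -
    have "\<exists>f. \<forall>n. (good (f n) \<and> (n = 0 \<longrightarrow> f n = (\<^bold>\<not> A))) \<and> next_ok n (f n) (f (Suc n))"
    proof (rule dependent_nat_choice[of "\<lambda>n C. good C \<and> (n = 0 \<longrightarrow> C = (\<^bold>\<not> A))" next_ok])
      show "\<exists>C. good C \<and> (0 = (0::nat) \<longrightarrow> C = (\<^bold>\<not> A))"
        using start by blast
      show "\<exists>D. (good D \<and> (Suc n = 0 \<longrightarrow> D = (\<^bold>\<not> A))) \<and> next_ok n C D"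
        if "good C \<and> (n = 0 \<longrightarrow> C = (\<^bold>\<not> A))" for C n
        using step[of C n] that by blast
    qed
    then show thesis
      using that by blast
  qed
  have wC: "wff (C n)" for n
    using C(1) by (simp add: good_def)
  have mono: "T \<turnstile> C n \<^bold>\<longrightarrow> C m" if "m \<le> n" for m n
    using that
  proof (induction rule: dec_induct)
    case base
    show ?case using wC by (rule prv_refl)
  next
    case (step n)
    then show ?case using C(2) prv_trans unfolding next_ok_def by blast
  qed
  define Tr where "Tr B \<longleftrightarrow> (\<exists>n. T \<turnstile> C n \<^bold>\<longrightarrow> B)" for B
  have Tr_mp: "Tr Y" if XY: "Tr (X \<^bold>\<longrightarrow> Y)" "Tr X" for X Y
  proof -
    obtain m n where "T \<turnstile> C m \<^bold>\<longrightarrow> X \<^bold>\<longrightarrow> Y" "T \<turnstile> C n \<^bold>\<longrightarrow> X"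
      using XY Tr_def by auto
    then have "T \<turnstile> C (max m n) \<^bold>\<longrightarrow> X \<^bold>\<longrightarrow> Y" "T \<turnstile> C (max m n) \<^bold>\<longrightarrow> X"
      using mono prv_trans by (meson max.cobounded1 max.cobounded2)+
    then show "Tr Y"
      using prv_mp_under Tr_def by blast
  qed
  have Tr_prv: "Tr B" if "T \<turnstile> B" for B
    using prv_weaken[OF that wC] Tr_def by blast
  have Tr_Fls: "\<not> Tr Fls"
    using C(1) by (simp add: Tr_def good_def)
  have dec: "Tr B \<or> Tr (\<^bold>\<not> B) \<and> (\<forall>\<tau> A. B = All \<tau> A \<longrightarrow> (\<exists>t. t \<^bold>: \<tau> \<and> Tr (\<^bold>\<not> open_fm 0 t A)))"
    if "wff B" for B
  proof -
    have "next_ok (to_nat B) (C (to_nat B)) (C (Suc (to_nat B)))"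
      by (rule C(2))
    then have "decides (C (Suc (to_nat B))) B"
      using that by (simp add: next_ok_def)
    then show ?thesis
      unfolding decides_def Tr_def by blast
  qed
  have "henkin T Tr"
  proof
    show "\<not> Tr Fls"
      by fact
    show "Tr X" if "T \<turnstile> X" for X
      using that by (rule Tr_prv)
    show "Tr (X \<^bold>\<longrightarrow> Y) \<longleftrightarrow> (Tr X \<longrightarrow> Tr Y)" if w: "wff X" "wff Y" for X Y
    proof
      assume "Tr X \<longrightarrow> Tr Y"
      then consider "Tr Y" | "Tr (\<^bold>\<not> X)"
        using dec[OF w(1)] by auto
      then show "Tr (X \<^bold>\<longrightarrow> Y)"
        using Tr_mp Tr_prv prv_const[OF w(2,1)] prv_contradict[OF w] by cases blast+
    qed (use Tr_mp in blast)
    show "Tr (All \<tau> X) \<longleftrightarrow> (\<forall>t. t \<^bold>: \<tau> \<longrightarrow> Tr (open_fm 0 t X))" if w: "wff (All \<tau> X)" for \<tau> X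
    proof
      assume X: "Tr (All \<tau> X)"
      have "T \<turnstile> All \<tau> X \<^bold>\<longrightarrow> open_fm 0 t X" if "t \<^bold>: \<tau>" for t
        using w that by (intro prv.impI prv.allE[OF prv.hyp]) auto
      then show "\<forall>t. t \<^bold>: \<tau> \<longrightarrow> Tr (open_fm 0 t X)"
        using X Tr_mp Tr_prv by blast
    next
      assume X: "\<forall>t. t \<^bold>: \<tau> \<longrightarrow> Tr (open_fm 0 t X)"
      show "Tr (All \<tau> X)"
      proof (rule ccontr)
        assume "\<not> Tr (All \<tau> X)"
        then obtain t where "t \<^bold>: \<tau>" "Tr (\<^bold>\<not> open_fm 0 t X)"
          using dec[OF w] by blast
        then show False
          using X Tr_mp Tr_Fls unfolding Neg_def by blast
      qed
    qed
  qed
  moreover have "\<not> Tr A"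
  proof
    assume "Tr A"
    moreover have "Tr (\<^bold>\<not> A)"
      using prv_refl[OF wC[of 0]] C(3) unfolding Tr_def by metis
    ultimately show False
      using Tr_mp Tr_Fls unfolding Neg_def by blast
  qed
  ultimately show ?thesis
    by blast
qed


section \<open>Interpretations\<close>

text \<open>
  A Henkin structure for the finite types: \<open>D \<tau>\<close> are the objects of type \<open>\<tau>\<close>, equality is
  interpreted by equality, and \<open>std\<close> is an arbitrary predicate. Bound indices are evaluated in a
  stack of objects, named variables in an assignment.
\<close>

locale interp =
  fixes D :: "ty \<Rightarrow> 'd set" and app :: "'d \<Rightarrow> 'd \<Rightarrow> 'd" (infixl "\<bullet>" 90)
    and con :: "trm \<Rightarrow> 'd" and std :: "ty \<Rightarrow> 'd \<Rightarrow> bool"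
begin

fun ev :: "(var \<Rightarrow> 'd) \<Rightarrow> 'd list \<Rightarrow> trm \<Rightarrow> 'd" where
  "ev e ds (V v) = e v"
| "ev e ds (Bnd i) = ds ! i"
| "ev e ds (s \<cdot> t) = ev e ds s \<bullet> ev e ds t"
| "ev e ds t = con t"

text \<open>Meant for closed terms, whose value does not depend on the assignment.\<close>

definition val :: "trm \<Rightarrow> 'd" where
  "val = ev undefined []"

text \<open>The order as the formula \<open>Less\<close> defines it.\<close>

definition lt :: "'d \<Rightarrow> 'd \<Rightarrow> bool" where
  "lt x y \<longleftrightarrow> val monus_c \<bullet> (con Succ \<bullet> x) \<bullet> y = con Zero"

fun sat :: "(var \<Rightarrow> 'd) \<Rightarrow> 'd list \<Rightarrow> fm \<Rightarrow> bool" where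
  "sat e ds (s \<^bold>= t) \<longleftrightarrow> ev e ds s = ev e ds t"
| "sat e ds (St \<tau> t) \<longleftrightarrow> std \<tau> (ev e ds t)"
| "sat e ds Fls \<longleftrightarrow> False"
| "sat e ds (A \<^bold>\<longrightarrow> B) \<longleftrightarrow> (sat e ds A \<longrightarrow> sat e ds B)"
| "sat e ds (All \<tau> A) \<longleftrightarrow> (\<forall>d\<in>D \<tau>. sat e (d # ds) A)"
| "sat e ds (BAll t A) \<longleftrightarrow> (\<forall>d\<in>D N. lt d (ev e ds t) \<longrightarrow> sat e (d # ds) A)"

definition env :: "(var \<Rightarrow> 'd) \<Rightarrow> bool" where
  "env e \<longleftrightarrow> (\<forall>v. e v \<in> D (snd v))"

lemma envD: "env e \<Longrightarrow> snd v = \<tau> \<Longrightarrow> e v \<in> D \<tau>"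
  unfolding env_def by blast

lemma env_upd: "env e \<Longrightarrow> d \<in> D (snd v) \<Longrightarrow> env (e(v := d))"
  unfolding env_def fun_upd_apply by metis

lemma ev_closed:
  "tyof \<Delta> t = Some \<tau> \<Longrightarrow> (\<And>v. v \<in> fv_trm t \<Longrightarrow> e v = e' v) \<Longrightarrow>
    ev e (ds @ ds') t = ev e' (ds @ ds'') t" if "length ds = length \<Delta>"
proof (induction t arbitrary: \<tau> rule: fv_trm.induct)
  case (2 s t)
  then show ?case by (auto simp: tyof_App_iff simp del: tyof.simps(3))
qed (use that in \<open>auto split: if_splits simp: nth_append\<close>)

lemma ev_val: "t \<^bold>: \<tau> \<Longrightarrow> fv_trm t = {} \<Longrightarrow> ev e ds t = val t"
  using ev_closed[of "[]" "[]" t \<tau> e undefined ds "[]"] by (simp add: val_def)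

end

text \<open>
  By \<open>ext_fun\<close> and \<open>ext_seq\<close>, objects that \<open>eqf\<close> relates at a function or sequence type are equal.
  Free variables of axioms are universal, so the axioms hold under all assignments.
\<close>

locale model = interp D app con std
  for D :: "ty \<Rightarrow> 'd set" and app (infixl "\<bullet>" 90) and con std +
  fixes T :: "fm set"
  assumes D_nonempty: "D \<tau> \<noteq> {}"
    and app_D: "x \<in> D (\<sigma> \<^bold>\<rightarrow> \<tau>) \<Longrightarrow> y \<in> D \<sigma> \<Longrightarrow> x \<bullet> y \<in> D \<tau>"
    and con_D: "c \<^bold>: \<tau> \<Longrightarrow> \<forall>v. c \<noteq> V v \<Longrightarrow> \<forall>s t. c \<noteq> s \<cdot> t \<Longrightarrow> con c \<in> D \<tau>"
    and ext_fun: "x \<in> D (\<sigma> \<^bold>\<rightarrow> \<tau>) \<Longrightarrow> y \<in> D (\<sigma> \<^bold>\<rightarrow> \<tau>) \<Longrightarrow>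
      (\<And>z. z \<in> D \<sigma> \<Longrightarrow> x \<bullet> z = y \<bullet> z) \<Longrightarrow> x = y"
    and ext_seq: "x \<in> D (Star \<sigma>) \<Longrightarrow> y \<in> D (Star \<sigma>) \<Longrightarrow> con (Len \<sigma>) \<bullet> x = con (Len \<sigma>) \<bullet> y \<Longrightarrow>
      (\<And>i. i \<in> D N \<Longrightarrow> lt i (con (Len \<sigma>) \<bullet> x) \<Longrightarrow>
        con (Prj \<sigma>) \<bullet> x \<bullet> i = con (Prj \<sigma>) \<bullet> y \<bullet> i) \<Longrightarrow> x = y"
    and sat_ax: "A \<in> T \<Longrightarrow> wff A \<Longrightarrow> env e \<Longrightarrow> sat e [] A"


section \<open>The term model of a Henkin set\<close>

text \<open>Simultaneous substitution for named variables and for the indices from \<open>k\<close> on.\<close>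

fun tsub :: "(var \<Rightarrow> trm) \<Rightarrow> nat \<Rightarrow> trm list \<Rightarrow> trm \<Rightarrow> trm" where
  "tsub e k ds (V v) = e v"
| "tsub e k ds (Bnd i) = (if i < k then Bnd i else ds ! (i - k))"
| "tsub e k ds (s \<cdot> t) = tsub e k ds s \<cdot> tsub e k ds t"
| "tsub e k ds t = t"

fun fsub :: "(var \<Rightarrow> trm) \<Rightarrow> nat \<Rightarrow> trm list \<Rightarrow> fm \<Rightarrow> fm" where
  "fsub e k ds (s \<^bold>= t) = (tsub e k ds s \<^bold>= tsub e k ds t)"
| "fsub e k ds (St \<tau> t) = St \<tau> (tsub e k ds t)"
| "fsub e k ds Fls = Fls"
| "fsub e k ds (A \<^bold>\<longrightarrow> B) = (fsub e k ds A \<^bold>\<longrightarrow> fsub e k ds B)"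
| "fsub e k ds (All \<tau> A) = All \<tau> (fsub e (Suc k) ds A)"
| "fsub e k ds (BAll t A) = BAll (tsub e k ds t) (fsub e (Suc k) ds A)"

definition typed :: "(var \<Rightarrow> trm) \<Rightarrow> trm list \<Rightarrow> ty list \<Rightarrow> bool" where
  "typed e ds \<Delta> \<longleftrightarrow> (\<forall>v. e v \<^bold>: snd v) \<and> list_all2 (\<lambda>d \<tau>. d \<^bold>: \<tau>) ds \<Delta>"

lemma typedD: "typed e ds \<Delta> \<Longrightarrow> e v \<^bold>: snd v"
  "typed e ds \<Delta> \<Longrightarrow> i < length \<Delta> \<Longrightarrow> ds ! i \<^bold>: \<Delta> ! i"
  "typed e ds \<Delta> \<Longrightarrow> length ds = length \<Delta>"
  by (cases v, auto simp: typed_def list_all2_conv_all_nth)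

lemma tyof_tsub:
  "tyof (\<Theta> @ \<Delta>) t = Some \<tau> \<Longrightarrow> typed e ds \<Delta> \<Longrightarrow> tyof \<Theta> (tsub e (length \<Theta>) ds t) = Some \<tau>"
proof (induction t arbitrary: \<tau> rule: fv_trm.induct)
  case (1 v)
  then show ?case using tyof_append[of "[]" "e v" "snd v" \<Theta>] by (simp add: typedD)
next
  case (2 s t)
  then show ?case by (auto simp: tyof_App_iff simp del: tyof.simps(3))
next
  case ("3_1" i)
  then show ?case using tyof_append[of "[]" "ds ! (i - length \<Theta>)" \<tau> \<Theta>]
    by (auto simp: nth_append split: if_splits dest: typedD(2)[where i = "i - length \<Theta>"])
qed auto

lemma wf_fsub:
  "wf_fm (\<Theta> @ \<Delta>) A \<Longrightarrow> typed e ds \<Delta> \<Longrightarrow> wf_fm \<Theta> (fsub e (length \<Theta>) ds A)"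
proof (induction A arbitrary: \<Theta> rule: fv.induct)
  case (5 \<tau> A)
  then show ?case using "5.IH"[of "\<tau> # \<Theta>"] by simp
next
  case (6 t A)
  then show ?case using "6.IH"[of "N # \<Theta>"] by (auto intro: tyof_tsub)
qed (auto intro: tyof_tsub)

lemma open_tsub:
  "tyof (\<Theta> @ \<sigma> # \<Delta>) t = Some \<tau> \<Longrightarrow> typed e ds \<Delta> \<Longrightarrow>
    open_trm (length \<Theta>) d (tsub e (Suc (length \<Theta>)) ds t) = tsub e (length \<Theta>) (d # ds) t"
proof (induction t arbitrary: \<tau> rule: fv_trm.induct)
  case (1 v)
  then show ?case using typedD(1)[of e ds \<Delta> v] by simp
next
  case (2 s t)
  then show ?case by (auto simp: tyof_App_iff simp del: tyof.simps(3))
next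
  case ("3_1" i)
  then show ?case using typedD(2)[of e ds \<Delta> "i - Suc (length \<Theta>)"]
    by (auto simp: nth_Cons' split: if_splits)
qed auto

lemma open_fsub:
  "wf_fm (\<Theta> @ \<sigma> # \<Delta>) A \<Longrightarrow> typed e ds \<Delta> \<Longrightarrow>
    open_fm (length \<Theta>) d (fsub e (Suc (length \<Theta>)) ds A) = fsub e (length \<Theta>) (d # ds) A"
proof (induction A arbitrary: \<Theta> rule: fv.induct)
  case (5 \<tau> A)
  then show ?case using "5.IH"[of "\<tau> # \<Theta>"] by simp
next
  case (6 t A)
  then show ?case using "6.IH"[of "N # \<Theta>"] by (auto intro: open_tsub)
qed (auto intro: open_tsub)

lemma tsub_closed: "tyof \<Theta> t = Some \<tau> \<Longrightarrow> fv_trm t = {} \<Longrightarrow> tsub e (length \<Theta>) ds t = t"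
proof (induction t arbitrary: \<tau> rule: fv_trm.induct)
  case (2 s t)
  then show ?case by (auto simp: tyof_App_iff simp del: tyof.simps(3))
qed (auto split: if_splits)

lemma fsub_closed: "wf_fm \<Theta> A \<Longrightarrow> fv A = {} \<Longrightarrow> fsub e (length \<Theta>) ds A = A"
proof (induction A arbitrary: \<Theta> rule: fv.induct)
  case (5 \<tau> A)
  then show ?case using "5.IH"[of "\<tau> # \<Theta>"] by simp
next
  case (6 t A)
  then show ?case using "6.IH"[of "N # \<Theta>"] by (auto intro: tsub_closed)
qed (auto intro: tsub_closed)

text \<open>
  The domain of the term model is the set of well-typed terms modulo \<open>eqf\<close>. The axioms of equality and
  extensionality make this an equivalence relation that application respects; that \<open>st\<close> respects it
  is an axiom on standardness.
\<close>

locale term_model = henkin +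
  assumes EPRA: "EPRA \<subseteq> T" and Standard: "Standard \<subseteq> T"
begin

lemma Tr_Neg [simp]: "wff A \<Longrightarrow> Tr (\<^bold>\<not> A) \<longleftrightarrow> \<not> Tr A"
  by (simp add: Neg_def)

lemma Tr_And [simp]: "wff A \<Longrightarrow> wff B \<Longrightarrow> Tr (A \<^bold>\<and> B) \<longleftrightarrow> Tr A \<and> Tr B"
  by (simp add: And_def)

lemma Tr_ax: "A \<in> T \<Longrightarrow> wff A \<Longrightarrow> Tr A"
  by (intro Tr_prv prv.ax)

lemma Tr_EPRA: "A \<in> EPRA \<Longrightarrow> wff A \<Longrightarrow> Tr A"
  using Tr_ax EPRA by blast

lemma Tr_BAll:
  assumes "wff (BAll t A)"
  shows "Tr (BAll t A) \<longleftrightarrow> (\<forall>s. s \<^bold>: N \<longrightarrow> Tr (s \<^bold>< t) \<longrightarrow> Tr (open_fm 0 s A))"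
proof -
  have t: "t \<^bold>: N" "tyof [N] t = Some N" "wf_fm [N] A"
    using assms tyof_append[of "[]" t N "[N]"] by auto
  have w: "wff (All N (Bnd 0 \<^bold>< t \<^bold>\<longrightarrow> A))"
    using t by simp
  have "Tr (BAll t A \<^bold>\<longleftrightarrow> All N (Bnd 0 \<^bold>< t \<^bold>\<longrightarrow> A))"
    using assms w by (intro Tr_EPRA EPRA.BAll_def) (auto simp del: wf_fm.simps)
  then have "Tr (BAll t A) \<longleftrightarrow> Tr (All N (Bnd 0 \<^bold>< t \<^bold>\<longrightarrow> A))"
    using assms w by (auto simp: Iff_def simp del: wf_fm.simps(5,6))
  also have "\<dots> \<longleftrightarrow> (\<forall>s. s \<^bold>: N \<longrightarrow> Tr (open_fm 0 s (Bnd 0 \<^bold>< t \<^bold>\<longrightarrow> A)))"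
    using w by (rule Tr_All)
  also have "\<dots> \<longleftrightarrow> (\<forall>s. s \<^bold>: N \<longrightarrow> Tr ((s \<^bold>< t) \<^bold>\<longrightarrow> open_fm 0 s A))"
    using t(1) by (simp add: Less_def Leq_def open_closed[OF monus_c_type(1)])
  also have "\<dots> \<longleftrightarrow> (\<forall>s. s \<^bold>: N \<longrightarrow> Tr (s \<^bold>< t) \<longrightarrow> Tr (open_fm 0 s A))"
    using t wff_open[of N A] by auto
  finally show ?thesis .
qed

abbreviation eqv :: "ty \<Rightarrow> trm \<Rightarrow> trm \<Rightarrow> bool" where
  "eqv \<tau> s t \<equiv> Tr (eqf \<tau> s t)"

lemma eqv_eucl: "s \<^bold>: N \<Longrightarrow> t \<^bold>: N \<Longrightarrow> u \<^bold>: N \<Longrightarrow> eqv N s t \<Longrightarrow> eqv N s u \<Longrightarrow> eqv N t u"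
  using Tr_EPRA[OF EPRA.eq_eucl[of s t u]] by simp

lemma eqv_fun:
  "s \<^bold>: \<sigma> \<^bold>\<rightarrow> \<tau> \<Longrightarrow> t \<^bold>: \<sigma> \<^bold>\<rightarrow> \<tau> \<Longrightarrow>
    eqv (\<sigma> \<^bold>\<rightarrow> \<tau>) s t \<longleftrightarrow> (\<forall>u. u \<^bold>: \<sigma> \<longrightarrow> eqv \<tau> (s \<cdot> u) (t \<cdot> u))"
  using Tr_All[OF wf_eqf[of "[]" s "\<sigma> \<^bold>\<rightarrow> \<tau>" t, unfolded eqf.simps]] by (auto simp: open_eqf)

lemma eqv_app: "s \<^bold>: \<rho> \<Longrightarrow> t \<^bold>: \<rho> \<Longrightarrow> u \<^bold>: \<rho> \<^bold>\<rightarrow> \<tau> \<Longrightarrow> eqv \<rho> s t \<Longrightarrow> eqv \<tau> (u \<cdot> s) (u \<cdot> t)"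
  using Tr_EPRA[OF EPRA.ext[of s \<rho> t u \<tau>]] by (simp add: wf_eqf)

text \<open>Needed because the bound in \<open>eqf\<close> at sequence types is the length of the left-hand side only.\<close>

lemma eqv_Less:
  assumes "i \<^bold>: N" "s \<^bold>: N" "t \<^bold>: N" "eqv N s t" "Tr (i \<^bold>< s)"
  shows "Tr (i \<^bold>< t)"
  using eqv_app[of s N t "monus_c \<cdot> (Succ \<cdot> i)" N]
    eqv_eucl[of "monus_c \<cdot> (Succ \<cdot> i) \<cdot> s" "monus_c \<cdot> (Succ \<cdot> i) \<cdot> t" Zero] assms
  by (simp add: Less_def Leq_def)

lemma eqv_seq:
  assumes "s \<^bold>: Star \<sigma>" "t \<^bold>: Star \<sigma>"
  shows "eqv (Star \<sigma>) s t \<longleftrightarrow> eqv N (Len \<sigma> \<cdot> s) (Len \<sigma> \<cdot> t) \<and>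
    (\<forall>i. i \<^bold>: N \<longrightarrow> Tr (i \<^bold>< Len \<sigma> \<cdot> s) \<longrightarrow> eqv \<sigma> (Prj \<sigma> \<cdot> s \<cdot> i) (Prj \<sigma> \<cdot> t \<cdot> i))"
proof -
  let ?B = "BAll (Len \<sigma> \<cdot> s) (eqf \<sigma> (Prj \<sigma> \<cdot> lift_trm s \<cdot> Bnd 0) (Prj \<sigma> \<cdot> lift_trm t \<cdot> Bnd 0))"
  have w: "wff ?B"
    using wf_eqf[of "[]" s "Star \<sigma>" t] assms by simp
  then have "eqv (Star \<sigma>) s t \<longleftrightarrow> eqv N (Len \<sigma> \<cdot> s) (Len \<sigma> \<cdot> t) \<and> Tr ?B"
    using assms by (simp del: wf_fm.simps(6))
  then show ?thesis
    unfolding Tr_BAll[OF w] using assms by (auto simp: open_eqf)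
qed

lemma eqv_equivalence:
  "(\<forall>s. s \<^bold>: \<tau> \<longrightarrow> eqv \<tau> s s) \<and>
   (\<forall>s t u. s \<^bold>: \<tau> \<longrightarrow> t \<^bold>: \<tau> \<longrightarrow> u \<^bold>: \<tau> \<longrightarrow> eqv \<tau> s t \<longrightarrow> eqv \<tau> s u \<longrightarrow> eqv \<tau> t u)"
proof (induction \<tau>)
  case N
  \<comment> \<open>Without the qualifier, the names of the rules denote rules of \<open>prv\<close>.\<close>
  show ?case
  proof (intro conjI HOL.allI HOL.impI)
    show "eqv N s s" if "s \<^bold>: N" for s
      using that Tr_EPRA[OF EPRA.eq_refl[OF that]] by simp
    show "eqv N t u" if "s \<^bold>: N" "t \<^bold>: N" "u \<^bold>: N" "eqv N s t" "eqv N s u" for s t u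
      using that by (rule eqv_eucl)
  qed
next
  case (Fun \<sigma> \<tau>)
  have app: "s \<cdot> u \<^bold>: \<tau>" if "s \<^bold>: \<sigma> \<^bold>\<rightarrow> \<tau>" "u \<^bold>: \<sigma>" for s u
    using that by simp
  show ?case
  proof (intro conjI HOL.allI HOL.impI)
    fix s assume "s \<^bold>: \<sigma> \<^bold>\<rightarrow> \<tau>"
    then show "eqv (\<sigma> \<^bold>\<rightarrow> \<tau>) s s"
      using Fun.IH(2) app eqv_fun by blast
  next
    fix s t u
    assume a: "s \<^bold>: \<sigma> \<^bold>\<rightarrow> \<tau>" "t \<^bold>: \<sigma> \<^bold>\<rightarrow> \<tau>" "u \<^bold>: \<sigma> \<^bold>\<rightarrow> \<tau>"
      "eqv (\<sigma> \<^bold>\<rightarrow> \<tau>) s t" "eqv (\<sigma> \<^bold>\<rightarrow> \<tau>) s u"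
    have "eqv \<tau> (t \<cdot> x) (u \<cdot> x)" if x: "x \<^bold>: \<sigma>" for x
    proof -
      have "eqv \<tau> (s \<cdot> x) (t \<cdot> x)" "eqv \<tau> (s \<cdot> x) (u \<cdot> x)"
        using a x eqv_fun by blast+
      then show ?thesis
        using Fun.IH(2) app[OF _ x] a by blast
    qed
    then show "eqv (\<sigma> \<^bold>\<rightarrow> \<tau>) t u"
      using eqv_fun a by blast
  qed
next
  case (Star \<sigma>)
  have p: "Prj \<sigma> \<cdot> s \<cdot> i \<^bold>: \<sigma>" if "s \<^bold>: Star \<sigma>" "i \<^bold>: N" for s i
    using that by simp
  have l: "Len \<sigma> \<cdot> s \<^bold>: N" if "s \<^bold>: Star \<sigma>" for s
    using that by simp
  have e: "eqv N s s" if "s \<^bold>: N" for s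
    using Tr_EPRA[OF EPRA.eq_refl] that by auto
  show ?case
  proof (intro conjI HOL.allI HOL.impI)
    fix s assume "s \<^bold>: Star \<sigma>"
    then show "eqv (Star \<sigma>) s s"
      using e l p Star.IH by (subst eqv_seq) blast+
  next
    fix s t u
    assume a: "s \<^bold>: Star \<sigma>" "t \<^bold>: Star \<sigma>" "u \<^bold>: Star \<sigma>" "eqv (Star \<sigma>) s t" "eqv (Star \<sigma>) s u"
    have st: "eqv N (Len \<sigma> \<cdot> s) (Len \<sigma> \<cdot> t)" "eqv N (Len \<sigma> \<cdot> s) (Len \<sigma> \<cdot> u)"
      using a eqv_seq by blast+
    then have ts: "eqv N (Len \<sigma> \<cdot> t) (Len \<sigma> \<cdot> s)"
      using e l a eqv_eucl by blast
    show "eqv (Star \<sigma>) t u"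
      unfolding eqv_seq[OF a(2,3)]
    proof (intro conjI HOL.allI HOL.impI)
      show "eqv N (Len \<sigma> \<cdot> t) (Len \<sigma> \<cdot> u)"
        using st l a eqv_eucl by blast
      fix i assume i: "i \<^bold>: N" "Tr (i \<^bold>< Len \<sigma> \<cdot> t)"
      then have "Tr (i \<^bold>< Len \<sigma> \<cdot> s)"
        using ts l a eqv_Less by blast
      then have "eqv \<sigma> (Prj \<sigma> \<cdot> s \<cdot> i) (Prj \<sigma> \<cdot> t \<cdot> i)" "eqv \<sigma> (Prj \<sigma> \<cdot> s \<cdot> i) (Prj \<sigma> \<cdot> u \<cdot> i)"
        using a i eqv_seq by blast+
      then show "eqv \<sigma> (Prj \<sigma> \<cdot> t \<cdot> i) (Prj \<sigma> \<cdot> u \<cdot> i)"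
        using Star.IH p a i by blast
    qed
  qed
qed

lemma eqv_refl: "s \<^bold>: \<tau> \<Longrightarrow> eqv \<tau> s s"
  using eqv_equivalence by blast

lemma eqv_sym: "s \<^bold>: \<tau> \<Longrightarrow> t \<^bold>: \<tau> \<Longrightarrow> eqv \<tau> s t \<Longrightarrow> eqv \<tau> t s"
  using eqv_equivalence by blast

lemma eqv_trans: "s \<^bold>: \<tau> \<Longrightarrow> t \<^bold>: \<tau> \<Longrightarrow> u \<^bold>: \<tau> \<Longrightarrow> eqv \<tau> s t \<Longrightarrow> eqv \<tau> t u \<Longrightarrow> eqv \<tau> s u"
  using eqv_equivalence by blast

text \<open>
  Representatives are chosen instead of forming classes: the objects are then terms themselves and
  can be substituted into formulas.
\<close>

definition nf :: "trm \<Rightarrow> trm" where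
  "nf t = (SOME s. tyof [] s = tyof [] t \<and> eqv (the (tyof [] t)) t s)"

lemma nf: assumes "t \<^bold>: \<tau>" shows "nf t \<^bold>: \<tau>" "eqv \<tau> t (nf t)"
proof -
  have "tyof [] t = tyof [] t \<and> eqv (the (tyof [] t)) t t"
    using assms eqv_refl by simp
  then have "tyof [] (nf t) = tyof [] t \<and> eqv (the (tyof [] t)) t (nf t)"
    unfolding nf_def by (rule someI)
  then show "nf t \<^bold>: \<tau>" "eqv \<tau> t (nf t)"
    using assms by auto
qed

lemma nf_eq:
  assumes "s \<^bold>: \<tau>" "t \<^bold>: \<tau>"
  shows "nf s = nf t \<longleftrightarrow> eqv \<tau> s t"
proof
  assume "nf s = nf t"
  then show "eqv \<tau> s t"
    using nf[OF assms(1)] nf[OF assms(2)] eqv_trans[OF assms(1) _ assms(2)] eqv_sym[OF assms(2)]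
    by metis
next
  assume st: "eqv \<tau> s t"
  have "eqv \<tau> s u \<longleftrightarrow> eqv \<tau> t u" if "u \<^bold>: \<tau>" for u
    using that st assms eqv_trans eqv_sym by blast
  then have "(\<lambda>u. tyof [] u = Some \<tau> \<and> eqv \<tau> s u) = (\<lambda>u. tyof [] u = Some \<tau> \<and> eqv \<tau> t u)"
    by auto
  then show "nf s = nf t"
    using assms by (simp add: nf_def)
qed

lemma nf_app:
  assumes "s \<^bold>: \<sigma> \<^bold>\<rightarrow> \<tau>" "t \<^bold>: \<sigma>"
  shows "nf (nf s \<cdot> nf t) = nf (s \<cdot> t)"
proof -
  have "eqv \<tau> (s \<cdot> t) (nf s \<cdot> t)"
    using nf[OF assms(1)] eqv_fun assms by blast
  moreover have "eqv \<tau> (nf s \<cdot> t) (nf s \<cdot> nf t)"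
    using nf[OF assms(1)] nf[OF assms(2)] eqv_app assms by blast
  moreover have ty: "s \<cdot> t \<^bold>: \<tau>" "nf s \<cdot> t \<^bold>: \<tau>" "nf s \<cdot> nf t \<^bold>: \<tau>"
    using assms nf(1)[OF assms(1)] nf(1)[OF assms(2)] by auto
  ultimately have "eqv \<tau> (s \<cdot> t) (nf s \<cdot> nf t)"
    using eqv_trans by blast
  then show ?thesis
    using nf_eq ty by metis
qed

definition Dm :: "ty \<Rightarrow> trm set" where
  "Dm \<tau> = {nf t | t. t \<^bold>: \<tau>}"

lemma Dm_nf: "d \<in> Dm \<tau> \<Longrightarrow> nf d = d" "d \<in> Dm \<tau> \<Longrightarrow> d \<^bold>: \<tau>"
  using nf nf_eq eqv_sym by (fastforce simp: Dm_def)+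

lemma nf_Dm: "t \<^bold>: \<tau> \<Longrightarrow> nf t \<in> Dm \<tau>"
  by (auto simp: Dm_def)

sublocale interp Dm "\<lambda>s t. nf (s \<cdot> t)" nf "\<lambda>\<tau> t. Tr (St \<tau> t)" .

lemma ev_nf:
  assumes "env e" "typed e ds \<Delta>"
  shows "tyof \<Delta> t = Some \<tau> \<Longrightarrow> ev e (map nf ds) t = nf (tsub e 0 ds t)"
proof (induction t arbitrary: \<tau> rule: fv_trm.induct)
  case (1 v)
  then show ?case using Dm_nf(1)[OF envD[OF assms(1)]] by simp
next
  case (2 s t)
  then obtain \<sigma> where \<sigma>: "tyof \<Delta> s = Some (\<sigma> \<^bold>\<rightarrow> \<tau>)" "tyof \<Delta> t = Some \<sigma>"
    by (auto simp: tyof_App_iff simp del: tyof.simps(3))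
  then have "tsub e 0 ds s \<^bold>: \<sigma> \<^bold>\<rightarrow> \<tau>" "tsub e 0 ds t \<^bold>: \<sigma>"
    using tyof_tsub[of "[]" \<Delta> _ _ e ds] assms by auto
  then show ?case
    using 2 \<sigma> nf_app by simp
qed (use typedD[OF assms(2)] in \<open>auto split: if_splits\<close>)

lemma env_typed: "env e \<Longrightarrow> typed e [] []"
  using Dm_nf by (auto simp: env_def typed_def)

lemma val_nf: "t \<^bold>: \<tau> \<Longrightarrow> fv_trm t = {} \<Longrightarrow> val t = nf t"
proof -
  assume t: "t \<^bold>: \<tau>" "fv_trm t = {}"
  have "env (\<lambda>v. nf (V v))"
    by (auto simp: env_def intro: nf_Dm)
  from ev_nf[OF this env_typed[OF this] t(1)] show ?thesis
    using ev_val[OF t] tsub_closed[of "[]" t] t by simp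
qed

lemma lt_nf: "s \<^bold>: N \<Longrightarrow> t \<^bold>: N \<Longrightarrow> lt (nf s) (nf t) \<longleftrightarrow> Tr (s \<^bold>< t)"
proof -
  assume st: "s \<^bold>: N" "t \<^bold>: N"
  have "nf (nf (nf monus_c \<cdot> nf (nf Succ \<cdot> nf s)) \<cdot> nf t) = nf (monus_c \<cdot> (Succ \<cdot> s) \<cdot> t)"
    using st by (subst nf_app[of Succ N N s], simp, simp,
        subst nf_app[of monus_c N "N \<^bold>\<rightarrow> N"], simp, simp, subst nf_app[of _ N N], simp_all)
  moreover have "nf (monus_c \<cdot> (Succ \<cdot> s) \<cdot> t) = nf Zero \<longleftrightarrow> eqv N (monus_c \<cdot> (Succ \<cdot> s) \<cdot> t) Zero"
    using st by (intro nf_eq) auto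
  ultimately show ?thesis
    by (simp add: lt_def val_nf[OF monus_c_type] Less_def Leq_def)
qed

lemma Tr_St_nf: "t \<^bold>: \<tau> \<Longrightarrow> Tr (St \<tau> (nf t)) \<longleftrightarrow> Tr (St \<tau> t)"
proof -
  have *: "Tr (St \<tau> s) \<Longrightarrow> eqv \<tau> s t \<Longrightarrow> s \<^bold>: \<tau> \<Longrightarrow> t \<^bold>: \<tau> \<Longrightarrow> Tr (St \<tau> t)" for s t
    using Tr_ax[of "St \<tau> s \<^bold>\<and> eqf \<tau> s t \<^bold>\<longrightarrow> St \<tau> t"] Standard Standard.st_eq[of s \<tau> t]
    by (auto simp: wf_eqf)
  assume "t \<^bold>: \<tau>"
  then show ?thesis
    using * nf[of t \<tau>] eqv_sym by blast
qed

text \<open>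
  The truth lemma. It speaks of arbitrary terms on the stack, not only of representatives, so that
  no invariance of \<open>Tr\<close> under provable equality has to be shown beforehand.
\<close>

lemma truth:
  assumes "env e"
  shows "wf_fm \<Delta> A \<Longrightarrow> typed e ds \<Delta> \<Longrightarrow> sat e (map nf ds) A \<longleftrightarrow> Tr (fsub e 0 ds A)"
proof (induction A arbitrary: \<Delta> ds rule: fv.induct)
  case (1 s t)
  then have "tsub e 0 ds s \<^bold>: N" "tsub e 0 ds t \<^bold>: N"
    using tyof_tsub[of "[]" \<Delta> _ _ e ds] by auto
  then show ?case
    using 1 ev_nf[OF assms 1(2)] nf_eq[of "tsub e 0 ds s" N "tsub e 0 ds t"] by simp
next
  case (2 \<tau> t)
  then show ?case
    using ev_nf[OF assms 2(2)] tyof_tsub[of "[]" \<Delta> t \<tau> e ds] by (simp add: Tr_St_nf)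
next
  case (4 A B)
  then show ?case
    using wf_fsub[of "[]" \<Delta> A e ds] wf_fsub[of "[]" \<Delta> B e ds]
      "4.IH"(1)[of \<Delta> ds] "4.IH"(2)[of \<Delta> ds] by simp
next
  case (5 \<tau> A)
  have w: "wff (All \<tau> (fsub e (Suc 0) ds A))"
    using wf_fsub[of "[]" \<Delta> "All \<tau> A" e ds] 5 by simp
  have ty: "typed e (t # ds) (\<tau> # \<Delta>)" if "t \<^bold>: \<tau>" for t
    using 5(3) that by (simp add: typed_def)
  have op: "open_fm 0 t (fsub e (Suc 0) ds A) = fsub e 0 (t # ds) A" for t
    using open_fsub[of "[]" \<tau> \<Delta> A e ds t] 5 by simp
  have "sat e (map nf ds) (All \<tau> A) \<longleftrightarrow> (\<forall>t. t \<^bold>: \<tau> \<longrightarrow> sat e (map nf (t # ds)) A)"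
    by (auto simp: Dm_def)
  also have "\<dots> \<longleftrightarrow> (\<forall>t. t \<^bold>: \<tau> \<longrightarrow> Tr (fsub e 0 (t # ds) A))"
    using 5 ty by (metis wf_fm.simps(5))
  also have "\<dots> \<longleftrightarrow> Tr (fsub e 0 ds (All \<tau> A))"
    using Tr_All[OF w] by (simp add: op)
  finally show ?case .
next
  case (6 s A)
  have w: "wff (BAll (tsub e 0 ds s) (fsub e (Suc 0) ds A))"
    using wf_fsub[of "[]" \<Delta> "BAll s A" e ds] 6 by simp
  have ty: "typed e (t # ds) (N # \<Delta>)" if "t \<^bold>: N" for t
    using 6(3) that by (simp add: typed_def)
  have op: "open_fm 0 t (fsub e (Suc 0) ds A) = fsub e 0 (t # ds) A" for t
    using open_fsub[of "[]" N \<Delta> A e ds t] 6 by simp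
  have "sat e (map nf ds) (BAll s A) \<longleftrightarrow>
      (\<forall>t. t \<^bold>: N \<longrightarrow> lt (nf t) (nf (tsub e 0 ds s)) \<longrightarrow> sat e (map nf (t # ds)) A)"
    using ev_nf[OF assms 6(3)] 6(2) by (auto simp: Dm_def)
  also have "\<dots> \<longleftrightarrow> (\<forall>t. t \<^bold>: N \<longrightarrow> Tr (t \<^bold>< tsub e 0 ds s) \<longrightarrow> Tr (fsub e 0 (t # ds) A))"
    using 6 ty lt_nf w by (metis wf_fm.simps(6))
  also have "\<dots> \<longleftrightarrow> Tr (fsub e 0 ds (BAll s A))"
    using Tr_BAll[OF w] by (simp add: op)
  finally show ?case .
qed auto

lemma truth_sentence: "wff A \<Longrightarrow> fv A = {} \<Longrightarrow> env e \<Longrightarrow> sat e [] A \<longleftrightarrow> Tr A"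
  using truth[of e "[]" A "[]"] env_typed fsub_closed[of "[]" A] by simp

end

context interp
begin

lemma ev_close:
  "tyof \<Delta> t = Some \<tau> \<Longrightarrow> length ds = length \<Delta> \<Longrightarrow>
    ev e (ds @ [d]) (close_trm v (length \<Delta>) t) = ev (e(v := d)) ds t"
proof (induction t arbitrary: \<tau> rule: fv_trm.induct)
  case (2 s t)
  then show ?case by (auto simp: tyof_App_iff simp del: tyof.simps(3))
qed (auto simp: nth_append split: if_splits)

lemma sat_close:
  "wf_fm \<Delta> A \<Longrightarrow> length ds = length \<Delta> \<Longrightarrow>
    sat e (ds @ [d]) (close_fm v (length \<Delta>) A) = sat (e(v := d)) ds A"
proof (induction A arbitrary: \<Delta> ds rule: fv.induct)
  case (5 \<tau> A)
  then show ?case using "5.IH"[of "\<tau> # \<Delta>" "_ # ds"] by simp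
next
  case (6 t A)
  then show ?case using "6.IH"[of "N # \<Delta>" "_ # ds"] by (simp add: ev_close del: fun_upd_apply)
qed (auto simp: ev_close)

lemma sat_fall [simp]: "wff A \<Longrightarrow> sat e [] (\<^bold>\<forall>v. A) \<longleftrightarrow> (\<forall>d\<in>D (snd v). sat (e(v := d)) [] A)"
  using sat_close[of "[]" A "[]" e _ v] by (simp add: fall_def)

end

lemma prv_spec: "T \<turnstile> (\<^bold>\<forall>v. A) \<Longrightarrow> wff A \<Longrightarrow> T \<turnstile> A"
  using prv.allE[of T "[]" "snd v" "close_fm v 0 A" "V v"] open_close_fm[of "[]" A v]
  by (simp add: fall_def)

text \<open>
  Through universal closures, truth under all assignments reduces to the truth lemma for sentences,
  on which substitution does nothing.
\<close>

lemma universal_closure: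
  "wff A \<Longrightarrow> wff (foldr fall vs A) \<and> fv (foldr fall vs A) = fv A - set vs \<and>
    (T \<turnstile> foldr fall vs A) = (T \<turnstile> A)"
proof (induction vs)
  case (Cons v vs)
  then show ?case
    using prv_spec[of T v "foldr fall vs A"] prv.allI[of T "[]" "foldr fall vs A" v] by auto
qed simp

lemma (in interp) sat_closure:
  "wff A \<Longrightarrow> env e \<Longrightarrow> sat e [] (foldr fall vs A) \<Longrightarrow> sat e [] A"
proof (induction vs)
  case (Cons v vs)
  have "e v \<in> D (snd v)"
    using Cons.prems envD by blast
  then have "sat (e(v := e v)) [] (foldr fall vs A)"
    using Cons.prems sat_fall[of "foldr fall vs A" e v] universal_closure[of A vs] by auto
  then show ?case
    using Cons by simp
qed simp

sublocale term_model \<subseteq> model Dm "\<lambda>s t. nf (s \<cdot> t)" nf "\<lambda>\<tau> t. Tr (St \<tau> t)" T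
proof
  show "Dm \<tau> \<noteq> {}" for \<tau>
    using nf_Dm[of "V (undefined, \<tau>)"] by auto
  show "nf (x \<cdot> y) \<in> Dm \<tau>" if "x \<in> Dm (\<sigma> \<^bold>\<rightarrow> \<tau>)" "y \<in> Dm \<sigma>" for x y \<sigma> \<tau>
    using that Dm_nf(2) by (intro nf_Dm) simp
  show "nf c \<in> Dm \<tau>" if "c \<^bold>: \<tau>" for c \<tau>
    using that by (rule nf_Dm)
  show "x = y" if xy: "x \<in> Dm (\<sigma> \<^bold>\<rightarrow> \<tau>)" "y \<in> Dm (\<sigma> \<^bold>\<rightarrow> \<tau>)"
    and eq: "\<And>z. z \<in> Dm \<sigma> \<Longrightarrow> nf (x \<cdot> z) = nf (y \<cdot> z)" for x y \<sigma> \<tau>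
  proof -
    have "eqv \<tau> (x \<cdot> u) (y \<cdot> u)" if u: "u \<^bold>: \<sigma>" for u
    proof -
      have "nf (x \<cdot> u) = nf (y \<cdot> u)"
        using eq[OF nf_Dm[OF u]] nf_app[OF _ u] xy Dm_nf by metis
      then show ?thesis
        using nf_eq[of "x \<cdot> u" \<tau> "y \<cdot> u"] u xy Dm_nf by auto
    qed
    then show "x = y"
      using eqv_fun nf_eq Dm_nf xy by metis
  qed
  show "x = y" if xy: "x \<in> Dm (Star \<sigma>)" "y \<in> Dm (Star \<sigma>)"
    and len: "nf (nf (Len \<sigma>) \<cdot> x) = nf (nf (Len \<sigma>) \<cdot> y)"
    and eq: "\<And>i. i \<in> Dm N \<Longrightarrow> lt i (nf (nf (Len \<sigma>) \<cdot> x)) \<Longrightarrow>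
        nf (nf (nf (Prj \<sigma>) \<cdot> x) \<cdot> i) = nf (nf (nf (Prj \<sigma>) \<cdot> y) \<cdot> i)" for x y \<sigma>
  proof -
    have ty: "x \<^bold>: Star \<sigma>" "y \<^bold>: Star \<sigma>"
      using xy Dm_nf by auto
    have L: "nf (nf (Len \<sigma>) \<cdot> u) = nf (Len \<sigma> \<cdot> u)" if "u \<in> Dm (Star \<sigma>)" for u
      using nf_app[of "Len \<sigma>" "Star \<sigma>" N u] Dm_nf[OF that] by simp
    have P: "nf (nf (nf (Prj \<sigma>) \<cdot> u) \<cdot> nf i) = nf (Prj \<sigma> \<cdot> u \<cdot> i)"
      if "u \<in> Dm (Star \<sigma>)" "i \<^bold>: N" for u i
      using nf_app[of "Prj \<sigma>" "Star \<sigma>" "N \<^bold>\<rightarrow> \<sigma>" u] nf_app[of "Prj \<sigma> \<cdot> u" N \<sigma> i] Dm_nf[OF that(1)] that(2)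
      by simp
    have "eqv \<sigma> (Prj \<sigma> \<cdot> x \<cdot> i) (Prj \<sigma> \<cdot> y \<cdot> i)" if i: "i \<^bold>: N" "Tr (i \<^bold>< Len \<sigma> \<cdot> x)" for i
    proof -
      have "lt (nf i) (nf (nf (Len \<sigma>) \<cdot> x))"
        using i lt_nf[of i "Len \<sigma> \<cdot> x"] ty L[OF xy(1)] by simp
      then have "nf (Prj \<sigma> \<cdot> x \<cdot> i) = nf (Prj \<sigma> \<cdot> y \<cdot> i)"
        using eq[OF nf_Dm[OF i(1)]] P i xy by simp
      then show ?thesis
        using nf_eq[of "Prj \<sigma> \<cdot> x \<cdot> i" \<sigma> "Prj \<sigma> \<cdot> y \<cdot> i"] ty i by simp
    qed
    moreover have "eqv N (Len \<sigma> \<cdot> x) (Len \<sigma> \<cdot> y)"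
      using len L xy nf_eq[of "Len \<sigma> \<cdot> x" N "Len \<sigma> \<cdot> y"] ty by simp
    ultimately have "eqv (Star \<sigma>) x y"
      using eqv_seq[OF ty] by blast
    then show "x = y"
      using nf_eq[OF ty] Dm_nf xy by metis
  qed
  show "sat e [] A" if A: "A \<in> T" "wff A" "env e" for A e
  proof -
    obtain vs where vs: "set vs = fv A"
      using finite_fv finite_list by blast
    have "T \<turnstile> foldr fall vs A"
      using A prv.ax universal_closure by blast
    then have "sat e [] (foldr fall vs A)"
      using Tr_prv truth_sentence[OF _ _ A(3)] universal_closure[OF A(2)] vs by simp
    then show ?thesis
      using sat_closure A by blast
  qed
qed

text \<open>
  An unprovable sentence is omitted by some Henkin set, whose term model refutes it. The systems
  \<open>EPRA\<close> and \<open>Standard\<close> provide what the quotient by \<open>eqf\<close> needs.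
\<close>

theorem completeness:
  assumes T: "EPRA \<subseteq> T" "Standard \<subseteq> T" and A: "wff A" "fv A = {}"
    and sat: "\<And>(D :: ty \<Rightarrow> trm set) app con std e.
      model D app con std T \<Longrightarrow> interp.env D e \<Longrightarrow> interp.sat D app con std e [] A"
  shows "T \<turnstile> A"
proof (rule ccontr)
  assume "\<not> (T \<turnstile> A)"
  then obtain Tr where Tr: "henkin T Tr" "\<not> Tr A"
    using henkin_exists A by blast
  then interpret term_model T Tr
    using T by (simp add: term_model_def term_model_axioms_def)
  have e: "env (\<lambda>v. nf (V v))"
    by (auto simp: env_def intro: nf_Dm)
  have "sat (\<lambda>v. nf (V v)) [] A"
    using sat[OF model_axioms e] .
  then show False
    using truth_sentence[OF A e] Tr by simp
qed


section \<open>Evaluation in models\<close>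

context interp
begin

lemma sat_Neg [simp]: "sat e ds (\<^bold>\<not> A) \<longleftrightarrow> \<not> sat e ds A"
  by (simp add: Neg_def)

lemma sat_And [simp]: "sat e ds (A \<^bold>\<and> B) \<longleftrightarrow> sat e ds A \<and> sat e ds B"
  by (simp add: And_def)

lemma sat_Iff [simp]: "sat e ds (A \<^bold>\<longleftrightarrow> B) \<longleftrightarrow> (sat e ds A \<longleftrightarrow> sat e ds B)"
  by (auto simp: Iff_def)

lemma sat_fex [simp]: "wff A \<Longrightarrow> sat e [] (\<^bold>\<exists>v. A) \<longleftrightarrow> (\<exists>d\<in>D (snd v). sat (e(v := d)) [] A)"
  by (simp add: fex_def)

lemma sat_fall_st [simp]:
  "wff A \<Longrightarrow> sat e [] (\<^bold>\<forall>\<^sup>s\<^sup>t v. A) \<longleftrightarrow> (\<forall>d\<in>D (snd v). std (snd v) d \<longrightarrow> sat (e(v := d)) [] A)"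
  by (simp add: fall_st_def)

lemma sat_fex_st [simp]:
  "wff A \<Longrightarrow> sat e [] (\<^bold>\<exists>\<^sup>s\<^sup>t v. A) \<longleftrightarrow> (\<exists>d\<in>D (snd v). std (snd v) d \<and> sat (e(v := d)) [] A)"
  by (simp add: fex_st_def)

lemma sat_fball [simp]:
  "wff A \<Longrightarrow> sat e [] (\<^bold>\<forall>i\<^bold><t. A) \<longleftrightarrow> (\<forall>d\<in>D N. lt d (ev e [] t) \<longrightarrow> sat (e(i := d)) [] A)"
  using sat_close[of "[]" A "[]" e _ i] by (simp add: fball_def)

lemma sat_fbex [simp]:
  "wff A \<Longrightarrow> sat e [] (\<^bold>\<exists>i\<^bold><t. A) \<longleftrightarrow> (\<exists>d\<in>D N. lt d (ev e [] t) \<and> sat (e(i := d)) [] A)"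
  by (auto simp add: fbex_def)

lemma ev_open:
  "tyof (\<Delta> @ [\<sigma>]) t = Some \<tau> \<Longrightarrow> u \<^bold>: \<sigma> \<Longrightarrow> length ds = length \<Delta> \<Longrightarrow>
    ev e ds (open_trm (length \<Delta>) u t) = ev e (ds @ [ev e [] u]) t"
proof (induction t arbitrary: \<tau> rule: fv_trm.induct)
  case (2 s t)
  then show ?case by (auto simp: tyof_App_iff simp del: tyof.simps(3))
next
  case ("3_1" i)
  then show ?case using ev_closed[of "[]" "[]" u \<sigma> e e ds "[]"]
    by (auto simp: nth_append split: if_splits)
qed auto

lemma sat_open:
  "wf_fm (\<Delta> @ [\<sigma>]) A \<Longrightarrow> u \<^bold>: \<sigma> \<Longrightarrow> length ds = length \<Delta> \<Longrightarrow>
    sat e ds (open_fm (length \<Delta>) u A) = sat e (ds @ [ev e [] u]) A"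
proof (induction A arbitrary: \<Delta> ds rule: fv.induct)
  case (5 \<tau> A)
  then show ?case using "5.IH"[of "\<tau> # \<Delta>" "_ # ds"] by simp
next
  case (6 t A)
  then show ?case using "6.IH"[of "N # \<Delta>" "_ # ds"] by (simp add: ev_open[of \<Delta> \<sigma>])
qed (auto simp: ev_open[of _ \<sigma>])

lemma sat_subst [simp]:
  "wff A \<Longrightarrow> u \<^bold>: snd v \<Longrightarrow> sat e [] (A\<lbrakk>v ::= u\<rbrakk>) = sat (e(v := ev e [] u)) [] A"
  using sat_open[of "[]" "snd v" "close_fm v 0 A" u "[]" e] wf_close[of "[]" A v]
    sat_close[of "[]" A "[]" e "ev e [] u" v] by (simp add: subst_def)

lemma ev_lift: "tyof \<Delta> t = Some \<tau> \<Longrightarrow> ev e (d # ds) (lift_trm t) = ev e ds t"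
proof (induction t arbitrary: \<tau> rule: fv_trm.induct)
  case (2 s t)
  then show ?case by (auto simp: tyof_App_iff simp del: tyof.simps(3))
qed auto

lemmas ev_monus_c [simp] = ev_val[OF monus_c_type]
lemmas ev_pred_c [simp] = ev_val[OF pred_c_type]
lemmas ev_ifz_c [simp] = ev_val[OF ifz_c_type]
lemmas ev_ext0_c [simp] = ev_val[OF ext0_c_type]
lemmas ev_assoc_c [simp] = ev_val[OF assoc_c_type]

lemma sat_Less [simp]: "sat e ds (s \<^bold>< t) \<longleftrightarrow> lt (ev e ds s) (ev e ds t)"
  by (simp add: Less_def Leq_def lt_def)

end

context model
begin

lemma con_types [simp]:
  "con Zero \<in> D N" "con Succ \<in> D T1" "con Rec \<in> D (N \<^bold>\<rightarrow> N \<^bold>\<rightarrow> (N \<^bold>\<rightarrow> N \<^bold>\<rightarrow> N) \<^bold>\<rightarrow> N)"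
  "con (Kc \<sigma> \<tau>) \<in> D (\<sigma> \<^bold>\<rightarrow> \<tau> \<^bold>\<rightarrow> \<sigma>)"
  "con (Sc \<rho> \<sigma> \<tau>) \<in> D ((\<rho> \<^bold>\<rightarrow> \<sigma> \<^bold>\<rightarrow> \<tau>) \<^bold>\<rightarrow> (\<rho> \<^bold>\<rightarrow> \<sigma>) \<^bold>\<rightarrow> \<rho> \<^bold>\<rightarrow> \<tau>)"
  "con (Len \<sigma>) \<in> D (Star \<sigma> \<^bold>\<rightarrow> N)" "con (Prj \<sigma>) \<in> D (Star \<sigma> \<^bold>\<rightarrow> N \<^bold>\<rightarrow> \<sigma>)"
  "con (Mk \<sigma>) \<in> D (N \<^bold>\<rightarrow> (N \<^bold>\<rightarrow> \<sigma>) \<^bold>\<rightarrow> Star \<sigma>)"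
  "con Lambda1 \<in> D (T2 \<^bold>\<rightarrow> T1 \<^bold>\<rightarrow> N)"
  by (rule con_D; simp)+

lemma ev_D: "tyof [] t = Some \<tau> \<Longrightarrow> env e \<Longrightarrow> ev e [] t \<in> D \<tau>"
proof (induction t arbitrary: \<tau> rule: fv_trm.induct)
  case (1 v)
  then show ?case using envD[of e v] by simp
next
  case (2 s t)
  then show ?case by (auto simp: tyof_App_iff simp del: tyof.simps(3) intro: app_D)
qed (auto intro: con_D)

definition e0 :: "var \<Rightarrow> 'd" where
  "e0 v = (SOME d. d \<in> D (snd v))"

lemma env_e0 [simp]: "env e0"
  unfolding env_def e0_def using D_nonempty by (simp add: some_in_eq)

lemma env_update [simp]: "env e \<Longrightarrow> d \<in> D (snd v) \<Longrightarrow> env (e(v := d))"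
  by (rule env_upd)

lemma val_D: "t \<^bold>: \<tau> \<Longrightarrow> fv_trm t = {} \<Longrightarrow> val t \<in> D \<tau>"
  using ev_val[of t \<tau> e0 "[]"] ev_D[of t \<tau> e0] by simp

text \<open>By induction on the type, since models are extensional.\<close>

lemma sat_eqf:
  "tyof \<Delta> s = Some \<tau> \<Longrightarrow> tyof \<Delta> t = Some \<tau> \<Longrightarrow> ev e ds s \<in> D \<tau> \<Longrightarrow> ev e ds t \<in> D \<tau> \<Longrightarrow>
    sat e ds (eqf \<tau> s t) \<longleftrightarrow> ev e ds s = ev e ds t"
proof (induction \<tau> arbitrary: \<Delta> s t ds)
  case (Fun \<sigma> \<tau>)
  have "sat e ds (eqf (\<sigma> \<^bold>\<rightarrow> \<tau>) s t) \<longleftrightarrow> (\<forall>d\<in>D \<sigma>. ev e ds s \<bullet> d = ev e ds t \<bullet> d)"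
    using Fun.prems app_D Fun.IH(2)[of "\<sigma> # \<Delta>" "lift_trm s \<cdot> Bnd 0" "lift_trm t \<cdot> Bnd 0" "_ # ds"]
    by (simp add: tyof_lift ev_lift)
  then show ?case
    using Fun.prems ext_fun[of "ev e ds s" \<sigma> \<tau> "ev e ds t"] by auto
next
  case (Star \<sigma>)
  have P: "con (Prj \<sigma>) \<bullet> x \<bullet> d \<in> D \<sigma>" if "x \<in> D (Star \<sigma>)" "d \<in> D N" for x d
    using that con_types(7)[of \<sigma>] app_D by blast
  have "sat e ds (eqf (Star \<sigma>) s t) \<longleftrightarrow> con (Len \<sigma>) \<bullet> ev e ds s = con (Len \<sigma>) \<bullet> ev e ds t \<and>
     (\<forall>d\<in>D N. lt d (con (Len \<sigma>) \<bullet> ev e ds s) \<longrightarrow>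
        con (Prj \<sigma>) \<bullet> ev e ds s \<bullet> d = con (Prj \<sigma>) \<bullet> ev e ds t \<bullet> d)"
    using Star.prems P Star.IH[of "N # \<Delta>" "Prj \<sigma> \<cdot> lift_trm s \<cdot> Bnd 0" "Prj \<sigma> \<cdot> lift_trm t \<cdot> Bnd 0" "_ # ds"]
    by (simp add: tyof_lift ev_lift)
  then show ?case
    using Star.prems ext_seq[of "ev e ds s" \<sigma> "ev e ds t"] by auto
qed simp

end


section \<open>Combinatory completeness and arithmetic in models\<close>

definition add_c :: trm where
  "add_c = (\<^bold>\<lambda>vm. \<^bold>\<lambda>vn. Rec \<cdot> V vn \<cdot> V vm \<cdot> (\<^bold>\<lambda>vr. \<^bold>\<lambda>vi. Succ \<cdot> V vr))"

text \<open>Zero exactly on equal arguments.\<close>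

definition eqt_c :: trm where
  "eqt_c = (\<^bold>\<lambda>vm. \<^bold>\<lambda>vn. ifz_c \<cdot> (monus_c \<cdot> V vm \<cdot> V vn) \<cdot> (monus_c \<cdot> V vn \<cdot> V vm) \<cdot> One)"

text \<open>The sum of the first \<open>n\<close> entries; all that matters is that it bounds each of them.\<close>

definition sum_c :: trm where
  "sum_c = (\<^bold>\<lambda>vsig. \<^bold>\<lambda>vn. Rec \<cdot> V vn \<cdot> Zero \<cdot>
     (\<^bold>\<lambda>vr. \<^bold>\<lambda>vi. add_c \<cdot> V vr \<cdot> (Prj N \<cdot> V vsig \<cdot> V vi)))"

text \<open>Among the first \<open>n\<close> entries, the last one at which \<open>f\<close> vanishes.\<close>

definition search_c :: trm where
  "search_c = (\<^bold>\<lambda>vf. \<^bold>\<lambda>vsig. \<^bold>\<lambda>vn. Rec \<cdot> V vn \<cdot> Zero \<cdot>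
     (\<^bold>\<lambda>vr. \<^bold>\<lambda>vi. ifz_c \<cdot> (V vf \<cdot> (Prj N \<cdot> V vsig \<cdot> V vi)) \<cdot> (Prj N \<cdot> V vsig \<cdot> V vi) \<cdot> V vr))"

lemma add_c_type [simp]: "add_c \<^bold>: N \<^bold>\<rightarrow> N \<^bold>\<rightarrow> N" "fv_trm add_c = {}"
  by (auto simp: add_c_def)

lemma eqt_c_type [simp]: "eqt_c \<^bold>: N \<^bold>\<rightarrow> N \<^bold>\<rightarrow> N" "fv_trm eqt_c = {}"
  by (auto simp: eqt_c_def)

lemma sum_c_type [simp]: "sum_c \<^bold>: Star N \<^bold>\<rightarrow> N \<^bold>\<rightarrow> N" "fv_trm sum_c = {}"
  by (auto simp: sum_c_def)

lemma search_c_type [simp]: "search_c \<^bold>: T1 \<^bold>\<rightarrow> Star N \<^bold>\<rightarrow> N \<^bold>\<rightarrow> N" "fv_trm search_c = {}"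
  by (auto simp: search_c_def)

locale arith_model = model D app con std T
  for D :: "ty \<Rightarrow> 'd set" and app (infixl "\<bullet>" 90) and con std T +
  assumes EPRA: "EPRA \<subseteq> T"
begin

lemmas ev_add_c [simp] = ev_val[OF add_c_type]
lemmas ev_eqt_c [simp] = ev_val[OF eqt_c_type]
lemmas ev_sum_c [simp] = ev_val[OF sum_c_type]
lemmas ev_search_c [simp] = ev_val[OF search_c_type]

lemma sat_EPRA: "A \<in> EPRA \<Longrightarrow> wff A \<Longrightarrow> env e \<Longrightarrow> sat e [] A"
  using sat_ax EPRA by blast

lemma K_app [simp]: assumes "x \<in> D \<sigma>" "y \<in> D \<tau>" shows "con (Kc \<sigma> \<tau>) \<bullet> x \<bullet> y = x"
proof -
  let ?a = "V (''a'', \<sigma>)" and ?b = "V (''b'', \<tau>)"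
  let ?e = "e0((''a'', \<sigma>) := x, (''b'', \<tau>) := y)"
  have "con (Kc \<sigma> \<tau>) \<bullet> x \<bullet> y \<in> D \<sigma>"
    using assms con_types(4) app_D by blast
  moreover have "sat ?e [] (eqf \<sigma> (Kc \<sigma> \<tau> \<cdot> ?a \<cdot> ?b) ?a)"
    using assms by (intro sat_EPRA EPRA.K_def wf_eqf) auto
  ultimately show ?thesis
    using sat_eqf[of "[]" "Kc \<sigma> \<tau> \<cdot> ?a \<cdot> ?b" \<sigma> ?a ?e "[]"] assms by simp
qed

lemma S_app [simp]:
  assumes "x \<in> D (\<rho> \<^bold>\<rightarrow> \<sigma> \<^bold>\<rightarrow> \<tau>)" "y \<in> D (\<rho> \<^bold>\<rightarrow> \<sigma>)" "z \<in> D \<rho>"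
  shows "con (Sc \<rho> \<sigma> \<tau>) \<bullet> x \<bullet> y \<bullet> z = x \<bullet> z \<bullet> (y \<bullet> z)"
proof -
  let ?a = "V (''a'', \<rho> \<^bold>\<rightarrow> \<sigma> \<^bold>\<rightarrow> \<tau>)" and ?b = "V (''b'', \<rho> \<^bold>\<rightarrow> \<sigma>)" and ?c = "V (''c'', \<rho>)"
  let ?e = "e0((''a'', \<rho> \<^bold>\<rightarrow> \<sigma> \<^bold>\<rightarrow> \<tau>) := x, (''b'', \<rho> \<^bold>\<rightarrow> \<sigma>) := y, (''c'', \<rho>) := z)"
  have "con (Sc \<rho> \<sigma> \<tau>) \<bullet> x \<bullet> y \<bullet> z \<in> D \<tau>" "x \<bullet> z \<bullet> (y \<bullet> z) \<in> D \<tau>"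
    using assms con_types(5)[of \<rho> \<sigma> \<tau>] app_D by blast+
  moreover have "sat ?e [] (eqf \<tau> (Sc \<rho> \<sigma> \<tau> \<cdot> ?a \<cdot> ?b \<cdot> ?c) (?a \<cdot> ?c \<cdot> (?b \<cdot> ?c)))"
    using assms by (intro sat_EPRA EPRA.S_def wf_eqf) auto
  ultimately show ?thesis
    using sat_eqf[of "[]" "Sc \<rho> \<sigma> \<tau> \<cdot> ?a \<cdot> ?b \<cdot> ?c" \<tau> "?a \<cdot> ?c \<cdot> (?b \<cdot> ?c)" ?e "[]"] assms by simp
qed

lemma ev_const_trm: "t \<^bold>: \<tau> \<Longrightarrow> env e \<Longrightarrow> d \<in> D \<sigma> \<Longrightarrow> ev e [] (const_trm \<sigma> t) \<bullet> d = ev e [] t"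
  using ev_D[of t \<tau> e] by (simp add: const_trm_def)

lemma ev_fresh: "t \<^bold>: \<tau> \<Longrightarrow> v \<notin> fv_trm t \<Longrightarrow> ev (e(v := d)) [] t = ev e [] t"
  using ev_closed[of "[]" "[]" t \<tau> "e(v := d)" e "[]" "[]"] by (metis append_Nil fun_upd_apply list.size(3))

text \<open>
  By the equations for the combinators, every term with a free variable defines a functional.
\<close>

lemma ev_lam':
  "t \<^bold>: \<tau> \<Longrightarrow> env e \<Longrightarrow> d \<in> D (snd v) \<Longrightarrow> ev e [] (\<^bold>\<lambda>v. t) \<bullet> d = ev (e(v := d)) [] t"
proof (induction v t arbitrary: \<tau> rule: lam.induct)
  case (1 v s t)
  then obtain \<sigma> where \<sigma>: "s \<^bold>: \<sigma> \<^bold>\<rightarrow> \<tau>" "t \<^bold>: \<sigma>"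
    by (auto simp: tyof_App_iff simp del: tyof.simps(3))
  show ?case
  proof (cases "v \<in> fv_trm (s \<cdot> t)")
    case True
    have "ev e [] (\<^bold>\<lambda>v. s) \<in> D (snd v \<^bold>\<rightarrow> \<sigma> \<^bold>\<rightarrow> \<tau>)" "ev e [] (\<^bold>\<lambda>v. t) \<in> D (snd v \<^bold>\<rightarrow> \<sigma>)"
      using \<sigma> 1 by (auto intro!: ev_D)
    then show ?thesis
      using True \<sigma> 1 by (simp add: lam.simps(1))
  next
    case False
    then show ?thesis
      using 1 ev_const_trm[OF 1(3)] ev_fresh[OF 1(3)] by (simp add: lam.simps(1) del: ev.simps fun_upd_apply)
  qed
next
  case (2 v w)
  then show ?case
    using ev_const_trm[OF 2(1)] ev_fresh[OF 2(1)] app_D[OF con_types(4)[of "snd v" "snd v"]]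
    by (auto simp: lam.simps)
qed (use ev_const_trm ev_fresh in \<open>auto simp: lam.simps\<close>)

lemma ev_lam [simp]:
  "tyof [] t \<noteq> None \<Longrightarrow> env e \<Longrightarrow> d \<in> D (snd v) \<Longrightarrow> ev e [] (\<^bold>\<lambda>v. t) \<bullet> d = ev (e(v := d)) [] t"
  using ev_lam' by blast

abbreviation Z where "Z \<equiv> con Zero"
abbreviation S where "S x \<equiv> con Succ \<bullet> x"
abbreviation monus (infixl "\<ominus>" 65) where "x \<ominus> y \<equiv> val monus_c \<bullet> x \<bullet> y"
abbreviation plus' (infixl "\<oplus>" 65) where "x \<oplus> y \<equiv> val add_c \<bullet> x \<bullet> y"
abbreviation prd where "prd x \<equiv> val pred_c \<bullet> x"
abbreviation ifz where "ifz x y z \<equiv> val ifz_c \<bullet> x \<bullet> y \<bullet> z"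

lemma S_D [simp]: "x \<in> D N \<Longrightarrow> S x \<in> D N"
  using con_types(2) app_D by blast

lemma monus_D [simp]: "x \<in> D N \<Longrightarrow> y \<in> D N \<Longrightarrow> x \<ominus> y \<in> D N"
  using val_D[OF monus_c_type] app_D by blast

lemma plus_D [simp]: "x \<in> D N \<Longrightarrow> y \<in> D N \<Longrightarrow> x \<oplus> y \<in> D N"
  using val_D[OF add_c_type] app_D by blast

lemma prd_D [simp]: "x \<in> D N \<Longrightarrow> prd x \<in> D N"
  using val_D[OF pred_c_type] app_D by blast

lemma Rec_D [simp]:
  "x \<in> D N \<Longrightarrow> y \<in> D N \<Longrightarrow> z \<in> D (N \<^bold>\<rightarrow> N \<^bold>\<rightarrow> N) \<Longrightarrow> con Rec \<bullet> x \<bullet> y \<bullet> z \<in> D N"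
  using con_types(3) app_D by blast

lemma Rec_Z [simp]:
  "x \<in> D N \<Longrightarrow> y \<in> D (N \<^bold>\<rightarrow> N \<^bold>\<rightarrow> N) \<Longrightarrow> con Rec \<bullet> Z \<bullet> x \<bullet> y = x"
  using sat_EPRA[OF EPRA.Rec_zero[of "V (''a'', N)" "V (''b'', N \<^bold>\<rightarrow> N \<^bold>\<rightarrow> N)"],
      of "e0((''a'', N) := x, (''b'', N \<^bold>\<rightarrow> N \<^bold>\<rightarrow> N) := y)"] by simp

lemma Rec_S [simp]:
  "u \<in> D N \<Longrightarrow> x \<in> D N \<Longrightarrow> y \<in> D (N \<^bold>\<rightarrow> N \<^bold>\<rightarrow> N) \<Longrightarrow>
    con Rec \<bullet> S u \<bullet> x \<bullet> y = y \<bullet> (con Rec \<bullet> u \<bullet> x \<bullet> y) \<bullet> u"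
  using sat_EPRA[OF EPRA.Rec_succ[of "V (''u'', N)" "V (''a'', N)" "V (''b'', N \<^bold>\<rightarrow> N \<^bold>\<rightarrow> N)"],
      of "e0((''u'', N) := u, (''a'', N) := x, (''b'', N \<^bold>\<rightarrow> N \<^bold>\<rightarrow> N) := y)"] by simp

lemma S_inj [simp]: "x \<in> D N \<Longrightarrow> y \<in> D N \<Longrightarrow> S x = S y \<longleftrightarrow> x = y"
  using sat_EPRA[OF EPRA.succ_inj[of "V (''a'', N)" "V (''b'', N)"],
      of "e0((''a'', N) := x, (''b'', N) := y)"] by auto

lemma S_not_Z [simp]: "x \<in> D N \<Longrightarrow> S x \<noteq> Z"
  using sat_EPRA[OF EPRA.succ_zero[of "V (''a'', N)"], of "e0((''a'', N) := x)"] by auto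

text \<open>
  Induction is available for quantifier-free formulas only: in the proofs of the laws of the order,
  all variables but one have to stay fixed.
\<close>

lemma induct_qf:
  assumes "wff A" "qfree A" "snd n = N" "env e"
    and "sat (e(n := Z)) [] A"
    and "\<And>x. x \<in> D N \<Longrightarrow> sat (e(n := x)) [] A \<Longrightarrow> sat (e(n := S x)) [] A"
    and "x \<in> D N"
  shows "sat (e(n := x)) [] A"
proof -
  have "sat e [] (A\<lbrakk>n ::= Zero\<rbrakk> \<^bold>\<longrightarrow> (\<^bold>\<forall>n. A \<^bold>\<longrightarrow> A\<lbrakk>n ::= Succ \<cdot> V n\<rbrakk>) \<^bold>\<longrightarrow> (\<^bold>\<forall>n. A))"
    using assms(1-4) by (intro sat_EPRA EPRA.qf_induct) auto
  then show ?thesis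
    using assms by (simp del: fun_upd_apply add: fun_upd_same)
qed

lemma prd_Z [simp]: "prd Z = Z" and prd_S [simp]: "x \<in> D N \<Longrightarrow> prd (S x) = x"
proof -
  have *: "prd y = con Rec \<bullet> y \<bullet> Z \<bullet> ev (e0(vn := y)) [] (\<^bold>\<lambda>vr. \<^bold>\<lambda>vi. V vi)" if "y \<in> D N" for y
    using that by (subst ev_val[OF pred_c_type, symmetric, of e0 "[]"]) (simp add: pred_c_def)
  have F: "ev (e0(vn := y)) [] (\<^bold>\<lambda>vr. \<^bold>\<lambda>vi. V vi) \<in> D (N \<^bold>\<rightarrow> N \<^bold>\<rightarrow> N)" if "y \<in> D N" for y
    using that by (intro ev_D) auto
  show "prd Z = Z"
    using F by (simp add: *)
  show "prd (S x) = x" if "x \<in> D N"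
    using F that by (simp add: *)
qed

lemma monus_Z [simp]: "x \<in> D N \<Longrightarrow> x \<ominus> Z = x"
  and monus_S: "x \<in> D N \<Longrightarrow> y \<in> D N \<Longrightarrow> x \<ominus> S y = prd (x \<ominus> y)"
proof -
  let ?F = "\<lambda>x y. ev (e0(vm := x, vn := y)) [] (\<^bold>\<lambda>vr. \<^bold>\<lambda>vi. pred_c \<cdot> V vr)"
  have *: "x \<ominus> y = con Rec \<bullet> y \<bullet> x \<bullet> ?F x y" if "x \<in> D N" "y \<in> D N" for x y
    using that by (subst ev_val[OF monus_c_type, symmetric, of e0 "[]"]) (simp add: monus_c_def)
  have F: "?F x y \<in> D (N \<^bold>\<rightarrow> N \<^bold>\<rightarrow> N)" if "x \<in> D N" "y \<in> D N" for x y
    using that by (intro ev_D) auto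
  have eq: "?F x (S y) = ?F x y" if "x \<in> D N" "y \<in> D N" for x y
    using ev_fresh[of "\<^bold>\<lambda>vr. \<^bold>\<lambda>vi. pred_c \<cdot> V vr" _ vn] by simp
  show "x \<ominus> Z = x" if "x \<in> D N" for x
    using F that by (simp add: *)
  show "x \<ominus> S y = prd (x \<ominus> y)" if "x \<in> D N" "y \<in> D N" for x y
    using F that by (simp add: * eq)
qed

lemma ifz_Z [simp]: "y \<in> D N \<Longrightarrow> z \<in> D N \<Longrightarrow> ifz Z y z = y"
  and ifz_S: "x \<in> D N \<Longrightarrow> y \<in> D N \<Longrightarrow> z \<in> D N \<Longrightarrow> ifz (S x) y z = z"
proof -
  let ?F = "\<lambda>x y z. ev (e0(vx := x, vm := y, vn := z)) [] (\<^bold>\<lambda>vr. \<^bold>\<lambda>vi. V vn)"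
  have *: "ifz x y z = con Rec \<bullet> x \<bullet> y \<bullet> ?F x y z" if "x \<in> D N" "y \<in> D N" "z \<in> D N" for x y z
    using that by (subst ev_val[OF ifz_c_type, symmetric, of e0 "[]"]) (simp add: ifz_c_def)
  have F: "?F x y z \<in> D (N \<^bold>\<rightarrow> N \<^bold>\<rightarrow> N)" if "x \<in> D N" "y \<in> D N" "z \<in> D N" for x y z
    using that by (intro ev_D) auto
  show "ifz Z y z = y" if "y \<in> D N" "z \<in> D N" for y z
    using F that by (simp add: *)
  show "ifz (S x) y z = z" if "x \<in> D N" "y \<in> D N" "z \<in> D N" for x y z
    using F that by (simp add: *)
qed

lemma plus_Z [simp]: "x \<in> D N \<Longrightarrow> x \<oplus> Z = x"
  and plus_S [simp]: "x \<in> D N \<Longrightarrow> y \<in> D N \<Longrightarrow> x \<oplus> S y = S (x \<oplus> y)"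
proof -
  let ?F = "\<lambda>x y. ev (e0(vm := x, vn := y)) [] (\<^bold>\<lambda>vr. \<^bold>\<lambda>vi. Succ \<cdot> V vr)"
  have *: "x \<oplus> y = con Rec \<bullet> y \<bullet> x \<bullet> ?F x y" if "x \<in> D N" "y \<in> D N" for x y
    using that by (subst ev_val[OF add_c_type, symmetric, of e0 "[]"]) (simp add: add_c_def)
  have F: "?F x y \<in> D (N \<^bold>\<rightarrow> N \<^bold>\<rightarrow> N)" if "x \<in> D N" "y \<in> D N" for x y
    using that by (intro ev_D) auto
  have eq: "?F x (S y) = ?F x y" if "x \<in> D N" "y \<in> D N" for x y
    using that ev_fresh[of "\<^bold>\<lambda>vr. \<^bold>\<lambda>vi. Succ \<cdot> V vr" _ vn] by simp
  show "x \<oplus> Z = x" if "x \<in> D N" for x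
    using F that by (simp add: *)
  show "x \<oplus> S y = S (x \<oplus> y)" if "x \<in> D N" "y \<in> D N" for x y
    using F that by (simp add: * eq)
qed

lemma induct_eq:
  assumes "s \<^bold>: N" "t \<^bold>: N" "env e" "ev (e(vn := Z)) [] s = ev (e(vn := Z)) [] t"
    and "\<And>x. x \<in> D N \<Longrightarrow> ev (e(vn := x)) [] s = ev (e(vn := x)) [] t \<Longrightarrow>
      ev (e(vn := S x)) [] s = ev (e(vn := S x)) [] t"
    and "x \<in> D N"
  shows "ev (e(vn := x)) [] s = ev (e(vn := x)) [] t"
  using induct_qf[of "s \<^bold>= t" vn e x] assms by simp

lemma Z_or_S: "x \<in> D N \<Longrightarrow> x = Z \<or> x = S (prd x)"
  using induct_qf[of "(\<^bold>\<not> (V vn \<^bold>= Zero)) \<^bold>\<longrightarrow> V vn \<^bold>= Succ \<cdot> (pred_c \<cdot> V vn)" vn e0 x]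
  by (auto simp: Neg_def)

lemma ifz_cases: "x \<in> D N \<Longrightarrow> y \<in> D N \<Longrightarrow> z \<in> D N \<Longrightarrow> ifz x y z = (if x = Z then y else z)"
  using Z_or_S[of x] ifz_S[of "prd x" y z] by auto

lemma monus_SS [simp]: "x \<in> D N \<Longrightarrow> y \<in> D N \<Longrightarrow> S x \<ominus> S y = x \<ominus> y"
  using induct_eq[of "monus_c \<cdot> (Succ \<cdot> V vm) \<cdot> (Succ \<cdot> V vn)" "monus_c \<cdot> V vm \<cdot> V vn" "e0(vm := x)" y]
  by (simp add: monus_S)

lemma Z_monus [simp]: "y \<in> D N \<Longrightarrow> Z \<ominus> y = Z"
  using induct_eq[of "monus_c \<cdot> Zero \<cdot> V vn" Zero e0 y] by (simp add: monus_S)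

lemma monus_self [simp]: "y \<in> D N \<Longrightarrow> y \<ominus> y = Z"
  using induct_eq[of "monus_c \<cdot> V vn \<cdot> V vn" Zero e0 y] by simp

lemma S_monus_self [simp]: "y \<in> D N \<Longrightarrow> S y \<ominus> y = S Z"
  using induct_eq[of "monus_c \<cdot> (Succ \<cdot> V vn) \<cdot> V vn" One e0 y] by simp

lemma Z_plus [simp]: "y \<in> D N \<Longrightarrow> Z \<oplus> y = y"
  using induct_eq[of "add_c \<cdot> Zero \<cdot> V vn" "V vn" e0 y] by simp

lemma S_plus [simp]: "x \<in> D N \<Longrightarrow> y \<in> D N \<Longrightarrow> S x \<oplus> y = S (x \<oplus> y)"
  using induct_eq[of "add_c \<cdot> (Succ \<cdot> V vm) \<cdot> V vn" "Succ \<cdot> (add_c \<cdot> V vm \<cdot> V vn)" "e0(vm := x)" y]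
  by simp

definition le where "le x y \<longleftrightarrow> x \<ominus> y = Z"

lemma lt_le: "lt x y \<longleftrightarrow> le (S x) y"
  by (simp add: lt_def le_def)

text \<open>
  The identity \<open>x = y \<oplus> (x \<ominus> y)\<close> for \<open>x \<ominus> y \<noteq> Z\<close> is proved by induction on \<open>y\<close>. If \<open>x \<ominus> S y\<close>
  vanishes, then \<open>x \<ominus> y\<close> is zero or one, and the identity gives \<open>x = S y\<close> in the second case.
  Transitivity and antisymmetry of the order rest on this lemma.
\<close>

lemma le_S:
  assumes "x \<in> D N" "y \<in> D N"
  shows "le x (S y) \<longleftrightarrow> le x y \<or> x = S y"
proof -
  let ?A = "(\<^bold>\<not> (monus_c \<cdot> V vm \<cdot> V vn \<^bold>= Zero)) \<^bold>\<longrightarrow>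
      V vm \<^bold>= add_c \<cdot> V vn \<cdot> (monus_c \<cdot> V vm \<cdot> V vn)"
  have "sat (e0(vm := x, vn := y)) [] ?A"
  proof (rule induct_qf)
    fix n
    assume n: "n \<in> D N" "sat (e0(vm := x, vn := n)) [] ?A"
    then show "sat (e0(vm := x, vn := S n)) [] ?A"
      using assms Z_or_S[of "x \<ominus> n"] by (auto simp: monus_S) (metis plus_S prd_D monus_D)+
  qed (use assms in \<open>auto simp: Neg_def\<close>)
  then have *: "x \<ominus> y = Z \<or> x = y \<oplus> (x \<ominus> y)"
    by auto
  show ?thesis
  proof
    assume "le x (S y)"
    then have "prd (x \<ominus> y) = Z"
      using assms by (simp add: le_def monus_S)
    then have "x \<ominus> y = Z \<or> x \<ominus> y = S Z"
      using Z_or_S[of "x \<ominus> y"] assms by auto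
    then show "le x y \<or> x = S y"
      using * assms by (auto simp: le_def)
  next
    assume "le x y \<or> x = S y"
    then show "le x (S y)"
      using assms by (auto simp: le_def monus_S)
  qed
qed

lemma le_refl [simp]: "x \<in> D N \<Longrightarrow> le x x"
  by (simp add: le_def)

lemma le_Z: "x \<in> D N \<Longrightarrow> le x Z \<longleftrightarrow> x = Z"
  by (simp add: le_def)

lemma le_trans:
  assumes "x \<in> D N" "y \<in> D N" "z \<in> D N" "le x y" "le y z"
  shows "le x z"
proof -
  let ?A = "(monus_c \<cdot> V vm \<cdot> V vn \<^bold>= Zero) \<^bold>\<longrightarrow> (monus_c \<cdot> V vx \<cdot> V vn \<^bold>= Zero)"
  have "sat (e0(vx := x, vm := y, vn := z)) [] ?A"
  proof (rule induct_qf)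
    show "sat (e0(vx := x, vm := y, vn := Z)) [] ?A"
      using assms by (auto simp: le_def)
    fix n
    assume n: "n \<in> D N" "sat (e0(vx := x, vm := y, vn := n)) [] ?A"
    then have "le y n \<longrightarrow> le x n"
      by (simp add: le_def)
    then have "le y (S n) \<longrightarrow> le x (S n)"
      using n assms by (auto simp: le_S)
    then show "sat (e0(vx := x, vm := y, vn := S n)) [] ?A"
      by (simp add: le_def)
  qed (use assms in auto)
  then show ?thesis
    using assms by (simp add: le_def)
qed

lemma lt_S: "x \<in> D N \<Longrightarrow> y \<in> D N \<Longrightarrow> lt x (S y) \<longleftrightarrow> lt x y \<or> x = y"
  using le_S[of "S x" y] by (simp add: lt_le)

lemma not_lt_Z [simp]: "x \<in> D N \<Longrightarrow> \<not> lt x Z"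
  by (simp add: lt_def)

lemma lt_le_trans: "x \<in> D N \<Longrightarrow> y \<in> D N \<Longrightarrow> z \<in> D N \<Longrightarrow> lt x y \<Longrightarrow> le y z \<Longrightarrow> lt x z"
  using le_trans[of "S x" y z] by (simp add: lt_le)

lemma le_antisym:
  assumes "x \<in> D N" "y \<in> D N" "le x y" "le y x"
  shows "x = y"
proof (cases "y = Z")
  case False
  define z where "z = prd y"
  have z: "y = S z" "z \<in> D N"
    using Z_or_S[of y] False assms by (auto simp: z_def)
  show ?thesis
  proof (rule ccontr)
    assume "x \<noteq> y"
    then have "le x z"
      using assms z by (simp add: le_S)
    then have "le (S z) z"
      using assms z le_trans[of "S z" x z] by simp
    then show False
      using z by (simp add: le_def)
  qed
qed (use assms in \<open>simp add: le_Z\<close>)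

lemma eqt_Z_iff [simp]:
  assumes "x \<in> D N" "y \<in> D N"
  shows "val eqt_c \<bullet> x \<bullet> y = Z \<longleftrightarrow> x = y"
proof -
  have "val eqt_c \<bullet> x \<bullet> y = ifz (x \<ominus> y) (y \<ominus> x) (S Z)"
    using assms by (subst ev_val[OF eqt_c_type, symmetric, of e0 "[]"]) (simp add: eqt_c_def)
  then show ?thesis
    using assms le_antisym[of x y] by (auto simp: ifz_cases le_def)
qed

lemma le_plus1: "x \<in> D N \<Longrightarrow> y \<in> D N \<Longrightarrow> le x (x \<oplus> y)"
  using induct_eq[of "monus_c \<cdot> V vm \<cdot> (add_c \<cdot> V vm \<cdot> V vn)" Zero "e0(vm := x)" y]
  by (simp add: le_def monus_S)

lemma le_plus2: "x \<in> D N \<Longrightarrow> y \<in> D N \<Longrightarrow> le y (x \<oplus> y)"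
  using induct_eq[of "monus_c \<cdot> V vn \<cdot> (add_c \<cdot> V vm \<cdot> V vn)" Zero "e0(vm := x)" y]
  by (simp add: le_def)

subsection \<open>Finite sequences\<close>

abbreviation len where "len \<equiv> \<lambda>\<sigma> x. con (Len \<sigma>) \<bullet> x"
abbreviation entry where "entry \<equiv> \<lambda>\<sigma> x i. con (Prj \<sigma>) \<bullet> x \<bullet> i"

lemma len_D [simp]: "x \<in> D (Star \<sigma>) \<Longrightarrow> len \<sigma> x \<in> D N"
  using con_types(6) app_D by blast

lemma entry_D [simp]: "x \<in> D (Star \<sigma>) \<Longrightarrow> i \<in> D N \<Longrightarrow> entry \<sigma> x i \<in> D \<sigma>"
  using con_types(7)[of \<sigma>] app_D by blast

lemma Mk_D [simp]: "n \<in> D N \<Longrightarrow> f \<in> D (N \<^bold>\<rightarrow> \<sigma>) \<Longrightarrow> con (Mk \<sigma>) \<bullet> n \<bullet> f \<in> D (Star \<sigma>)"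
  using con_types(8)[of \<sigma>] app_D by blast

lemma len_Mk [simp]: "n \<in> D N \<Longrightarrow> f \<in> D (N \<^bold>\<rightarrow> \<sigma>) \<Longrightarrow> len \<sigma> (con (Mk \<sigma>) \<bullet> n \<bullet> f) = n"
  using sat_EPRA[OF EPRA.Len_Mk[of "V (''n'', N)" "V (''f'', N \<^bold>\<rightarrow> \<sigma>)" \<sigma>],
      of "e0((''n'', N) := n, (''f'', N \<^bold>\<rightarrow> \<sigma>) := f)"] by simp

lemma entry_Mk [simp]:
  assumes "n \<in> D N" "f \<in> D (N \<^bold>\<rightarrow> \<sigma>)" "i \<in> D N" "lt i n"
  shows "entry \<sigma> (con (Mk \<sigma>) \<bullet> n \<bullet> f) i = f \<bullet> i"
proof -
  let ?n = "V (''n'', N)" and ?f = "V (''f'', N \<^bold>\<rightarrow> \<sigma>)" and ?i = "V (''i'', N)"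
  let ?e = "e0((''n'', N) := n, (''f'', N \<^bold>\<rightarrow> \<sigma>) := f, (''i'', N) := i)"
  have "f \<bullet> i \<in> D \<sigma>"
    using assms app_D by blast
  moreover have "sat ?e [] (?i \<^bold>< ?n \<^bold>\<longrightarrow> eqf \<sigma> (Prj \<sigma> \<cdot> (Mk \<sigma> \<cdot> ?n \<cdot> ?f) \<cdot> ?i) (?f \<cdot> ?i))"
    using assms by (intro sat_EPRA EPRA.Prj_Mk) (auto intro: wf_eqf)
  ultimately show ?thesis
    using sat_eqf[of "[]" "Prj \<sigma> \<cdot> (Mk \<sigma> \<cdot> ?n \<cdot> ?f) \<cdot> ?i" \<sigma> "?f \<cdot> ?i" ?e "[]"] assms by simp
qed

definition agree where "agree f g n \<longleftrightarrow> (\<forall>i\<in>D N. lt i n \<longrightarrow> f \<bullet> i = g \<bullet> i)"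

lemma sat_eq_seg [simp]:
  assumes "f \<^bold>: T1" "g \<^bold>: T1" "n \<^bold>: N" "env e"
  shows "sat e [] (eq_seg f g n) \<longleftrightarrow> agree (ev e [] f) (ev e [] g) (ev e [] n)"
proof -
  have d: "ev e [] f \<in> D T1" "ev e [] g \<in> D T1" "ev e [] n \<in> D N"
    using assms ev_D by auto
  then have "sat e [] (eq_seg f g n) \<longleftrightarrow>
      con (Mk N) \<bullet> ev e [] n \<bullet> ev e [] f = con (Mk N) \<bullet> ev e [] n \<bullet> ev e [] g"
    using sat_eqf[of "[]" "seg f n" "Star N" "seg g n" e "[]"] assms
    by (simp add: eq_seg_def seg_def del: eqf.simps)
  also have "\<dots> \<longleftrightarrow> agree (ev e [] f) (ev e [] g) (ev e [] n)"
    using d ext_seq[of "con (Mk N) \<bullet> ev e [] n \<bullet> ev e [] f" N "con (Mk N) \<bullet> ev e [] n \<bullet> ev e [] g"]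
    unfolding agree_def by (metis Mk_D entry_Mk len_Mk)
  finally show ?thesis .
qed

lemma agree_mono:
  "agree f g n \<Longrightarrow> m \<in> D N \<Longrightarrow> n \<in> D N \<Longrightarrow> le m n \<Longrightarrow> agree f g m"
  unfolding agree_def using lt_le_trans by blast

lemma agree_refl [simp]: "agree f f n"
  by (simp add: agree_def)

lemma sum_bound:
  assumes "x \<in> D (Star N)" "i \<in> D N" "lt i n" "n \<in> D N"
  shows "le (entry N x i) (val sum_c \<bullet> x \<bullet> n)"
proof -
  let ?F = "\<lambda>x n. ev (e0(vsig := x, vn := n)) [] (\<^bold>\<lambda>vr. \<^bold>\<lambda>vi. add_c \<cdot> V vr \<cdot> (Prj N \<cdot> V vsig \<cdot> V vi))"
  let ?s = "\<lambda>n. val sum_c \<bullet> x \<bullet> n"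
  have *: "?s n = con Rec \<bullet> n \<bullet> Z \<bullet> ?F x n" if "n \<in> D N" for n
    using that assms by (subst ev_val[OF sum_c_type, symmetric, of e0 "[]"]) (simp add: sum_c_def)
  have F: "?F x n \<in> D (N \<^bold>\<rightarrow> N \<^bold>\<rightarrow> N)" if "n \<in> D N" for n
    using that assms by (intro ev_D) auto
  have eq: "?F x (S n) = ?F x n" if "n \<in> D N" for n
    using that ev_fresh[of "\<^bold>\<lambda>vr. \<^bold>\<lambda>vi. add_c \<cdot> V vr \<cdot> (Prj N \<cdot> V vsig \<cdot> V vi)" _ vn] by simp
  have sD: "?s n \<in> D N" if "n \<in> D N" for n
    using that assms val_D[OF sum_c_type] app_D by blast
  have sS: "?s (S n) = ?s n \<oplus> entry N x n" if "n \<in> D N" for n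
    using that assms F by (simp add: * eq)
  let ?A = "(V vi \<^bold>< V vn) \<^bold>\<longrightarrow> (monus_c \<cdot> (Prj N \<cdot> V vsig \<cdot> V vi) \<cdot> (sum_c \<cdot> V vsig \<cdot> V vn) \<^bold>= Zero)"
  have "sat (e0(vsig := x, vi := i, vn := n)) [] ?A"
  proof (rule induct_qf)
    show "qfree ?A"
      by (simp add: Less_def Leq_def)
    show "sat (e0(vsig := x, vi := i, vn := Z)) [] ?A"
      using assms by simp
    fix n
    assume n: "n \<in> D N" "sat (e0(vsig := x, vi := i, vn := n)) [] ?A"
    then have "lt i n \<longrightarrow> le (entry N x i) (?s n)"
      by (simp add: le_def)
    then have "lt i (S n) \<longrightarrow> le (entry N x i) (?s (S n))"
      using n assms sS sD lt_S le_plus1[of "?s n" "entry N x n"] le_plus2[of "?s n" "entry N x n"]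
        le_trans[of "entry N x i" "?s n" "?s n \<oplus> entry N x n"] by auto
    then show "sat (e0(vsig := x, vi := i, vn := S n)) [] ?A"
      by (simp add: le_def)
  qed (use assms in auto)
  then show ?thesis
    using assms by (simp add: le_def)
qed

lemma search_finds:
  assumes "f \<in> D T1" "x \<in> D (Star N)" "i \<in> D N" "lt i n" "n \<in> D N" "f \<bullet> entry N x i = Z"
  shows "f \<bullet> (val search_c \<bullet> f \<bullet> x \<bullet> n) = Z"
proof -
  let ?step = "\<^bold>\<lambda>vr. \<^bold>\<lambda>vi. ifz_c \<cdot> (V vf \<cdot> (Prj N \<cdot> V vsig \<cdot> V vi)) \<cdot> (Prj N \<cdot> V vsig \<cdot> V vi) \<cdot> V vr"
  let ?F = "\<lambda>n. ev (e0(vf := f, vsig := x, vn := n)) [] ?step"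
  let ?s = "\<lambda>n. val search_c \<bullet> f \<bullet> x \<bullet> n"
  have *: "?s n = con Rec \<bullet> n \<bullet> Z \<bullet> ?F n" if "n \<in> D N" for n
    using that assms by (subst ev_val[OF search_c_type, symmetric, of e0 "[]"]) (simp add: search_c_def)
  have F: "?F n \<in> D (N \<^bold>\<rightarrow> N \<^bold>\<rightarrow> N)" if "n \<in> D N" for n
    using that assms by (intro ev_D) auto
  have eq: "?F (S n) = ?F n" if "n \<in> D N" for n
    using that ev_fresh[of ?step _ vn] by simp
  have fD: "f \<bullet> n \<in> D N" if "n \<in> D N" for n
    using that assms app_D by blast
  have sS: "?s (S n) = (if f \<bullet> entry N x n = Z then entry N x n else ?s n)" if "n \<in> D N" for n
    using that assms F fD by (simp add: * eq ifz_cases)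
  let ?A = "(V vi \<^bold>< V vn) \<^bold>\<longrightarrow> (V vf \<cdot> (search_c \<cdot> V vf \<cdot> V vsig \<cdot> V vn) \<^bold>= Zero)"
  have "sat (e0(vf := f, vsig := x, vi := i, vn := n)) [] ?A"
  proof (rule induct_qf)
    show "qfree ?A"
      by (simp add: Less_def Leq_def)
    show "sat (e0(vf := f, vsig := x, vi := i, vn := Z)) [] ?A"
      using assms by simp
    fix n
    assume n: "n \<in> D N" "sat (e0(vf := f, vsig := x, vi := i, vn := n)) [] ?A"
    then show "sat (e0(vf := f, vsig := x, vi := i, vn := S n)) [] ?A"
      using assms sS lt_S by auto
  qed (use assms in auto)
  then show ?thesis
    using assms by simp
qed

lemma ext0_app:
  assumes "x \<in> D (Star N)" "i \<in> D N"
  shows "val ext0_c \<bullet> x \<bullet> i = (if lt i (len N x) then entry N x i else Z)"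
  using assms
  by (subst ev_val[OF ext0_c_type, symmetric, of e0 "[]"])
    (simp add: ext0_c_def ifz_cases lt_def)

lemma assoc_pos:
  assumes "p \<in> D T2" "w \<in> D T2" "x \<in> D (Star N)" "y \<in> D N"
    and "val assoc_c \<bullet> p \<bullet> w \<bullet> x = S y"
  shows "le (w \<bullet> (val ext0_c \<bullet> x)) (len N x)" "p \<bullet> (val ext0_c \<bullet> x) = y"
proof -
  have d: "val ext0_c \<bullet> x \<in> D T1"
    using assms val_D[OF ext0_c_type] app_D by blast
  then have "w \<bullet> (val ext0_c \<bullet> x) \<in> D N" "p \<bullet> (val ext0_c \<bullet> x) \<in> D N"
    using assms app_D by blast+
  moreover have "val assoc_c \<bullet> p \<bullet> w \<bullet> x =
      ifz (w \<bullet> (val ext0_c \<bullet> x) \<ominus> len N x) (S (p \<bullet> (val ext0_c \<bullet> x))) Z"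
    using assms
    by (subst ev_val[OF assoc_c_type, symmetric, of e0 "[]"]) (simp add: assoc_c_def)
  ultimately show "le (w \<bullet> (val ext0_c \<bullet> x)) (len N x)" "p \<bullet> (val ext0_c \<bullet> x) = y"
    using assms S_not_Z[of y] by (auto simp: ifz_cases le_def split: if_splits)
qed

end


section \<open>Coding triples by functionals of type two\<close>

text \<open>
  Transfer and choice concern a single variable, whereas continuity is about a functional \<open>p\<close> and two
  functions \<open>f\<close>, \<open>g\<close>. The three are coded by one functional that reads the first value of its argument
  as a tag: on \<open>0, h 0, h 1, \<dots>\<close> it returns \<open>p h\<close>, on \<open>1, n, \<dots>\<close> it returns \<open>f n\<close>, and on \<open>2, n, \<dots>\<close>
  it returns \<open>g n\<close>. The projections evaluate the code on arguments of these three forms.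
\<close>

abbreviation "vh \<equiv> (''h'', T1)"
abbreviation "vP \<equiv> (''P'', T2)"

definition proj1_c :: trm where
  "proj1_c = (\<^bold>\<lambda>vP. \<^bold>\<lambda>vh. V vP \<cdot> (\<^bold>\<lambda>vn. Rec \<cdot> V vn \<cdot> Zero \<cdot> (\<^bold>\<lambda>vr. \<^bold>\<lambda>vi. V vh \<cdot> V vi)))"

definition proj2_c :: trm where
  "proj2_c = (\<^bold>\<lambda>vP. \<^bold>\<lambda>vn. V vP \<cdot> (\<^bold>\<lambda>vi. ifz_c \<cdot> V vi \<cdot> One \<cdot> V vn))"

definition proj3_c :: trm where
  "proj3_c = (\<^bold>\<lambda>vP. \<^bold>\<lambda>vn. V vP \<cdot> (\<^bold>\<lambda>vi. ifz_c \<cdot> V vi \<cdot> (Succ \<cdot> One) \<cdot> V vn))"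

definition triple_c :: trm where
  "triple_c = (\<^bold>\<lambda>vh. ifz_c \<cdot> (V vh \<cdot> Zero)
     \<cdot> (V vphi \<cdot> (\<^bold>\<lambda>vn. V vh \<cdot> (Succ \<cdot> V vn)))
     \<cdot> (ifz_c \<cdot> (pred_c \<cdot> (V vh \<cdot> Zero)) \<cdot> (V vf \<cdot> (V vh \<cdot> One)) \<cdot> (V vg \<cdot> (V vh \<cdot> One))))"

lemma proj_c_type [simp]:
  "proj1_c \<^bold>: T2 \<^bold>\<rightarrow> T2" "fv_trm proj1_c = {}"
  "proj2_c \<^bold>: T2 \<^bold>\<rightarrow> T1" "fv_trm proj2_c = {}"
  "proj3_c \<^bold>: T2 \<^bold>\<rightarrow> T1" "fv_trm proj3_c = {}"
  by (auto simp: proj1_c_def proj2_c_def proj3_c_def)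

lemma triple_c_type: "triple_c \<^bold>: T2" "fv_trm triple_c = {vphi, vf, vg}"
  by (auto simp: triple_c_def)

context interp
begin

lemmas ev_proj_c [simp] = ev_val[OF proj_c_type(1,2)] ev_val[OF proj_c_type(3,4)]
  ev_val[OF proj_c_type(5,6)]

lemma sat_cong:
  "wf_fm \<Delta> A \<Longrightarrow> length ds = length \<Delta> \<Longrightarrow> (\<And>v. v \<in> fv A \<Longrightarrow> e v = e' v) \<Longrightarrow>
    sat e ds A = sat e' ds A"
proof (induction A arbitrary: \<Delta> ds rule: fv.induct)
  case (1 s t)
  then show ?case
    using ev_closed[of ds \<Delta> s N e e' "[]" "[]"] ev_closed[of ds \<Delta> t N e e' "[]" "[]"] by auto
next
  case (2 \<tau> t)
  then show ?case
    using ev_closed[of ds \<Delta> t \<tau> e e' "[]" "[]"] by auto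
next
  case (4 A B)
  then show ?case
    using "4.IH"(1)[of \<Delta> ds] "4.IH"(2)[of \<Delta> ds] by auto
next
  case (5 \<tau> A)
  then show ?case using "5.IH"[of "\<tau> # \<Delta>" "_ # ds"] by simp
next
  case (6 t A)
  then show ?case
    using "6.IH"[of "N # \<Delta>" "_ # ds"] ev_closed[of ds \<Delta> t N e e' "[]" "[]"] by auto
qed auto

end

context arith_model
begin

lemma proj1_app [simp]: "P \<in> D T2 \<Longrightarrow> val proj1_c \<bullet> P \<in> D T2"
  and proj2_app [simp]: "P \<in> D T2 \<Longrightarrow> val proj2_c \<bullet> P \<in> D T1"
  and proj3_app [simp]: "P \<in> D T2 \<Longrightarrow> val proj3_c \<bullet> P \<in> D T1"
  using val_D[OF proj_c_type(1,2)] val_D[OF proj_c_type(3,4)] val_D[OF proj_c_type(5,6)] app_D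
  by blast+

lemma app1 [simp]: "f \<in> D T1 \<Longrightarrow> x \<in> D N \<Longrightarrow> f \<bullet> x \<in> D N"
  and app2 [simp]: "p \<in> D T2 \<Longrightarrow> f \<in> D T1 \<Longrightarrow> p \<bullet> f \<in> D N"
  using app_D by blast+

lemma triple:
  assumes e: "env e"
  defines "P \<equiv> ev e [] triple_c"
  shows "P \<in> D T2" "val proj1_c \<bullet> P = e vphi" "val proj2_c \<bullet> P = e vf"
    "val proj3_c \<bullet> P = e vg"
proof -
  define p f g where "p = e vphi" and "f = e vf" and "g = e vg"
  have pfg: "p \<in> D T2" "f \<in> D T1" "g \<in> D T1"
    using envD[OF e] by (auto simp: p_def f_def g_def)
  show P: "P \<in> D T2"
    unfolding P_def using e triple_c_type by (intro ev_D) auto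
  let ?s = "\<lambda>h. ev (e(vh := h)) [] (\<^bold>\<lambda>vn. V vh \<cdot> (Succ \<cdot> V vn))"
  have sD: "?s h \<in> D T1" if "h \<in> D T1" for h
    using that e by (intro ev_D) auto
  have app: "P \<bullet> h = ifz (h \<bullet> Z) (p \<bullet> ?s h) (ifz (prd (h \<bullet> Z)) (f \<bullet> (h \<bullet> S Z)) (g \<bullet> (h \<bullet> S Z)))"
    if "h \<in> D T1" for h
    using that e pfg by (simp add: P_def triple_c_def p_def f_def g_def)
  have *: "P \<bullet> ev (e0(vP := P, vn := n)) [] (\<^bold>\<lambda>vi. ifz_c \<cdot> V vi \<cdot> k \<cdot> V vn) =
      ifz (prd (ev e0 [] k)) (f \<bullet> n) (g \<bullet> n)"
    if n: "n \<in> D N" and k: "k \<^bold>: N" "fv_trm k = {}" "val k \<noteq> Z" for n k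
  proof -
    let ?h = "ev (e0(vP := P, vn := n)) [] (\<^bold>\<lambda>vi. ifz_c \<cdot> V vi \<cdot> k \<cdot> V vn)"
    have kD: "val k \<in> D N"
      using k val_D by blast
    have hD: "?h \<in> D T1"
      using P n k by (intro ev_D) auto
    have "?h \<bullet> Z = val k" "?h \<bullet> S Z = n"
      using P n kD k by (simp_all add: ev_val[OF k(1,2)] ifz_cases)
    then show ?thesis
      using app[OF hD] hD sD[OF hD] kD k n pfg by (simp add: ev_val[OF k(1,2)] ifz_cases)
  qed
  have v: "val One = S Z" "val (Succ \<cdot> One) = S (S Z)"
    by (simp_all add: val_def)
  have "val proj1_c \<bullet> P = p"
  proof (rule ext_fun[OF proj1_app[OF P] pfg(1)])
    fix h assume h: "h \<in> D T1"
    let ?F = "\<lambda>n. ev (e0(vP := P, vh := h, vn := n)) [] (\<^bold>\<lambda>vr. \<^bold>\<lambda>vi. V vh \<cdot> V vi)"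
    let ?h = "ev (e0(vP := P, vh := h)) [] (\<^bold>\<lambda>vn. Rec \<cdot> V vn \<cdot> Zero \<cdot> (\<^bold>\<lambda>vr. \<^bold>\<lambda>vi. V vh \<cdot> V vi))"
    have F: "?F n \<in> D (N \<^bold>\<rightarrow> N \<^bold>\<rightarrow> N)" if "n \<in> D N" for n
      using that P h by (intro ev_D) auto
    have hD: "?h \<in> D T1"
      using P h by (intro ev_D) auto
    have Z: "?h \<bullet> Z = Z"
      using P h F by simp
    have S: "?h \<bullet> S n = h \<bullet> n" if "n \<in> D N" for n
      using P h F that by simp
    have "?s ?h = h"
      by (rule ext_fun[OF sD[OF hD] h]) (use S hD e in simp)
    then have "P \<bullet> ?h = p \<bullet> h"
      using app[OF hD] Z hD h pfg by simp
    moreover have "val proj1_c \<bullet> P \<bullet> h = P \<bullet> ?h"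
      using P h by (subst ev_val[OF proj_c_type(1,2), symmetric, of e0 "[]"]) (simp add: proj1_c_def)
    ultimately show "val proj1_c \<bullet> P \<bullet> h = p \<bullet> h"
      by simp
  qed
  moreover have "val proj2_c \<bullet> P = f"
  proof (rule ext_fun[OF proj2_app[OF P] pfg(2)])
    fix n assume n: "n \<in> D N"
    have "val proj2_c \<bullet> P \<bullet> n = P \<bullet> ev (e0(vP := P, vn := n)) [] (\<^bold>\<lambda>vi. ifz_c \<cdot> V vi \<cdot> One \<cdot> V vn)"
      using P n by (subst ev_val[OF proj_c_type(3,4), symmetric, of e0 "[]"]) (simp add: proj2_c_def)
    then show "val proj2_c \<bullet> P \<bullet> n = f \<bullet> n"
      using *[of n One] n pfg v by simp
  qed
  moreover have "val proj3_c \<bullet> P = g"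
  proof (rule ext_fun[OF proj3_app[OF P] pfg(3)])
    fix n assume n: "n \<in> D N"
    have "val proj3_c \<bullet> P \<bullet> n = P \<bullet> ev (e0(vP := P, vn := n)) [] (\<^bold>\<lambda>vi. ifz_c \<cdot> V vi \<cdot> (Succ \<cdot> One) \<cdot> V vn)"
      using P n by (subst ev_val[OF proj_c_type(5,6), symmetric, of e0 "[]"]) (simp add: proj3_c_def)
    then show "val proj3_c \<bullet> P \<bullet> n = g \<bullet> n"
      using *[of n "Succ \<cdot> One"] n pfg v by (simp add: ifz_cases)
  qed
ultimately show "val proj1_c \<bullet> P = e vphi" "val proj2_c \<bullet> P = e vf"
    "val proj3_c \<bullet> P = e vg"
    by (simp_all add: p_def f_def g_def)
qed

end


section \<open>Models of the nonstandard system\<close>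

locale omega_model = model D app con std RCA0_Omega
  for D :: "ty \<Rightarrow> 'd set" and app (infixl "\<bullet>" 90) and con std

sublocale omega_model \<subseteq> arith_model D app con std RCA0_Omega
  by unfold_locales (auto simp: RCA0_Omega_def RCA0_omega_def)

context omega_model
begin

lemma std_closed:
  assumes "t \<^bold>: \<tau>" "fv_trm t = {}"
  shows "std \<tau> (val t)"
proof -
  have "sat e0 [] (St \<tau> t)"
    using assms Standard.st_closed[of t \<tau>] by (intro sat_ax) (auto simp: RCA0_Omega_def)
  then show ?thesis
    using ev_val[OF assms] by simp
qed

lemma std_app:
  assumes "f \<in> D (\<sigma> \<^bold>\<rightarrow> \<tau>)" "x \<in> D \<sigma>" "std (\<sigma> \<^bold>\<rightarrow> \<tau>) f" "std \<sigma> x"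
  shows "std \<tau> (f \<bullet> x)"
proof -
  let ?f = "V (''f'', \<sigma> \<^bold>\<rightarrow> \<tau>)" and ?x = "V (''x'', \<sigma>)"
  let ?e = "e0((''f'', \<sigma> \<^bold>\<rightarrow> \<tau>) := f, (''x'', \<sigma>) := x)"
  have "sat ?e [] (St (\<sigma> \<^bold>\<rightarrow> \<tau>) ?f \<^bold>\<and> St \<sigma> ?x \<^bold>\<longrightarrow> St \<tau> (?f \<cdot> ?x))"
    using assms Standard.st_app[of ?f \<sigma> \<tau> ?x] by (intro sat_ax) (auto simp: RCA0_Omega_def)
  then show ?thesis
    using assms by simp
qed

lemma std_lt:
  assumes "n \<in> D N" "i \<in> D N" "std N n" "lt i n"
  shows "std N i"
proof -
  let ?e = "e0(vi := i, vn := n)"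
  have "sat ?e [] (St N (V vn) \<^bold>\<and> V vi \<^bold>< V vn \<^bold>\<longrightarrow> St N (V vi))"
    using assms Standard.st_less[of "V vi" "V vn"] by (intro sat_ax) (auto simp: RCA0_Omega_def)
  then show ?thesis
    using assms by simp
qed

text \<open>
  Closed terms are standard and application preserves standardness. As bracket abstraction is made of
  constants and application, functionals defined from standard parameters are standard.
\<close>

lemma std_ev:
  "tyof [] t = Some \<tau> \<Longrightarrow> env e \<Longrightarrow> (\<And>v. v \<in> fv_trm t \<Longrightarrow> std (snd v) (e v)) \<Longrightarrow>
    std \<tau> (ev e [] t)"
proof (induction t arbitrary: \<tau> rule: fv_trm.induct)
  case (1 v)
  then show ?case by simp
next
  case (2 s t)
  then obtain \<sigma> where \<sigma>: "s \<^bold>: \<sigma> \<^bold>\<rightarrow> \<tau>" "t \<^bold>: \<sigma>"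
    by (auto simp: tyof_App_iff simp del: tyof.simps(3))
  then have "std (\<sigma> \<^bold>\<rightarrow> \<tau>) (ev e [] s)" "std \<sigma> (ev e [] t)"
    using 2 by auto
  then show ?case
    using std_app[OF ev_D[OF \<sigma>(1)] ev_D[OF \<sigma>(2)]] 2(4) by simp
qed (subst ev_val; (simp; fail)?; rule std_closed; simp)+

text \<open>That \<open>A\<close> has no other free variable than \<open>x\<close> is the reason for coding triples.\<close>

lemma transfer:
  assumes "wff A" "internal A" "fv A \<subseteq> {x}" "env e"
    and "\<And>a. a \<in> D (snd x) \<Longrightarrow> std (snd x) a \<Longrightarrow> sat (e(x := a)) [] A"
    and "a \<in> D (snd x)"
  shows "sat (e(x := a)) [] A"
proof -
  have "sat e [] ((\<^bold>\<forall>\<^sup>s\<^sup>t x. A) \<^bold>\<longrightarrow> (\<^bold>\<forall>x. A))"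
    using assms PF_TP.pftp[of A x] by (intro sat_ax) (auto simp: RCA0_Omega_def)
  then show ?thesis
    using assms by (simp del: fun_upd_apply)
qed

text \<open>
  The axiom \<open>HAC_int\<close> with fresh names for the choice functional and for the index of the correct
  entry, so that they can be dropped from the assignment.
\<close>

lemma choice:
  assumes A: "wff A" "internal A" "x \<noteq> y" and e: "env e"
    and ex: "\<And>a. a \<in> D (snd x) \<Longrightarrow> std (snd x) a \<Longrightarrow>
      \<exists>b\<in>D (snd y). std (snd y) b \<and> sat (e(x := a, y := b)) [] A"
  shows "\<exists>f\<in>D (snd x \<^bold>\<rightarrow> Star (snd y)). std (snd x \<^bold>\<rightarrow> Star (snd y)) f \<and>
    (\<forall>a\<in>D (snd x). std (snd x) a \<longrightarrow>
      (\<exists>j\<in>D N. lt j (len (snd y) (f \<bullet> a)) \<and> sat (e(x := a, y := entry (snd y) (f \<bullet> a) j)) [] A))"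
proof -
  let ?\<rho> = "snd x" and ?\<tau> = "snd y"
  obtain F where F: "snd F = ?\<rho> \<^bold>\<rightarrow> Star ?\<tau>"
      "F \<notin> fv (A \<^bold>\<and> eqf ?\<rho> (V x) (V x) \<^bold>\<and> St ?\<rho> (V x) \<^bold>\<and> St ?\<tau> (V y))"
    using fresh_var by blast
  obtain i where i: "snd i = N"
      "i \<notin> fv (A \<^bold>\<and> St ?\<rho> (V x) \<^bold>\<and> St ?\<tau> (V y) \<^bold>\<and> St (snd F) (V F))"
    using fresh_var by blast
  let ?u = "Prj ?\<tau> \<cdot> (V F \<cdot> V x) \<cdot> V i"
  let ?C = "\<^bold>\<exists>\<^sup>s\<^sup>t F. \<^bold>\<forall>\<^sup>s\<^sup>t x. \<^bold>\<exists>i\<^bold><Len ?\<tau> \<cdot> (V F \<cdot> V x). A\<lbrakk>y ::= ?u\<rbrakk>"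
  have "sat e [] ((\<^bold>\<forall>\<^sup>s\<^sup>t x. \<^bold>\<exists>\<^sup>s\<^sup>t y. A) \<^bold>\<longrightarrow> ?C)"
    using A e F i HAC_int.hac[of A x ?\<rho> y ?\<tau> F i] by (intro sat_ax) (auto simp: RCA0_Omega_def)
  moreover have "sat e [] (\<^bold>\<forall>\<^sup>s\<^sup>t x. \<^bold>\<exists>\<^sup>s\<^sup>t y. A)"
    using A ex by (simp del: fun_upd_apply)
  ultimately have "sat e [] ?C"
    by simp
  moreover have w: "wff (A\<lbrakk>y ::= ?u\<rbrakk>)" "?u \<^bold>: snd y" "Len ?\<tau> \<cdot> (V F \<cdot> V x) \<^bold>: N"
    using A F i by simp_all
  ultimately obtain f where f: "f \<in> D (snd F)" "std (snd F) f"
    "\<And>a. a \<in> D ?\<rho> \<Longrightarrow> std ?\<rho> a \<Longrightarrow> \<exists>j\<in>D N. lt j (ev (e(F := f, x := a)) [] (Len ?\<tau> \<cdot> (V F \<cdot> V x))) \<and>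
      sat (e(F := f, x := a, i := j, y := ev (e(F := f, x := a, i := j)) [] ?u)) [] A"
    using A F i by (auto simp del: fun_upd_apply ev.simps)
  have "sat (e(F := f, x := a, i := j, y := b)) [] A = sat (e(x := a, y := b)) [] A" for a j b
    using A F i by (intro sat_cong[of "[]"]) auto
  then show ?thesis
    using f F i A by (intro bexI[of _ f]) auto
qed

definition approx where "approx f g \<longleftrightarrow> (\<forall>n\<in>D N. std N n \<longrightarrow> f \<bullet> n = g \<bullet> n)"

lemma approx_agree:
  assumes "n \<in> D N" "std N n" "approx f g"
  shows "agree f g n"
  using assms std_lt unfolding approx_def agree_def by blast

text \<open>
  An internal property of the functions infinitely close to \<open>f\<close> holds for all functions that agree
  with \<open>f\<close> up to some standard number: otherwise, by idealisation, a single counterexample would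
  agree with \<open>f\<close> up to every standard number.
\<close>

lemma underspill:
  assumes "p \<in> D T2" "f \<in> D T1"
    and "\<And>g. g \<in> D T1 \<Longrightarrow> approx f g \<Longrightarrow> p \<bullet> g = Z"
  shows "\<exists>n\<in>D N. std N n \<and> (\<forall>g\<in>D T1. agree f g n \<longrightarrow> p \<bullet> g = Z)"
proof (rule ccontr)
  assume neg: "\<not> ?thesis"
  let ?A = "eq_seg (V vf) (V vg) (V vn) \<^bold>\<and> \<^bold>\<not> (V vphi \<cdot> V vg \<^bold>= Zero)"
  let ?e = "e0(vphi := p, vf := f)"
  let ?P = "\<^bold>\<forall>\<^sup>s\<^sup>t vsig. \<^bold>\<exists>vg. \<^bold>\<forall>vi\<^bold><Len N \<cdot> V vsig. ?A\<lbrakk>vn ::= Prj N \<cdot> V vsig \<cdot> V vi\<rbrakk>"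
  have e: "env ?e"
    using assms by simp
  have w: "wff ?A"
    by simp
  have "sat ?e [] (?P \<^bold>\<longrightarrow> (\<^bold>\<exists>vg. \<^bold>\<forall>\<^sup>s\<^sup>t vn. ?A))"
    using e w Idealization.ideal[of ?A vn N vsig vi vg] by (intro sat_ax) (auto simp: RCA0_Omega_def)
  moreover have "sat ?e [] ?P"
  proof -
    have "\<exists>g\<in>D T1. \<forall>i\<in>D N. lt i (len N x) \<longrightarrow> agree f g (entry N x i) \<and> p \<bullet> g \<noteq> Z"
      if x: "x \<in> D (Star N)" "std (Star N) x" for x
    proof -
      let ?m = "ev (e0(vsig := x)) [] (sum_c \<cdot> V vsig \<cdot> (Len N \<cdot> V vsig))"
      have m: "?m \<in> D N" "std N ?m"
        using x ev_D[of "sum_c \<cdot> V vsig \<cdot> (Len N \<cdot> V vsig)" N "e0(vsig := x)"]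
          std_ev[of "sum_c \<cdot> V vsig \<cdot> (Len N \<cdot> V vsig)" N "e0(vsig := x)"] by auto
      then obtain g where "g \<in> D T1" "agree f g ?m" "p \<bullet> g \<noteq> Z"
        using neg by blast
      moreover have "le (entry N x i) ?m" if "i \<in> D N" "lt i (len N x)" for i
        using that x sum_bound[of x i "len N x"] by simp
      ultimately show ?thesis
        using agree_mono m x by (meson entry_D)
    qed
    then show ?thesis
      using assms by simp
  qed
  ultimately have "sat ?e [] (\<^bold>\<exists>vg. \<^bold>\<forall>\<^sup>s\<^sup>t vn. ?A)"
    by simp
  then obtain g where g: "g \<in> D T1" "\<And>n. n \<in> D N \<Longrightarrow> std N n \<Longrightarrow> agree f g n \<and> p \<bullet> g \<noteq> Z"
    using assms by auto
  have "approx f g"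
    unfolding approx_def
  proof (intro ballI HOL.impI)
    fix n assume n: "n \<in> D N" "std N n"
    then have "std N (S n)"
      using std_ev[of "Succ \<cdot> V vn" N "e0(vn := n)"] by simp
    then show "f \<bullet> n = g \<bullet> n"
      using g(2)[of "S n"] n lt_S[of n n] by (simp add: agree_def)
  qed
  moreover have "std N Z"
    using std_closed[of Zero N] by (simp add: val_def)
  ultimately show False
    using g(2)[of Z] assms g(1) by simp
qed


section \<open>The principles in models\<close>

abbreviation "UT \<equiv> T2 \<^bold>\<rightarrow> T1 \<^bold>\<rightarrow> N"
abbreviation "WT \<equiv> T1 \<^bold>\<rightarrow> T2 \<^bold>\<rightarrow> N"
abbreviation "HT \<equiv> T1 \<^bold>\<rightarrow> N \<^bold>\<rightarrow> N"

lemma UT_app [simp]: "u \<in> D UT \<Longrightarrow> p \<in> D T2 \<Longrightarrow> f \<in> D T1 \<Longrightarrow> u \<bullet> p \<bullet> f \<in> D N"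
  and WT_app [simp]: "w \<in> D WT \<Longrightarrow> f \<in> D T1 \<Longrightarrow> p \<in> D T2 \<Longrightarrow> w \<bullet> f \<bullet> p \<in> D N"
  and HT_app [simp]: "h \<in> D HT \<Longrightarrow> f \<in> D T1 \<Longrightarrow> n \<in> D N \<Longrightarrow> h \<bullet> f \<bullet> n \<in> D N"
  and UT_app1 [simp]: "u \<in> D UT \<Longrightarrow> p \<in> D T2 \<Longrightarrow> u \<bullet> p \<in> D T2"
  and HT_app1 [simp]: "h \<in> D HT \<Longrightarrow> f \<in> D T1 \<Longrightarrow> h \<bullet> f \<in> D T1"
  using app_D by blast+

lemma sat_rel_fex [simp]: "wff A \<Longrightarrow> sat e [] (rel (\<^bold>\<exists>v. A)) \<longleftrightarrow>
    (\<exists>d\<in>D (snd v). std (snd v) d \<and> sat (e(v := d)) [] (rel A))"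
  by (simp add: fex_def)

text \<open>What the principles and their relativisations say in a model.\<close>

lemma sat_CONT: "env e \<Longrightarrow> sat e [] CONT \<longleftrightarrow>
    (\<exists>u\<in>D UT. \<forall>p\<in>D T2. \<forall>f\<in>D T1. \<forall>g\<in>D T1. agree f g (u \<bullet> p \<bullet> f) \<longrightarrow> p \<bullet> f = p \<bullet> g)"
  by (auto simp: CONT_def K1_def)

lemma sat_rel_CONT: "env e \<Longrightarrow> sat e [] (rel CONT) \<longleftrightarrow>
    (\<exists>u\<in>D UT. std UT u \<and> (\<forall>p\<in>D T2. std T2 p \<longrightarrow> (\<forall>f\<in>D T1. std T1 f \<longrightarrow>
      (\<forall>g\<in>D T1. std T1 g \<longrightarrow> agree f g (u \<bullet> p \<bullet> f) \<longrightarrow> p \<bullet> f = p \<bullet> g))))"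
  by (auto simp: CONT_def K1_def)

lemma sat_CO_star: "env e \<Longrightarrow> sat e [] CO_star \<longleftrightarrow>
    (\<forall>p\<in>D T2. std T2 p \<longrightarrow> (\<forall>f\<in>D T1. std T1 f \<longrightarrow>
      (\<exists>n\<in>D N. std N n \<and> (\<forall>g\<in>D T1. agree f g n \<longrightarrow> p \<bullet> f = p \<bullet> g))))"
  by (auto simp: CO_star_def)

lemma sat_approx1 [simp]: "sat e [] (approx1 (V (a, T1)) (V (b, T1))) \<longleftrightarrow> approx (e (a, T1)) (e (b, T1))"
  by (simp add: approx1_def approx_def)

lemma sat_CO_frak: "env e \<Longrightarrow> sat e [] CO_frak \<longleftrightarrow>
    (\<forall>p\<in>D T2. std T2 p \<longrightarrow> (\<forall>f\<in>D T1. std T1 f \<longrightarrow>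
      (\<forall>g\<in>D T1. approx f g \<longrightarrow> p \<bullet> f = p \<bullet> g)))"
  by (auto simp: CO_frak_def)

lemma sat_WC_star: "env e \<Longrightarrow> sat e [] WC_star \<longleftrightarrow>
    (\<forall>h\<in>D HT. std HT h \<longrightarrow>
      (\<forall>f\<in>D T1. std T1 f \<longrightarrow> (\<exists>n\<in>D N. std N n \<and> h \<bullet> f \<bullet> n = Z)) \<longrightarrow>
      (\<forall>f\<in>D T1. std T1 f \<longrightarrow> (\<exists>m\<in>D N. std N m \<and> (\<exists>x\<in>D N. std N x \<and>
        (\<forall>g\<in>D T1. agree f g m \<longrightarrow> h \<bullet> g \<bullet> x = Z)))))"
  by (simp add: WC_star_def)

lemma sat_WC_frak: "env e \<Longrightarrow> sat e [] WC_frak \<longleftrightarrow>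
    (\<forall>h\<in>D HT. std HT h \<longrightarrow>
      (\<forall>f\<in>D T1. std T1 f \<longrightarrow> (\<exists>n\<in>D N. std N n \<and> h \<bullet> f \<bullet> n = Z)) \<longrightarrow>
      (\<forall>f\<in>D T1. std T1 f \<longrightarrow> (\<exists>x\<in>D N. std N x \<and>
        (\<forall>g\<in>D T1. approx f g \<longrightarrow> h \<bullet> g \<bullet> x = Z))))"
  by (simp add: WC_frak_def)

lemma sat_UWC: "env e \<Longrightarrow> sat e [] UWC \<longleftrightarrow>
    (\<exists>u\<in>D WT. \<exists>w\<in>D WT. \<forall>h\<in>D HT. \<forall>p\<in>D T2.
      (\<forall>f\<in>D T1. h \<bullet> f \<bullet> (p \<bullet> f) = Z) \<longrightarrow>
      (\<forall>f\<in>D T1. \<forall>g\<in>D T1. agree f g (u \<bullet> f \<bullet> p) \<longrightarrow> h \<bullet> g \<bullet> (w \<bullet> f \<bullet> p) = Z))"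
  by (simp add: UWC_def)

lemma sat_rel_UWC: "env e \<Longrightarrow> sat e [] (rel UWC) \<longleftrightarrow>
    (\<exists>u\<in>D WT. std WT u \<and> (\<exists>w\<in>D WT. std WT w \<and>
      (\<forall>h\<in>D HT. std HT h \<longrightarrow> (\<forall>p\<in>D T2. std T2 p \<longrightarrow>
      (\<forall>f\<in>D T1. std T1 f \<longrightarrow> h \<bullet> f \<bullet> (p \<bullet> f) = Z) \<longrightarrow>
      (\<forall>f\<in>D T1. std T1 f \<longrightarrow> (\<forall>g\<in>D T1. std T1 g \<longrightarrow>
        agree f g (u \<bullet> f \<bullet> p) \<longrightarrow> h \<bullet> g \<bullet> (w \<bullet> f \<bullet> p) = Z))))))"
  by (simp add: UWC_def)

subsection \<open>Continuity\<close>

lemma K1_syntax: "wff K1" "internal K1" "fv K1 = {vUps}"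
  by (auto simp: K1_def)

lemma sat_K1: "env e \<Longrightarrow> sat e [] K1 \<longleftrightarrow>
    (\<forall>p\<in>D T2. \<forall>f\<in>D T1. \<forall>g\<in>D T1. agree f g (e vUps \<bullet> p \<bullet> f) \<longrightarrow> p \<bullet> f = p \<bullet> g)"
  by (simp add: K1_def)

lemma sat_rel_K1: "env e \<Longrightarrow> sat e [] (rel K1) \<longleftrightarrow>
    (\<forall>p\<in>D T2. std T2 p \<longrightarrow> (\<forall>f\<in>D T1. std T1 f \<longrightarrow>
      (\<forall>g\<in>D T1. std T1 g \<longrightarrow> agree f g (e vUps \<bullet> p \<bullet> f) \<longrightarrow> p \<bullet> f = p \<bullet> g)))"
  by (simp add: K1_def)

text \<open>
  By transfer for the negation, a property without parameters that some object has is had by a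
  standard object. A modulus for all arguments is in particular one for the standard arguments.
\<close>

lemma CONT_imp_rel_CONT:
  assumes "env e" "sat e [] CONT"
  shows "sat e [] (rel CONT)"
proof -
  obtain u where u: "u \<in> D UT" "sat (e(vUps := u)) [] K1"
    using assms by (auto simp: CONT_def K1_syntax)
  then obtain v where v: "v \<in> D UT" "std UT v" "sat (e(vUps := v)) [] K1"
    using transfer[of "\<^bold>\<not> K1" vUps e u] K1_syntax assms by auto
  have e: "env (e(vUps := v))"
    using v assms(1) by simp
  have "\<forall>p\<in>D T2. \<forall>f\<in>D T1. \<forall>g\<in>D T1. agree f g (v \<bullet> p \<bullet> f) \<longrightarrow> p \<bullet> f = p \<bullet> g"
    using v(3) unfolding sat_K1[OF e] fun_upd_same .
  then show ?thesis
    unfolding sat_rel_CONT[OF assms(1)] using v by blast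
qed

text \<open>
  Under the relativised continuity principle the constant \<open>Lambda1\<close> is itself a modulus of
  continuity on standard arguments. If \<open>\<sigma>\<close> is the initial segment of \<open>f\<close> of length
  \<open>Lambda1 \<phi> f\<close>, then the associate is defined at \<open>\<sigma>\<close>, so a modulus at \<open>\<sigma> * 00\<dots>\<close> is at most
  the length of \<open>\<sigma>\<close>, and \<open>\<phi>\<close> takes the value \<open>\<phi> f\<close> at \<open>\<sigma> * 00\<dots>\<close>, hence at every
  standard extension of \<open>\<sigma>\<close>. This statement about \<open>Lambda1\<close> has no parameters, and coding its
  three variables by one makes transfer applicable.
\<close>

lemma Lambda1_modulus:
  assumes "sat e0 [] (rel CONT)" and pfg: "p \<in> D T2" "f \<in> D T1" "g \<in> D T1"
  shows "agree f g (con Lambda1 \<bullet> p \<bullet> f) \<Longrightarrow> p \<bullet> f = p \<bullet> g"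
proof -
  let ?L = "con Lambda1"
  have L: "?L \<in> D UT" "std UT ?L"
    using std_closed[of Lambda1 UT] by (simp_all add: val_def)
  obtain u where u: "u \<in> D UT" "std UT u"
    and mod: "\<And>p f g. p \<in> D T2 \<Longrightarrow> std T2 p \<Longrightarrow> f \<in> D T1 \<Longrightarrow> std T1 f \<Longrightarrow> g \<in> D T1 \<Longrightarrow> std T1 g \<Longrightarrow>
      agree f g (u \<bullet> p \<bullet> f) \<Longrightarrow> p \<bullet> f = p \<bullet> g"
    using assms(1) unfolding sat_rel_CONT[OF env_e0] by blast
  have rK: "sat (e0(vUps := u)) [] (rel K1)"
  proof -
    have e: "env (e0(vUps := u))"
      using u by simp
    show ?thesis
      unfolding sat_rel_K1[OF e] fun_upd_same using mod by blast
  qed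
  let ?B = "assoc_c \<cdot> V vphi \<cdot> (V vUps \<cdot> V vphi) \<cdot> seg (V vf) (Lambda1 \<cdot> V vphi \<cdot> V vf)
        \<^bold>= Succ \<cdot> (V vphi \<cdot> V vf)"
  let ?C = "\<^bold>\<forall>\<^sup>s\<^sup>t vUps. rel K1 \<^bold>\<longrightarrow> (\<^bold>\<forall>\<^sup>s\<^sup>t vphi. \<^bold>\<forall>\<^sup>s\<^sup>t vf. ?B)"
  have "?C \<in> RCA0_Omega"
    using Constants.Lambda1_def unfolding RCA0_Omega_def by blast
  moreover have "wff ?C"
    by (simp add: K1_syntax seg_def)
  ultimately have "sat e0 [] ?C"
    by (rule sat_ax) simp
  then have "sat (e0(vUps := u)) [] (\<^bold>\<forall>\<^sup>s\<^sup>t vphi. \<^bold>\<forall>\<^sup>s\<^sup>t vf. ?B)"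
    using u rK by (simp add: K1_syntax seg_def)
  then have assoc: "val assoc_c \<bullet> p \<bullet> (u \<bullet> p) \<bullet> (con (Mk N) \<bullet> (?L \<bullet> p \<bullet> f) \<bullet> f) = S (p \<bullet> f)"
    if "p \<in> D T2" "std T2 p" "f \<in> D T1" "std T1 f" for p f
    using that by (simp add: seg_def)
  have std_case: "p \<bullet> f = p \<bullet> g"
    if p: "p \<in> D T2" "std T2 p" and f: "f \<in> D T1" "std T1 f" and g: "g \<in> D T1" "std T1 g"
      and ag: "agree f g (?L \<bullet> p \<bullet> f)" for p f g
  proof -
    let ?n = "?L \<bullet> p \<bullet> f"
    let ?x = "con (Mk N) \<bullet> ?n \<bullet> f"
    let ?h = "val ext0_c \<bullet> ?x"
    have n: "?n \<in> D N"
      using L p f by simp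
    have "std T1 (ev (e0(vphi := p, vf := f)) [] (ext0_c \<cdot> (Mk N \<cdot> (Lambda1 \<cdot> V vphi \<cdot> V vf) \<cdot> V vf)))"
      by (rule std_ev) (use p f in auto)
    moreover have "ev (e0(vphi := p, vf := f)) [] (ext0_c \<cdot> (Mk N \<cdot> (Lambda1 \<cdot> V vphi \<cdot> V vf) \<cdot> V vf)) \<in> D T1"
      by (rule ev_D) (use p f in auto)
    ultimately have h: "?h \<in> D T1" "std T1 ?h"
      by simp_all
    have le: "le (u \<bullet> p \<bullet> ?h) ?n" and ph: "p \<bullet> ?h = p \<bullet> f"
      using assoc_pos[OF p(1) _ _ _ assoc[OF p f]] n p f u by auto
    have "agree ?h g ?n"
      using ag n f by (simp add: agree_def ext0_app)
    then have "agree ?h g (u \<bullet> p \<bullet> ?h)"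
      using agree_mono le n u p h by simp
    then show "p \<bullet> f = p \<bullet> g"
      using mod[OF p h g] ph by metis
  qed
  let ?p = "proj1_c \<cdot> V vP" and ?f = "proj2_c \<cdot> V vP" and ?g = "proj3_c \<cdot> V vP"
  let ?A = "eq_seg ?f ?g (Lambda1 \<cdot> ?p \<cdot> ?f) \<^bold>\<longrightarrow> ?p \<cdot> ?f \<^bold>= ?p \<cdot> ?g"
  let ?P = "ev (e0(vphi := p, vf := f, vg := g)) [] triple_c"
  have P: "?P \<in> D T2" "val proj1_c \<bullet> ?P = p" "val proj2_c \<bullet> ?P = f" "val proj3_c \<bullet> ?P = g"
    using triple[of "e0(vphi := p, vf := f, vg := g)"] pfg by simp_all
  have "sat (e0(vP := ?P)) [] ?A"
  proof (rule transfer)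
    fix P assume P: "P \<in> D (snd vP)" "std (snd vP) P"
    then have "std T2 (val proj1_c \<bullet> P)" "std T1 (val proj2_c \<bullet> P)" "std T1 (val proj3_c \<bullet> P)"
      using std_ev[of ?p T2 "e0(vP := P)"] std_ev[of ?f T1 "e0(vP := P)"]
        std_ev[of ?g T1 "e0(vP := P)"] by auto
    then show "sat (e0(vP := P)) [] ?A"
      using P std_case[of "val proj1_c \<bullet> P" "val proj2_c \<bullet> P" "val proj3_c \<bullet> P"] by simp
  qed (use P in auto)
  then show "agree f g (?L \<bullet> p \<bullet> f) \<Longrightarrow> p \<bullet> f = p \<bullet> g"
    using P by simp
qed

lemma rel_CONT_imp_CONT: "sat e0 [] (rel CONT) \<Longrightarrow> sat e0 [] CONT"
  unfolding sat_CONT[OF env_e0] using Lambda1_modulus con_types(9) by blast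

lemma rel_CONT_imp_CO_star:
  assumes "sat e0 [] (rel CONT)"
  shows "sat e0 [] CO_star"
  unfolding sat_CO_star[OF env_e0]
proof (intro ballI HOL.impI)
  fix p f assume pf: "p \<in> D T2" "std T2 p" "f \<in> D T1" "std T1 f"
  have "std UT (con Lambda1)"
    using std_closed[of Lambda1 UT] by (simp add: val_def)
  then have "con Lambda1 \<bullet> p \<bullet> f \<in> D N" "std N (con Lambda1 \<bullet> p \<bullet> f)"
    using pf std_app[of "con Lambda1" T2 T2 p] std_app[of "con Lambda1 \<bullet> p" T1 N f] by simp_all
  then show "\<exists>n\<in>D N. std N n \<and> (\<forall>g\<in>D T1. agree f g n \<longrightarrow> p \<bullet> f = p \<bullet> g)"
    using Lambda1_modulus[OF assms] pf by blast
qed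

text \<open>
  Choice gives, for each standard pair of \<open>p\<close> and \<open>f\<close>, finitely many candidates for a number up to
  which agreement suffices. Their sum is at least the correct one, and agreement further out is a
  stronger condition. The pair is coded as the triple of \<open>p\<close>, \<open>f\<close> and again \<open>f\<close>.
\<close>

lemma CO_star_imp_rel_CONT:
  assumes "sat e0 [] CO_star"
  shows "sat e0 [] (rel CONT)"
proof -
  let ?p = "proj1_c \<cdot> V vP" and ?f = "proj2_c \<cdot> V vP"
  let ?A = "\<^bold>\<forall>vg. eq_seg ?f (V vg) (V vN) \<^bold>\<longrightarrow> ?p \<cdot> ?f \<^bold>= ?p \<cdot> V vg"
  have "\<exists>F\<in>D (snd vP \<^bold>\<rightarrow> Star (snd vN)). std (snd vP \<^bold>\<rightarrow> Star (snd vN)) F \<and>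
    (\<forall>P\<in>D (snd vP). std (snd vP) P \<longrightarrow> (\<exists>j\<in>D N. lt j (len (snd vN) (F \<bullet> P)) \<and>
      sat (e0(vP := P, vN := entry (snd vN) (F \<bullet> P) j)) [] ?A))"
  proof (rule choice)
    fix P assume P: "P \<in> D (snd vP)" "std (snd vP) P"
    then have "std T2 (val proj1_c \<bullet> P)" "std T1 (val proj2_c \<bullet> P)"
      using std_ev[of ?p T2 "e0(vP := P)"] std_ev[of ?f T1 "e0(vP := P)"] by auto
    then show "\<exists>n\<in>D (snd vN). std (snd vN) n \<and> sat (e0(vP := P, vN := n)) [] ?A"
      using P assms unfolding sat_CO_star[OF env_e0] by simp
  qed auto
  then obtain F where F: "F \<in> D (T2 \<^bold>\<rightarrow> Star N)" "std (T2 \<^bold>\<rightarrow> Star N) F"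
    "\<And>P. P \<in> D T2 \<Longrightarrow> std T2 P \<Longrightarrow> \<exists>j\<in>D N. lt j (len N (F \<bullet> P)) \<and>
      sat (e0(vP := P, vN := entry N (F \<bullet> P) j)) [] ?A"
    by auto
  let ?vF = "(''F'', T2 \<^bold>\<rightarrow> Star N)"
  let ?P = "(\<^bold>\<lambda>vg. triple_c) \<cdot> V vf"
  let ?t = "\<^bold>\<lambda>vphi. \<^bold>\<lambda>vf. sum_c \<cdot> (V ?vF \<cdot> ?P) \<cdot> (Len N \<cdot> (V ?vF \<cdot> ?P))"
  let ?u = "ev (e0(?vF := F)) [] ?t"
  have u: "?u \<in> D UT" "std UT ?u"
    by (rule ev_D; use F triple_c_type in simp) (rule std_ev; use F triple_c_type in auto)
  have "p \<bullet> f = p \<bullet> g"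
    if p: "p \<in> D T2" "std T2 p" and f: "f \<in> D T1" "std T1 f" and g: "g \<in> D T1"
      and ag: "agree f g (?u \<bullet> p \<bullet> f)" for p f g
  proof -
    let ?e = "e0(?vF := F, vphi := p, vf := f, vg := f)"
    let ?Q = "ev ?e [] triple_c"
    have e: "env ?e"
      using F p f by simp
    have "std T2 ?Q"
      by (rule std_ev[OF triple_c_type(1) e]) (use triple_c_type(2) p f in auto)
    then have Q: "?Q \<in> D T2" "val proj1_c \<bullet> ?Q = p" "val proj2_c \<bullet> ?Q = f" "std T2 ?Q"
      using triple[OF e] by simp_all
    have FQ: "F \<bullet> ?Q \<in> D (Star N)"
      using F Q app_D by blast
    obtain j where j: "j \<in> D N" "lt j (len N (F \<bullet> ?Q))"
      "sat (e0(vP := ?Q, vN := entry N (F \<bullet> ?Q) j)) [] ?A"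
      using F(3)[OF Q(1,4)] by blast
    have up: "?u \<bullet> p \<bullet> f = val sum_c \<bullet> (F \<bullet> ?Q) \<bullet> len N (F \<bullet> ?Q)"
      using F p f triple_c_type by simp
    have "le (entry N (F \<bullet> ?Q) j) (?u \<bullet> p \<bullet> f)"
      unfolding up using FQ j by (intro sum_bound) auto
    moreover have "?u \<bullet> p \<bullet> f \<in> D N"
      using u p f by simp
    ultimately have "agree f g (entry N (F \<bullet> ?Q) j)"
      using ag agree_mono FQ j by simp
    then show "p \<bullet> f = p \<bullet> g"
      using j(3) Q g FQ j(1) by simp
  qed
  then show ?thesis
    unfolding sat_rel_CONT[OF env_e0] using u by blast
qed

text \<open>
  Infinitely close functions agree up to every standard number. Conversely, underspill applies to
  the functional that tests \<open>p f = p g\<close>.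
\<close>

lemma CO_frak_iff_CO_star: "sat e0 [] CO_frak \<longleftrightarrow> sat e0 [] CO_star"
proof
  assume CO: "sat e0 [] CO_frak"
  show "sat e0 [] CO_star"
    unfolding sat_CO_star[OF env_e0]
  proof (intro ballI HOL.impI)
    fix p f assume pf: "p \<in> D T2" "std T2 p" "f \<in> D T1" "std T1 f"
    let ?q = "ev (e0(vphi := p, vf := f)) [] (\<^bold>\<lambda>vg. eqt_c \<cdot> (V vphi \<cdot> V vf) \<cdot> (V vphi \<cdot> V vg))"
    have q: "?q \<in> D T2"
      using pf by (intro ev_D) auto
    have eq: "?q \<bullet> g = Z \<longleftrightarrow> p \<bullet> f = p \<bullet> g" if "g \<in> D T1" for g
      using that pf by simp
    have "\<exists>n\<in>D N. std N n \<and> (\<forall>g\<in>D T1. agree f g n \<longrightarrow> ?q \<bullet> g = Z)"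
      using CO pf eq unfolding sat_CO_frak[OF env_e0] by (intro underspill[OF q]) auto
    then show "\<exists>n\<in>D N. std N n \<and> (\<forall>g\<in>D T1. agree f g n \<longrightarrow> p \<bullet> f = p \<bullet> g)"
      using eq by blast
  qed
next
  assume "sat e0 [] CO_star"
  then show "sat e0 [] CO_frak"
    unfolding sat_CO_star[OF env_e0] sat_CO_frak[OF env_e0] by (blast dest: approx_agree)
qed

subsection \<open>Weak continuity for relations\<close>

text \<open>
  A class of objects closed under definability: all objects, or the standard ones. This treats the
  uniform principles and their relativisations together.
\<close>

definition definably_closed :: "(ty \<Rightarrow> 'd \<Rightarrow> bool) \<Rightarrow> bool" where
  "definably_closed R \<longleftrightarrow> (\<forall>t \<tau> e. t \<^bold>: \<tau> \<longrightarrow> env e \<longrightarrow> (\<forall>v\<in>fv_trm t. R (snd v) (e v)) \<longrightarrow> R \<tau> (ev e [] t))"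

definition CONT_on where
  "CONT_on R \<longleftrightarrow> (\<exists>u\<in>D UT. R UT u \<and> (\<forall>p\<in>D T2. R T2 p \<longrightarrow> (\<forall>f\<in>D T1. R T1 f \<longrightarrow>
      (\<forall>g\<in>D T1. R T1 g \<longrightarrow> agree f g (u \<bullet> p \<bullet> f) \<longrightarrow> p \<bullet> f = p \<bullet> g))))"

definition UWC_on where
  "UWC_on R \<longleftrightarrow> (\<exists>u\<in>D WT. R WT u \<and> (\<exists>w\<in>D WT. R WT w \<and>
      (\<forall>h\<in>D HT. R HT h \<longrightarrow> (\<forall>p\<in>D T2. R T2 p \<longrightarrow>
      (\<forall>f\<in>D T1. R T1 f \<longrightarrow> h \<bullet> f \<bullet> (p \<bullet> f) = Z) \<longrightarrow>
      (\<forall>f\<in>D T1. R T1 f \<longrightarrow> (\<forall>g\<in>D T1. R T1 g \<longrightarrow>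
        agree f g (u \<bullet> f \<bullet> p) \<longrightarrow> h \<bullet> g \<bullet> (w \<bullet> f \<bullet> p) = Z))))))"

text \<open>The relation \<open>p f = n\<close>, with \<open>p\<close> as the value of \<open>vphi\<close>.\<close>

definition graph_c :: trm where
  "graph_c = (\<^bold>\<lambda>vf. \<^bold>\<lambda>vn. eqt_c \<cdot> (V vphi \<cdot> V vf) \<cdot> V vn)"

lemma graph_c_type: "graph_c \<^bold>: HT" "fv_trm graph_c = {vphi}"
  by (auto simp: graph_c_def)

lemma graph:
  assumes "p \<in> D T2"
  shows "ev (e0(vphi := p)) [] graph_c \<in> D HT"
    and "f \<in> D T1 \<Longrightarrow> n \<in> D N \<Longrightarrow> ev (e0(vphi := p)) [] graph_c \<bullet> f \<bullet> n = Z \<longleftrightarrow> p \<bullet> f = n"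
  using assms ev_D[OF graph_c_type(1), of "e0(vphi := p)"] by (simp_all add: graph_c_def)

text \<open>
  If \<open>\<psi>\<close> is a choice functional for \<open>H\<close>, then within a modulus of continuity of \<open>\<psi>\<close> at \<open>f\<close> the value
  \<open>\<psi> f\<close> remains a correct choice. Conversely, the only choice functional for the graph of \<open>\<phi>\<close> is
  \<open>\<phi>\<close> itself, and a value that is correct near \<open>f\<close> shows that \<open>\<phi>\<close> is constant there.
\<close>

lemma UWC_on_iff_CONT_on:
  assumes R: "definably_closed R"
  shows "UWC_on R \<longleftrightarrow> CONT_on R"
proof
  note R = R[unfolded definably_closed_def, rule_format]
  assume "CONT_on R"
  then obtain u where u: "u \<in> D UT" "R UT u"
    and mod: "\<And>p f g. p \<in> D T2 \<Longrightarrow> R T2 p \<Longrightarrow> f \<in> D T1 \<Longrightarrow> R T1 f \<Longrightarrow> g \<in> D T1 \<Longrightarrow> R T1 g \<Longrightarrow>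
      agree f g (u \<bullet> p \<bullet> f) \<Longrightarrow> p \<bullet> f = p \<bullet> g"
    unfolding CONT_on_def by blast
  let ?s = "\<^bold>\<lambda>vf. \<^bold>\<lambda>vpsi. V vUps \<cdot> V vpsi \<cdot> V vf" and ?t = "\<^bold>\<lambda>vf. \<^bold>\<lambda>vpsi. V vpsi \<cdot> V vf"
  let ?u = "ev (e0(vUps := u)) [] ?s" and ?w = "ev e0 [] ?t"
  have D: "?u \<in> D WT" "?w \<in> D WT" "R WT ?u" "R WT ?w"
    using u by (auto intro!: ev_D R)
  show "UWC_on R"
    unfolding UWC_on_def
  proof (rule bexI[of _ ?u], rule conjI, rule D(3), rule bexI[of _ ?w], rule conjI, rule D(4),
      intro ballI HOL.impI)
    fix h p f g
    assume a: "h \<in> D HT" "R HT h" "p \<in> D T2" "R T2 p" "f \<in> D T1" "R T1 f" "g \<in> D T1" "R T1 g"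
      and h: "\<forall>f\<in>D T1. R T1 f \<longrightarrow> h \<bullet> f \<bullet> (p \<bullet> f) = Z" and ag: "agree f g (?u \<bullet> f \<bullet> p)"
    have "p \<bullet> f = p \<bullet> g"
      by (rule mod) (use ag a u in auto)
    moreover have "?w \<bullet> f \<bullet> p = p \<bullet> f"
      using a by simp
    ultimately show "h \<bullet> g \<bullet> (?w \<bullet> f \<bullet> p) = Z"
      using h a by simp
  qed (rule D)+
next
  note R = R[unfolded definably_closed_def, rule_format]
  assume "UWC_on R"
  then obtain u w where u: "u \<in> D WT" "R WT u" and w: "w \<in> D WT" "R WT w"
    and uwc: "\<forall>h\<in>D HT. R HT h \<longrightarrow> (\<forall>p\<in>D T2. R T2 p \<longrightarrow>
      (\<forall>f\<in>D T1. R T1 f \<longrightarrow> h \<bullet> f \<bullet> (p \<bullet> f) = Z) \<longrightarrow>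
      (\<forall>f\<in>D T1. R T1 f \<longrightarrow> (\<forall>g\<in>D T1. R T1 g \<longrightarrow>
        agree f g (u \<bullet> f \<bullet> p) \<longrightarrow> h \<bullet> g \<bullet> (w \<bullet> f \<bullet> p) = Z)))"
    unfolding UWC_on_def by blast
  let ?s = "\<^bold>\<lambda>vphi. \<^bold>\<lambda>vf. V vPsi1 \<cdot> V vf \<cdot> V vphi"
  let ?u = "ev (e0(vPsi1 := u)) [] ?s"
  have D: "?u \<in> D UT" "R UT ?u"
    using u by (auto intro!: ev_D R)
  show "CONT_on R"
    unfolding CONT_on_def
  proof (intro bexI[of _ ?u] conjI ballI HOL.impI D)
    fix p f g
    assume a: "p \<in> D T2" "R T2 p" "f \<in> D T1" "R T1 f" "g \<in> D T1" "R T1 g"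
      and ag: "agree f g (?u \<bullet> p \<bullet> f)"
    let ?h = "ev (e0(vphi := p)) [] graph_c"
    have h: "?h \<in> D HT" "R HT ?h"
      using graph(1) a graph_c_type by (auto intro!: R)
    have "\<forall>f\<in>D T1. R T1 f \<longrightarrow> ?h \<bullet> f \<bullet> (p \<bullet> f) = Z"
      using graph(2)[OF a(1)] a(1) by simp
    then have "?h \<bullet> g' \<bullet> (w \<bullet> f \<bullet> p) = Z" if "g' \<in> D T1" "R T1 g'" "agree f g' (u \<bullet> f \<bullet> p)" for g'
      using uwc h a that by blast
    then have "p \<bullet> g' = w \<bullet> f \<bullet> p" if "g' \<in> D T1" "R T1 g'" "agree f g' (u \<bullet> f \<bullet> p)" for g'
      using that graph(2)[of p g' "w \<bullet> f \<bullet> p"] a w by simp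
    from this[of f] this[of g] show "p \<bullet> f = p \<bullet> g"
      using a ag u by simp
  qed
qed

text \<open>
  From the finitely many candidates that choice gives, search selects a correct one; this defines a
  standard choice functional \<open>q\<close> for \<open>h\<close>. Where both \<open>q\<close> and \<open>p = (\<lambda>f. h f (q f))\<close> are constant, the
  value \<open>q f\<close> is correct throughout.
\<close>

lemma CO_star_imp_WC_star:
  assumes "sat e0 [] CO_star"
  shows "sat e0 [] WC_star"
  unfolding sat_WC_star[OF env_e0]
proof (intro ballI HOL.impI)
  fix h f
  assume h: "h \<in> D HT" "std HT h"
    and ex: "\<forall>f\<in>D T1. std T1 f \<longrightarrow> (\<exists>n\<in>D N. std N n \<and> h \<bullet> f \<bullet> n = Z)"
    and f: "f \<in> D T1" "std T1 f"
  let ?A = "V vH \<cdot> V vf \<cdot> V vn \<^bold>= Zero"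
  have "\<exists>F\<in>D (snd vf \<^bold>\<rightarrow> Star (snd vn)). std (snd vf \<^bold>\<rightarrow> Star (snd vn)) F \<and>
    (\<forall>f\<in>D (snd vf). std (snd vf) f \<longrightarrow> (\<exists>j\<in>D N. lt j (len (snd vn) (F \<bullet> f)) \<and>
      sat (e0(vH := h, vf := f, vn := entry (snd vn) (F \<bullet> f) j)) [] ?A))"
    by (rule choice) (use h ex in auto)
  then obtain F where F: "F \<in> D (T1 \<^bold>\<rightarrow> Star N)" "std (T1 \<^bold>\<rightarrow> Star N) F"
    "\<And>f. f \<in> D T1 \<Longrightarrow> std T1 f \<Longrightarrow> \<exists>j\<in>D N. lt j (len N (F \<bullet> f)) \<and> h \<bullet> f \<bullet> entry N (F \<bullet> f) j = Z"
    by auto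
  let ?vF = "(''F'', T1 \<^bold>\<rightarrow> Star N)"
  let ?s = "\<^bold>\<lambda>vf. search_c \<cdot> (V vH \<cdot> V vf) \<cdot> (V ?vF \<cdot> V vf) \<cdot> (Len N \<cdot> (V ?vF \<cdot> V vf))"
  let ?q = "ev (e0(vH := h, ?vF := F)) [] ?s"
  let ?t = "\<^bold>\<lambda>vf. V vH \<cdot> V vf \<cdot> (V vpsi \<cdot> V vf)"
  let ?p = "ev (e0(vH := h, vpsi := ?q)) [] ?t"
  have q: "?q \<in> D T2" "std T2 ?q"
    using F h by (auto intro!: ev_D std_ev)
  have p: "?p \<in> D T2" "std T2 ?p"
    using q h by (auto intro!: ev_D std_ev simp del: fun_upd_apply) (auto simp: fun_upd_apply)
  have pv: "?p \<bullet> g = h \<bullet> g \<bullet> (?q \<bullet> g)" if "g \<in> D T1" for g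
    using that q h by simp
  have zero: "?p \<bullet> f = Z"
  proof -
    obtain j where j: "j \<in> D N" "lt j (len N (F \<bullet> f))" "h \<bullet> f \<bullet> entry N (F \<bullet> f) j = Z"
      using F(3) f by blast
    have Ff: "F \<bullet> f \<in> D (Star N)"
      using F f app_D by blast
    have "?q \<bullet> f = val search_c \<bullet> (h \<bullet> f) \<bullet> (F \<bullet> f) \<bullet> len N (F \<bullet> f)"
      using F h f by simp
    then show ?thesis
      using search_finds[of "h \<bullet> f" "F \<bullet> f" j "len N (F \<bullet> f)"] j Ff h f pv by simp
  qed
  obtain m where m: "m \<in> D N" "std N m" "\<forall>g\<in>D T1. agree f g m \<longrightarrow> ?p \<bullet> f = ?p \<bullet> g"
    using assms p f unfolding sat_CO_star[OF env_e0] by blast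
  obtain n where n: "n \<in> D N" "std N n" "\<forall>g\<in>D T1. agree f g n \<longrightarrow> ?q \<bullet> f = ?q \<bullet> g"
    using assms q f unfolding sat_CO_star[OF env_e0] by blast
  have "std N (ev (e0(vm := m, vn := n)) [] (add_c \<cdot> V vm \<cdot> V vn))"
    by (rule std_ev) (use m n in auto)
  then have mn: "m \<oplus> n \<in> D N" "std N (m \<oplus> n)"
    using m n by simp_all
  have "h \<bullet> g \<bullet> (?q \<bullet> f) = Z" if g: "g \<in> D T1" "agree f g (m \<oplus> n)" for g
  proof -
    have "agree f g m" "agree f g n"
      using agree_mono[OF g(2)] m n mn le_plus1 le_plus2 by auto
    then show ?thesis
      using m n g pv[OF g(1)] zero by metis
  qed
  moreover have "?q \<bullet> f \<in> D N" "std N (?q \<bullet> f)"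
    using q f std_app by auto
  ultimately show "\<exists>m\<in>D N. std N m \<and> (\<exists>x\<in>D N. std N x \<and> (\<forall>g\<in>D T1. agree f g m \<longrightarrow> h \<bullet> g \<bullet> x = Z))"
    using mn by blast
qed

text \<open>
  In the graph of \<open>p\<close>, a number \<open>x\<close> that is correct for all functions near \<open>f\<close> is the value of \<open>p\<close> at
  each of them, \<open>f\<close> included.
\<close>

lemma WC_star_imp_CO_star:
  assumes "sat e0 [] WC_star"
  shows "sat e0 [] CO_star"
  unfolding sat_CO_star[OF env_e0]
proof (intro ballI HOL.impI)
  fix p f assume p: "p \<in> D T2" "std T2 p" and f: "f \<in> D T1" "std T1 f"
  let ?h = "ev (e0(vphi := p)) [] graph_c"
  have h: "?h \<in> D HT" "std HT ?h"
    using graph(1) p graph_c_type by (auto intro!: std_ev)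
  have "\<exists>n\<in>D N. std N n \<and> ?h \<bullet> f \<bullet> n = Z" if "f \<in> D T1" "std T1 f" for f
    using that p graph(2) std_app by (intro bexI[of _ "p \<bullet> f"]) auto
  then obtain m x where mx: "m \<in> D N" "std N m" "x \<in> D N"
    "\<forall>g\<in>D T1. agree f g m \<longrightarrow> ?h \<bullet> g \<bullet> x = Z"
    using assms h f unfolding sat_WC_star[OF env_e0] by blast
  then have "\<forall>g\<in>D T1. agree f g m \<longrightarrow> p \<bullet> g = x"
    using graph(2) p by blast
  then have "\<forall>g\<in>D T1. agree f g m \<longrightarrow> p \<bullet> f = p \<bullet> g"
    using f by simp
  then show "\<exists>n\<in>D N. std N n \<and> (\<forall>g\<in>D T1. agree f g n \<longrightarrow> p \<bullet> f = p \<bullet> g)"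
    using mx by blast
qed

text \<open>For a fixed \<open>x\<close>, underspill applies to the functional \<open>\<lambda>g. h g x\<close>.\<close>

lemma WC_star_iff_WC_frak: "sat e0 [] WC_star \<longleftrightarrow> sat e0 [] WC_frak"
proof
  assume WC: "sat e0 [] WC_star"
  show "sat e0 [] WC_frak"
    unfolding sat_WC_frak[OF env_e0]
  proof (intro ballI HOL.impI)
    fix h f
    assume h: "h \<in> D HT" "std HT h" "\<forall>f\<in>D T1. std T1 f \<longrightarrow> (\<exists>n\<in>D N. std N n \<and> h \<bullet> f \<bullet> n = Z)"
      and f: "f \<in> D T1" "std T1 f"
    obtain m x where m: "m \<in> D N" "std N m" and x: "x \<in> D N" "std N x"
      and "\<forall>g\<in>D T1. agree f g m \<longrightarrow> h \<bullet> g \<bullet> x = Z"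
      using WC[unfolded sat_WC_star[OF env_e0], THEN bspec, OF h(1), THEN HOL.mp, OF h(2),
          THEN HOL.mp, OF h(3), THEN bspec, OF f(1), THEN HOL.mp, OF f(2)] by blast
    then show "\<exists>x\<in>D N. std N x \<and> (\<forall>g\<in>D T1. approx f g \<longrightarrow> h \<bullet> g \<bullet> x = Z)"
      using approx_agree[OF m] by blast
  qed
next
  assume WC: "sat e0 [] WC_frak"
  show "sat e0 [] WC_star"
    unfolding sat_WC_star[OF env_e0]
  proof (intro ballI HOL.impI)
    fix h f
    assume h: "h \<in> D HT" "std HT h"
      and ex: "\<forall>f\<in>D T1. std T1 f \<longrightarrow> (\<exists>n\<in>D N. std N n \<and> h \<bullet> f \<bullet> n = Z)"
      and f: "f \<in> D T1" "std T1 f"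
    obtain x where x: "x \<in> D N" "std N x" "\<forall>g\<in>D T1. approx f g \<longrightarrow> h \<bullet> g \<bullet> x = Z"
      using WC h ex f unfolding sat_WC_frak[OF env_e0] by blast
    let ?p = "ev (e0(vH := h, vx := x)) [] (\<^bold>\<lambda>vg. V vH \<cdot> V vg \<cdot> V vx)"
    have p: "?p \<in> D T2"
      using h x by (intro ev_D) auto
    have pv: "?p \<bullet> g = h \<bullet> g \<bullet> x" if "g \<in> D T1" for g
      using that h x by simp
    have "\<exists>m\<in>D N. std N m \<and> (\<forall>g\<in>D T1. agree f g m \<longrightarrow> ?p \<bullet> g = Z)"
      by (rule underspill[OF p f(1)]) (use x pv in auto)
    then show "\<exists>m\<in>D N. std N m \<and> (\<exists>x\<in>D N. std N x \<and> (\<forall>g\<in>D T1. agree f g m \<longrightarrow> h \<bullet> g \<bullet> x = Z))"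
      using x pv by metis
  qed
qed

lemma sat_CONT_on: "sat e0 [] CONT \<longleftrightarrow> CONT_on (\<lambda>_ _. True)"
  by (simp add: sat_CONT CONT_on_def)

lemma sat_rel_CONT_on: "sat e0 [] (rel CONT) \<longleftrightarrow> CONT_on std"
  by (simp add: sat_rel_CONT CONT_on_def)

lemma sat_UWC_on: "sat e0 [] UWC \<longleftrightarrow> UWC_on (\<lambda>_ _. True)"
  by (simp add: sat_UWC UWC_on_def)

lemma sat_rel_UWC_on: "sat e0 [] (rel UWC) \<longleftrightarrow> UWC_on std"
  by (simp add: sat_rel_UWC UWC_on_def)

lemma UWC_iff_CONT: "sat e0 [] UWC \<longleftrightarrow> sat e0 [] CONT"
  and rel_UWC_iff_rel_CONT: "sat e0 [] (rel UWC) \<longleftrightarrow> sat e0 [] (rel CONT)"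
  using UWC_on_iff_CONT_on[of "\<lambda>_ _. True"] UWC_on_iff_CONT_on[of std] std_ev
  by (auto simp: sat_CONT_on sat_rel_CONT_on sat_UWC_on sat_rel_UWC_on definably_closed_def)

lemma principles_equivalent:
  "sat e0 [] (rel UWC) \<longleftrightarrow> sat e0 [] UWC"
  "sat e0 [] WC_star \<longleftrightarrow> sat e0 [] UWC"
  "sat e0 [] WC_frak \<longleftrightarrow> sat e0 [] UWC"
  "sat e0 [] CONT \<longleftrightarrow> sat e0 [] UWC"
  "sat e0 [] (rel CONT) \<longleftrightarrow> sat e0 [] UWC"
  "sat e0 [] CO_frak \<longleftrightarrow> sat e0 [] UWC"
  "sat e0 [] CO_star \<longleftrightarrow> sat e0 [] UWC"
  using UWC_iff_CONT rel_UWC_iff_rel_CONT CONT_imp_rel_CONT[OF env_e0] rel_CONT_imp_CONT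
    rel_CONT_imp_CO_star CO_star_imp_rel_CONT CO_frak_iff_CO_star CO_star_imp_WC_star
    WC_star_imp_CO_star WC_star_iff_WC_frak by blast+

end

text \<open>Sentences do not depend on the assignment, so it suffices to consider the default one.\<close>

lemma provable_iff:
  assumes "wff A" "wff B" "fv A = {}" "fv B = {}"
    and eq: "\<And>(D :: ty \<Rightarrow> trm set) app con std. omega_model D app con std \<Longrightarrow>
      interp.sat D app con std (model.e0 D) [] A \<longleftrightarrow> interp.sat D app con std (model.e0 D) [] B"
  shows "RCA0_Omega \<turnstile> A \<^bold>\<longleftrightarrow> B"
proof (rule completeness)
  show "EPRA \<subseteq> RCA0_Omega" "Standard \<subseteq> RCA0_Omega"
    by (auto simp: RCA0_Omega_def RCA0_omega_def)
  fix D :: "ty \<Rightarrow> trm set" and app con std e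
  assume m: "model D app con std RCA0_Omega"
  then interpret omega_model D app con std
    by (simp add: omega_model_def)
  have "sat e [] A = sat e0 [] A" "sat e [] B = sat e0 [] B"
    using assms(1-4) sat_cong[of "[]" A "[]" e e0] sat_cong[of "[]" B "[]" e e0] by simp_all
  then show "sat e [] (A \<^bold>\<longleftrightarrow> B)"
    using eq[OF omega_model_axioms] by simp
qed (use assms in auto)

theorem theorem5p5:
  shows "(RCA0_Omega \<turnstile> UWC \<^bold>\<longleftrightarrow> rel UWC) \<and>
         (RCA0_Omega \<turnstile> rel UWC \<^bold>\<longleftrightarrow> WC_star) \<and>
         (RCA0_Omega \<turnstile> WC_star \<^bold>\<longleftrightarrow> WC_frak) \<and>
         (RCA0_Omega \<turnstile> WC_frak \<^bold>\<longleftrightarrow> CONT) \<and>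
         (RCA0_Omega \<turnstile> CONT \<^bold>\<longleftrightarrow> rel CONT) \<and>
         (RCA0_Omega \<turnstile> rel CONT \<^bold>\<longleftrightarrow> CO_frak) \<and>
         (RCA0_Omega \<turnstile> CO_frak \<^bold>\<longleftrightarrow> CO_star)"
proof -
  note principles = UWC_def WC_star_def WC_frak_def CONT_def K1_def CO_frak_def CO_star_def approx1_def
  have wff: "wff UWC" "wff WC_star" "wff WC_frak" "wff CONT" "wff CO_frak" "wff CO_star"
    by (simp_all add: principles)
  have fv: "fv UWC = {}" "fv WC_star = {}" "fv WC_frak = {}" "fv CONT = {}" "fv CO_frak = {}"
    "fv CO_star = {}"
    by (auto simp: principles)
  show ?thesis
    by (intro conjI provable_iff)
      (simp_all add: wff fv fv_rel omega_model.principles_equivalent)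
qed

end
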